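(* Let $A_N$ and $B_N$ be independent $N\times N$ random matrices ($N$ even), each sampled from the real symmetric palindromic Toeplitz ensemble, and let $\{A_N,B_N\}=A_NB_N+B_NA_N$. The limiting spectral density of $\{\mathrm{PTE},\mathrm{PTE}\}$, i.e. the density of the limiting spectral distribution of $\{A_N,B_N\}/N$ as $N\to\infty$, is the convolution $$\mu(x)=f(x)*g(x),$$ where $f$ is the probability density function of a chi-squared random variable with $1$ degree of freedom and $g$ is the probability density function of the negative of a chi-squared random variable with $1$ degree of freedom.
   Context: The $N\times N$ real symmetric palindromic Toeplitz ensemble (PTE), with $N$ even, consists of matrices $(a_{ij})$ with entries parametrized by $b_0,b_1,\dots,b_{N/2-1}$, which are i.i.d. random variables with mean $0$, variance $1$ and finite higher moments: $$a_{ij}=\begin{cases} b_{|i-j|} & \text{if } 0\le|i-j|\le \frac N2-1,\\ b_{N-1-|i-j|} & \text{if } \frac N2\le|i-j|\le N-1.\end{cases}$$ For an $N\times N$ real symmetric random matrix $C_N$ with eigenvalues $\lambda_1,\dots,\lambda_N$, the empirical spectral distribution of $C_N/N$ is $F^{C_N/N}(x)=\frac1N\#\{i\le N:\lambda_i/N\le x\}$. If $F^{C_N/N}$ converges (in probability or almost surely) to a distribution $F$ as $N\to\infty$, then $F$ is called the limiting spectral distribution of the ensemble, and its density is the limiting spectral density. *)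

theory Defs
  imports "HOL-Probability.Probability" "Jordan_Normal_Form.Char_Poly"
begin

definition palindromic_toeplitz :: "nat \<Rightarrow> (nat \<Rightarrow> real) \<Rightarrow> real mat" where
  "palindromic_toeplitz N b = Matrix.mat N N (\<lambda>(i, j).
     let d = nat \<bar>int i - int j\<bar>
     in if d < N div 2 then b d else b (N - 1 - d))"

text \<open>
  An entry law of the ensemble. It does not depend on the size of the matrix.
\<close>
definition pte_law :: "real measure \<Rightarrow> bool" where
  "pte_law D \<longleftrightarrow>
     real_distribution D \<and>
     (\<forall>k::nat. integrable D (\<lambda>x. x ^ k)) \<and>
     prob_space.expectation D (\<lambda>x. x) = 0 \<and>
     prob_space.variance D (\<lambda>x. x) = 1"

definition pte_random_matrix ::
    "'w measure \<Rightarrow> real measure \<Rightarrow> nat \<Rightarrow> ('w \<Rightarrow> real mat) \<Rightarrow> bool" where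
  "pte_random_matrix M D N A \<longleftrightarrow>
     (\<exists>b :: nat \<Rightarrow> 'w \<Rightarrow> real.
        prob_space.indep_vars M (\<lambda>_. borel) b {..<N div 2} \<and>
        (\<forall>i < N div 2. distr M borel (b i) = D) \<and>
        (\<forall>\<omega> \<in> space M. A \<omega> = palindromic_toeplitz N (\<lambda>i. b i \<omega>)))"

text \<open>
  The Borel \<open>\<sigma>\<close>-algebra on the real \<open>N \<times> N\<close> matrices, generated by the entries.
\<close>
definition mat_borel :: "nat \<Rightarrow> real mat measure" where
  "mat_borel N = vimage_algebra (carrier_mat N N)
     (\<lambda>X. \<lambda>p \<in> {..<N} \<times> {..<N}. X $$ p) (\<Pi>\<^sub>M p \<in> {..<N} \<times> {..<N}. borel)"

definition anticommutator :: "real mat \<Rightarrow> real mat \<Rightarrow> real mat" where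
  "anticommutator X Y = X * Y + Y * X"

text \<open>
  The empirical spectral distribution function of \<open>C / N\<close> for a real symmetric \<open>N \<times> N\<close>
  matrix \<open>C\<close>. Eigenvalues are counted with multiplicity, which is their order as a root
  of the characteristic polynomial.
\<close>
definition scaled_esd :: "real mat \<Rightarrow> real \<Rightarrow> real" where
  "scaled_esd C x =
     1 / real (dim_row C) *
     real (\<Sum>l \<in> {l. eigenvalue C l \<and> l / real (dim_row C) \<le> x}. Polynomial.order l (char_poly C))"

text \<open>
  Convergence to \<open>F\<close> in probability, at every continuity point of \<open>F\<close>. For events the outer
  measure is the probability; using it, the definition does not rely on the convention that
  \<open>measure\<close> is 0 on non-measurable sets.
\<close>
definition weak_conv_in_prob ::
    "'w measure \<Rightarrow> (nat \<Rightarrow> 'w \<Rightarrow> real \<Rightarrow> real) \<Rightarrow> (real \<Rightarrow> real) \<Rightarrow> bool" where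
  "weak_conv_in_prob M G F \<longleftrightarrow>
     (\<forall>x. isCont F x \<longrightarrow>
        (\<forall>\<epsilon>>0. (\<lambda>n. outer_measure_of M {\<omega> \<in> space M. \<epsilon> < \<bar>G n \<omega> x - F x\<bar>})
                  \<longlonglongrightarrow> 0))"

definition limiting_spectral_distribution ::
    "'w measure \<Rightarrow> (nat \<Rightarrow> 'w \<Rightarrow> real mat) \<Rightarrow> real measure \<Rightarrow> bool" where
  "limiting_spectral_distribution M C \<mu> \<longleftrightarrow>
     real_distribution \<mu> \<and>
     (weak_conv_in_prob M (\<lambda>n \<omega>. scaled_esd (C n \<omega>)) (cdf \<mu>) \<or>
      (AE \<omega> in M. weak_conv (\<lambda>n. scaled_esd (C n \<omega>)) (cdf \<mu>)))"

definition limiting_spectral_density ::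
    "'w measure \<Rightarrow> (nat \<Rightarrow> 'w \<Rightarrow> real mat) \<Rightarrow> (real \<Rightarrow> ennreal) \<Rightarrow> bool" where
  "limiting_spectral_density M C h \<longleftrightarrow>
     h \<in> borel_measurable borel \<and>
     limiting_spectral_distribution M C (density lborel h)"

definition chi_squared_density :: "nat \<Rightarrow> real \<Rightarrow> real" where
  "chi_squared_density k x =
     (if x \<le> 0 then 0
      else x powr (real k / 2 - 1) * exp (- x / 2) / (2 powr (real k / 2) * Gamma (real k / 2)))"

text \<open>
  The density of \<open>- X\<close>, where \<open>X\<close> is chi-squared.
\<close>
definition neg_chi_squared_density :: "nat \<Rightarrow> real \<Rightarrow> real" where
  "neg_chi_squared_density k x = chi_squared_density k (- x)"

text \<open>
  The values are in \<open>ennreal\<close> because the convolution may be infinite at single points: the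
  convolution of the two densities above, for \<open>k = 1\<close>, is infinite at 0.
\<close>
definition density_convolution :: "(real \<Rightarrow> real) \<Rightarrow> (real \<Rightarrow> real) \<Rightarrow> real \<Rightarrow> ennreal" where
  "density_convolution f g x = (\<integral>\<^sup>+ y. ennreal (f (x - y)) * ennreal (g y) \<partial>lborel)"

end

theory Submission
  imports Defs "Jordan_Normal_Form.Schur_Decomposition" "HOL-Real_Asymp.Real_Asymp"
begin

unbundle no vec_syntax

text \<open>
  Write \<open>N = 2 * h\<close> and \<open>m = N - 1\<close>. The entries of a palindromic Toeplitz matrix depend on
  \<open>d = |i - j|\<close> through a sequence that is invariant under \<open>d \<mapsto> m - d\<close>. Hence deleting the last row
  and column leaves a symmetric circulant matrix of odd order \<open>m\<close>. All symmetric circulant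
  matrices are diagonal in one real orthonormal basis, the Hartley basis \<open>cos + sin\<close>, so these
  blocks of \<open>A\<close> and \<open>B\<close> commute. Their eigenvalues \<open>\<lambda>\<^sub>k\<close> and \<open>\<mu>\<^sub>k\<close> are explicit linear forms in the
  random coefficients (\<open>palindromic_toeplitz_hartley\<close>). On the vectors that vanish in the
  last coordinate and are orthogonal to the last row of \<open>A\<close>, the quadratic form of \<open>A B + B A\<close> is
  diagonal with coefficients \<open>2 \<lambda>\<^sub>k \<mu>\<^sub>k\<close>. A dimension count in the style of Courant, Fischer and Weyl
  then shows that the eigenvalue counting function of \<open>A B + B A\<close> and that of the numbers
  \<open>2 \<lambda>\<^sub>k \<mu>\<^sub>k\<close> differ by at most 2, so that the two distribution functions differ by at most
  \<open>3 / N\<close> (\<open>scaled_esd_anticommutator_palindromic_toeplitz\<close>).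

  It remains to study the empirical distribution of \<open>2 \<lambda>\<^sub>k \<mu>\<^sub>k / N\<close>, \<open>k < m\<close>. For two frequencies \<open>k\<close>
  and \<open>l\<close> that are nonzero and satisfy \<open>l \<noteq> k\<close> and \<open>l \<noteq> m - k\<close>, the coefficient vectors of \<open>\<lambda>\<^sub>k / sqrt N\<close>
  and \<open>\<lambda>\<^sub>l / sqrt N\<close> are almost orthonormal and have entries of size \<open>O(1 / sqrt N)\<close>; the characteristic
  function of the pair is therefore close to that of two independent standard normal variables, with an
  explicit error that comes from the third moments (\<open>char_scaled_eigenvalue_pair\<close>). Applied
  twice, once for each matrix, this gives the joint characteristic function of two products
  \<open>2 \<lambda>\<^sub>k \<mu>\<^sub>k / N\<close> and \<open>2 \<lambda>\<^sub>l \<mu>\<^sub>l / N\<close> (\<open>two_point_char\<close>). Expanding the square shows that the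
  characteristic function of the empirical distribution converges in mean square, at every point,
  to that of \<open>2 Z W\<close> with independent standard normal \<open>Z\<close> and \<open>W\<close>
  (\<open>empirical_char_second_moment\<close>).

  By rotation, \<open>2 Z W\<close> has the law of \<open>U\<^sup>2 - V\<^sup>2\<close> with independent standard normal \<open>U\<close> and \<open>V\<close>, which
  is the convolution in the theorem (\<open>char_chi_conv\<close>). Finally, a compactness argument based
  on tightness and the uniqueness theorem of Levy shows that the distribution function at a continuity
  point of the limit is controlled by the characteristic function at finitely many
  rational points together with a bound on the first absolute moment
  (\<open>cdf_close_of_char_close\<close>); Markov's inequality turns the mean square estimates into
  convergence in probability.
\<close>

section \<open>Spectral decomposition of real symmetric matrices\<close>

lemma homogeneous_system_nontrivial:
  fixes c :: "'j \<Rightarrow> 'i \<Rightarrow> real"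
  assumes "finite J" "finite I" "card J < card I"
  shows "\<exists>x. (\<exists>i\<in>I. x i \<noteq> 0) \<and> (\<forall>j\<in>J. (\<Sum>i\<in>I. c j i * x i) = 0)"
  using assms
proof (induction J arbitrary: I c rule: finite_induct)
  case empty
  then obtain i where "i \<in> I" by fastforce
  then show ?case by (intro exI[of _ "\<lambda>_. 1"]) auto
next
  case (insert j J)
  show ?case
  proof (cases "\<forall>i\<in>I. c j i = 0")
    case True
    obtain x where x: "\<exists>i\<in>I. x i \<noteq> 0" "\<forall>j\<in>J. (\<Sum>i\<in>I. c j i * x i) = 0"
      using insert.IH[of I c] insert by fastforce
    have "(\<Sum>i\<in>I. c j i * x i) = 0" using True by simp
    with x show ?thesis by blast
  next
    case False
    then obtain p where p: "p \<in> I" "c j p \<noteq> 0" by auto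
    \<comment> \<open>Solve equation \<open>j\<close> for the unknown \<open>p\<close> and substitute into the other equations.\<close>
    define I' where "I' = I - {p}"
    have I': "finite I'" "card J < card I'" "p \<notin> I'" "I = insert p I'"
      using insert p by (auto simp: I'_def)
    obtain y where y: "\<exists>i\<in>I'. y i \<noteq> 0"
        "\<forall>l\<in>J. (\<Sum>i\<in>I'. (c l i - c l p * c j i / c j p) * y i) = 0"
      using insert.IH[OF I'(1,2), of "\<lambda>l i. c l i - c l p * c j i / c j p"] by blast
    define s where "s = (\<Sum>i\<in>I'. c j i * y i)"
    define x where "x = (\<lambda>i. if i = p then - s / c j p else y i)"
    have sum_x: "(\<Sum>i\<in>I. c l i * x i) = - c l p * s / c j p + (\<Sum>i\<in>I'. c l i * y i)" for l
    proof -
      have "(\<Sum>i\<in>I. c l i * x i) = c l p * x p + (\<Sum>i\<in>I'. c l i * x i)"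
        using I' by simp
      also have "(\<Sum>i\<in>I'. c l i * x i) = (\<Sum>i\<in>I'. c l i * y i)"
        using I' by (intro sum.cong) (auto simp: x_def)
      finally show ?thesis by (simp add: x_def)
    qed
    have "(\<Sum>i\<in>I. c j i * x i) = 0"
      using p by (simp add: sum_x s_def)
    moreover have "(\<Sum>i\<in>I. c l i * x i) = 0" if "l \<in> J" for l
    proof -
      have "(\<Sum>i\<in>I'. (c l i - c l p * c j i / c j p) * y i)
          = (\<Sum>i\<in>I'. c l i * y i) - c l p / c j p * s"
        unfolding s_def sum_distrib_left sum_subtractf[symmetric]
        by (intro sum.cong refl) (simp add: algebra_simps)
      with y(2) that show ?thesis by (simp add: sum_x)
    qed
    moreover have "\<exists>i\<in>I. x i \<noteq> 0"
      using y(1) I' by (auto simp: x_def)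
    ultimately show ?thesis by blast
  qed
qed

lemma symmetric_real_mat_eigenvalue_exists:
  fixes C :: "real mat"
  assumes C: "C \<in> carrier_mat n n" and sym: "transpose_mat C = C" and n: "n \<noteq> 0"
  shows "\<exists>e. eigenvalue C e"
proof -
  let ?h = "of_real :: real \<Rightarrow> complex"
  define D where "D = map_mat ?h C"
  have D: "D \<in> carrier_mat n n" using C by (simp add: D_def)
  have "degree (char_poly D) = n" using degree_monic_char_poly[OF D] by simp
  then obtain z where z: "poly (char_poly D) z = 0"
    using n fundamental_theorem_of_algebra[of "char_poly D"] constant_degree[of "char_poly D"] by auto
  then have "eigenvalue D z" using eigenvalue_root_char_poly[OF D] by simp
  then obtain v where v: "v \<in> carrier_vec n" "v \<noteq> 0\<^sub>v n" "D *\<^sub>v v = z \<cdot>\<^sub>v v"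
    using D by (auto simp: eigenvalue_def eigenvector_def)
  have cv: "conjugate v \<in> carrier_vec n" using v by simp
  have Dij: "D $$ (i,j) = ?h (C $$ (i,j))" if "i < n" "j < n" for i j
    using that C by (simp add: D_def)
  have Csym: "C $$ (i,j) = C $$ (j,i)" if "i < n" "j < n" for i j
    using sym that C by (metis carrier_matD index_transpose_mat(1))
  \<comment> \<open>The Hermitian form \<open>q\<close> of the eigenvector is real by symmetry, and \<open>q = z * r\<close> with \<open>r > 0\<close>.\<close>
  define q where "q = (\<Sum>i<n. \<Sum>j<n. cnj (v $ i) * ?h (C $$ (i,j)) * v $ j)"
  define r where "r = (\<Sum>i<n. cnj (v $ i) * v $ i)"
  have Dv: "(\<Sum>j<n. ?h (C $$ (i,j)) * v $ j) = z * v $ i" if "i < n" for i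
  proof -
    have "(D *\<^sub>v v) $ i = (\<Sum>j<n. D $$ (i,j) * v $ j)"
      using D v(1) that by (simp add: scalar_prod_def lessThan_atLeast0 del: v(3))
    also have "\<dots> = (\<Sum>j<n. ?h (C $$ (i,j)) * v $ j)"
      using that by (intro sum.cong) (auto simp: Dij)
    finally show ?thesis using v that by (metis index_smult_vec(1) carrier_vecD)
  qed
  have "q = (\<Sum>i<n. cnj (v $ i) * (\<Sum>j<n. ?h (C $$ (i,j)) * v $ j))"
    by (simp add: q_def sum_distrib_left mult.assoc)
  also have "\<dots> = (\<Sum>i<n. cnj (v $ i) * (z * v $ i))"
    by (intro sum.cong) (auto simp: Dv)
  also have "\<dots> = z * r"
    by (simp add: r_def sum_distrib_left mult_ac)
  finally have q: "q = z * r" .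
  have "cnj q = (\<Sum>i<n. \<Sum>j<n. v $ i * ?h (C $$ (i,j)) * cnj (v $ j))"
    by (simp add: q_def)
  also have "\<dots> = (\<Sum>j<n. \<Sum>i<n. v $ i * ?h (C $$ (i,j)) * cnj (v $ j))"
    by (rule sum.swap)
  also have "\<dots> = q"
    unfolding q_def by (intro sum.cong refl) (auto simp: Csym)
  finally have "cnj q = q" .
  moreover have rr: "r = ?h (\<Sum>i<n. (cmod (v $ i))\<^sup>2)"
    unfolding r_def of_real_sum complex_norm_square by (intro sum.cong) (auto simp: mult.commute)
  moreover have "r \<noteq> 0"
  proof
    assume "r = 0"
    then have "(\<Sum>i<n. (cmod (v $ i))\<^sup>2) = 0" using rr of_real_eq_0_iff by metis
    then have "\<forall>i<n. v $ i = 0" by (subst (asm) sum_nonneg_eq_0_iff) auto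
    then have "v = 0\<^sub>v n" using v by (intro eq_vecI) auto
    with v show False by simp
  qed
  ultimately have "cnj z = z"
    using q by (metis complex_cnj_complex_of_real complex_cnj_mult mult_right_cancel)
  then obtain e where e: "z = ?h e" by (metis Reals_cases Reals_cnj_iff)
  have "char_poly D = map_poly ?h (char_poly C)"
    unfolding D_def by (rule of_real_hom.char_poly_hom[OF C])
  with z e have "poly (char_poly C) e = 0" by simp
  then show ?thesis using eigenvalue_root_char_poly[OF C] by blast
qed

lemma four_block_diag_mult:
  fixes X Y :: "'a :: comm_ring_1 mat"
  assumes "E \<in> carrier_mat k k" "F \<in> carrier_mat k k" "X \<in> carrier_mat n n" "Y \<in> carrier_mat n n"
  shows "four_block_mat E (0\<^sub>m k n) (0\<^sub>m n k) X * four_block_mat F (0\<^sub>m k n) (0\<^sub>m n k) Y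
       = four_block_mat (E * F) (0\<^sub>m k n) (0\<^sub>m n k) (X * Y)"
proof -
  have "E * F \<in> carrier_mat k k" "X * Y \<in> carrier_mat n n" using assms by auto
  with mult_four_block_mat[OF assms(1) zero_carrier_mat zero_carrier_mat assms(3)
      assms(2) zero_carrier_mat zero_carrier_mat assms(4)]
  show ?thesis using assms by simp
qed

text \<open>
  The spectral theorem, by deflation: complete a real eigenvector to an orthogonal basis; in this
  basis the matrix splits into a \<open>1 \<times> 1\<close> block and a smaller symmetric matrix.
\<close>
lemma real_spectral_decomposition:
  fixes C :: "real mat"
  assumes "C \<in> carrier_mat n n" and "transpose_mat C = C"
  shows "\<exists>P d. P \<in> carrier_mat n n \<and> transpose_mat P * P = 1\<^sub>m n \<and>
           transpose_mat P * C * P = Matrix.mat n n (\<lambda>(i,j). if i = j then d i else 0)"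
  using assms
proof (induction n arbitrary: C)
  case 0
  then show ?case by (intro exI[of _ "1\<^sub>m 0"] exI[of _ "\<lambda>_. 0"]) (auto intro!: eq_matI)
next
  case (Suc n)
  let ?N = "Suc n"
  note C = Suc.prems(1) and sym = Suc.prems(2)
  obtain e where "eigenvalue C e"
    using symmetric_real_mat_eigenvalue_exists[OF C sym] by auto
  then obtain v where v: "v \<in> carrier_vec ?N" "v \<noteq> 0\<^sub>v ?N" "C *\<^sub>v v = e \<cdot>\<^sub>v v"
    using C by (auto simp: eigenvalue_def eigenvector_def)
  interpret cof_vec_space ?N "TYPE(real)" .
  define b where "b = basis_completion v"
  define ws where "ws = gram_schmidt ?N b"
  from basis_completion[OF v(1,2), folded b_def]
  have dist_b: "distinct b" and indep: "\<not> lin_dep (set b)" and b: "set b \<subseteq> carrier_vec ?N"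
    and hdb: "hd b = v" and len_b: "length b = ?N" by auto
  obtain vs where bv: "b = v # vs" using hdb len_b by (cases b) auto
  from gram_schmidt_result[OF b dist_b indep refl, folded ws_def]
  have ws: "set ws \<subseteq> carrier_vec ?N" "corthogonal ws" "length ws = ?N"
    by (auto simp: len_b)
  have hdws: "hd ws = v" using gram_schmidt_hd[OF v(1), of vs, folded bv] by (simp add: ws_def)
  then have ws0: "ws ! 0 = v" using ws(3) by (cases ws) auto
  have wsc: "ws ! i \<in> carrier_vec ?N" if "i < ?N" for i using ws that by auto
  have conj: "conjugate u = u" for u :: "real vec" by (intro eq_vecI) auto
  have orth: "(ws ! i \<bullet> ws ! j = 0) \<longleftrightarrow> i \<noteq> j" if "i < ?N" "j < ?N" for i j
    using corthogonalD[OF ws(2), of i j] that ws(3) by (simp add: conj)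
  \<comment> \<open>Normalise the Gram-Schmidt basis; its first vector is still an eigenvector.\<close>
  define r where "r = (\<lambda>i. sqrt (ws ! i \<bullet> ws ! i))"
  have pos: "ws ! i \<bullet> ws ! i > 0" if "i < ?N" for i
  proof -
    have "ws ! i \<bullet> ws ! i \<ge> 0" by (simp add: scalar_prod_def sum_nonneg)
    moreover have "ws ! i \<bullet> ws ! i \<noteq> 0" using orth[OF that that] by simp
    ultimately show ?thesis by simp
  qed
  define U where "U = Matrix.mat ?N ?N (\<lambda>(i,j). (ws ! j) $ i / r j)"
  have U: "U \<in> carrier_mat ?N ?N" by (simp add: U_def)
  have colU: "col U j = (1 / r j) \<cdot>\<^sub>v (ws ! j)" if "j < ?N" for j
    using that wsc[OF that] by (intro eq_vecI) (auto simp: U_def)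
  have r2: "r i * r i = ws ! i \<bullet> ws ! i" if "i < ?N" for i
    using pos[OF that] by (simp add: r_def)
  have dotU: "col U i \<bullet> col U j = (if i = j then 1 else 0)" if "i < ?N" "j < ?N" for i j
  proof -
    have "col U i \<bullet> col U j = (ws ! i \<bullet> ws ! j) / (r i * r j)"
      using that wsc[OF that(1)] wsc[OF that(2)]
        smult_scalar_prod_distrib[OF wsc[OF that(1)] smult_carrier_vec[THEN iffD2, OF wsc[OF that(2)]]]
        scalar_prod_smult_distrib[OF wsc[OF that(1)] wsc[OF that(2)]]
      by (simp add: colU)
    then show ?thesis using orth[OF that] r2[of i] pos[of i] that by auto
  qed
  have UtU: "transpose_mat U * U = 1\<^sub>m ?N"
    using U dotU by (intro eq_matI) auto
  define C' where "C' = transpose_mat U * C * U"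
  have Ut: "transpose_mat U \<in> carrier_mat ?N ?N" using U by simp
  have C': "C' \<in> carrier_mat ?N ?N" using U C by (simp add: C'_def)
  have symC': "transpose_mat C' = C'"
  proof -
    have "transpose_mat C' = transpose_mat U * transpose_mat (transpose_mat U * C)"
      unfolding C'_def by (rule transpose_mult) (use U C Ut in auto)
    also have "transpose_mat (transpose_mat U * C) = transpose_mat C * transpose_mat (transpose_mat U)"
      by (rule transpose_mult) (use U C Ut in auto)
    also have "\<dots> = C * U" by (simp add: sym)
    finally show ?thesis
      unfolding C'_def using assoc_mult_mat[OF Ut C U] by simp
  qed
  have C'0: "C' $$ (i,0) = (if i = 0 then e else 0)" if i: "i < ?N" for i
  proof -
    have "C' = transpose_mat U * (C * U)" unfolding C'_def by (rule assoc_mult_mat[OF Ut C U])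
    then have "C' $$ (i,0) = col U i \<bullet> col (C * U) 0"
      using i U C by simp
    also have "col (C * U) 0 = C *\<^sub>v col U 0" using U C by (intro eq_vecI) auto
    also have "col U 0 = (1 / r 0) \<cdot>\<^sub>v v" using colU[of 0] ws0 by simp
    also have "C *\<^sub>v ((1 / r 0) \<cdot>\<^sub>v v) = e \<cdot>\<^sub>v ((1 / r 0) \<cdot>\<^sub>v v)"
      using C v by (simp add: mult_mat_vec smult_smult_assoc mult.commute)
    also have "(1 / r 0) \<cdot>\<^sub>v v = col U 0" using colU[of 0] ws0 by simp
    also have "col U i \<bullet> (e \<cdot>\<^sub>v col U 0) = e * (col U i \<bullet> col U 0)"
      using U i by (intro scalar_prod_smult_distrib[of _ ?N]) (auto intro: col_carrier_vec)
    finally show ?thesis using dotU[of i 0] i by simp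
  qed
  have C'0': "C' $$ (0,j) = (if j = 0 then e else 0)" if "j < ?N" for j
    using C'0[OF that] symC' C' that by (metis carrier_matD index_transpose_mat(1) zero_less_Suc)
  define C3 where "C3 = Matrix.mat n n (\<lambda>(i,j). C' $$ (Suc i, Suc j))"
  have C3: "C3 \<in> carrier_mat n n" by (simp add: C3_def)
  have C'sym: "C' $$ (i,j) = C' $$ (j,i)" if "i < ?N" "j < ?N" for i j
    using symC' C' that by (metis carrier_matD index_transpose_mat(1))
  have "transpose_mat C3 = C3"
    by (intro eq_matI) (auto simp: C3_def C'sym)
  from Suc.IH[OF C3 this] obtain P' d' where P': "P' \<in> carrier_mat n n"
      "transpose_mat P' * P' = 1\<^sub>m n"
      "transpose_mat P' * C3 * P' = Matrix.mat n n (\<lambda>(i,j). if i = j then d' i else 0)" by auto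
  let ?E = "Matrix.mat 1 1 (\<lambda>_. e) :: real mat"
  have block: "C' = four_block_mat ?E (0\<^sub>m 1 n) (0\<^sub>m n 1) C3"
  proof (rule eq_matI)
    fix i j assume "i < dim_row (four_block_mat ?E (0\<^sub>m 1 n) (0\<^sub>m n 1) C3)"
      and "j < dim_col (four_block_mat ?E (0\<^sub>m 1 n) (0\<^sub>m n 1) C3)"
    then have "i < ?N" "j < ?N" using C3 by auto
    then show "C' $$ (i,j) = four_block_mat ?E (0\<^sub>m 1 n) (0\<^sub>m n 1) C3 $$ (i,j)"
      using C3 C'0[of i] C'0'[of j] by (cases i; cases j) (simp_all add: C3_def)
  qed (use C' C3 in auto)
  define R where "R = four_block_mat (1\<^sub>m 1) (0\<^sub>m 1 n) (0\<^sub>m n 1) P'"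
  have R: "R \<in> carrier_mat ?N ?N"
    using four_block_carrier_mat[OF one_carrier_mat P'(1), of 1] by (simp add: R_def)
  have Pt: "transpose_mat P' \<in> carrier_mat n n" using P' by simp
  have Rt: "transpose_mat R = four_block_mat (1\<^sub>m 1) (0\<^sub>m 1 n) (0\<^sub>m n 1) (transpose_mat P')"
    unfolding R_def
    using transpose_four_block_mat[OF one_carrier_mat zero_carrier_mat zero_carrier_mat P'(1), of 1]
    by simp
  have Rtc: "transpose_mat R \<in> carrier_mat ?N ?N" using R by simp
  have E: "?E \<in> carrier_mat 1 1" by simp
  have RtR: "transpose_mat R * R = 1\<^sub>m ?N"
    unfolding Rt unfolding R_def four_block_diag_mult[OF one_carrier_mat one_carrier_mat Pt P'(1)] P'(2)
    using four_block_one_mat[of 1 n] by simp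
  have RtCR: "transpose_mat R * C' * R = four_block_mat ?E (0\<^sub>m 1 n) (0\<^sub>m n 1) (transpose_mat P' * C3 * P')"
  proof -
    have "transpose_mat R * C' = four_block_mat ?E (0\<^sub>m 1 n) (0\<^sub>m n 1) (transpose_mat P' * C3)"
      unfolding Rt block four_block_diag_mult[OF one_carrier_mat E Pt C3] left_mult_one_mat[OF E] ..
    moreover have "transpose_mat P' * C3 \<in> carrier_mat n n" using Pt C3 by simp
    ultimately show ?thesis
      unfolding R_def by (simp only: four_block_diag_mult[OF E one_carrier_mat _ P'(1)] right_mult_one_mat[OF E])
  qed
  define d where "d = case_nat e d'"
  have diag: "transpose_mat R * C' * R = Matrix.mat ?N ?N (\<lambda>(i,j). if i = j then d i else 0)"
    unfolding RtCR P'(3)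
  proof (rule eq_matI)
    fix i j assume "i < dim_row (Matrix.mat ?N ?N (\<lambda>(i,j). if i = j then d i else 0))"
      and "j < dim_col (Matrix.mat ?N ?N (\<lambda>(i,j). if i = j then d i else 0))"
    then show "four_block_mat ?E (0\<^sub>m 1 n) (0\<^sub>m n 1) (Matrix.mat n n (\<lambda>(i,j). if i = j then d' i else 0)) $$ (i,j)
        = Matrix.mat ?N ?N (\<lambda>(i,j). if i = j then d i else 0) $$ (i,j)"
      by (cases i; cases j) (simp_all add: d_def)
  qed auto
  define P where "P = U * R"
  have P: "P \<in> carrier_mat ?N ?N" using U R by (simp add: P_def)
  have Ptr: "transpose_mat P = transpose_mat R * transpose_mat U"
    unfolding P_def by (rule transpose_mult[OF U R])
  have "transpose_mat P * P = transpose_mat R * (transpose_mat U * (U * R))"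
    unfolding Ptr unfolding P_def by (rule assoc_mult_mat) (use U R Ut Rtc in auto)
  also have "transpose_mat U * (U * R) = R"
    using assoc_mult_mat[OF Ut U R] UtU R by simp
  finally have 1: "transpose_mat P * P = 1\<^sub>m ?N" using RtR by simp
  have "transpose_mat P * C * P = transpose_mat R * (transpose_mat U * C) * (U * R)"
    unfolding Ptr unfolding P_def using assoc_mult_mat[OF Rtc Ut C] by simp
  also have "\<dots> = transpose_mat R * ((transpose_mat U * C) * (U * R))"
    by (rule assoc_mult_mat) (use U R Ut Rtc C in auto)
  also have "(transpose_mat U * C) * (U * R) = C' * R"
    unfolding C'_def by (rule assoc_mult_mat[symmetric]) (use U R Ut Rtc C in auto)
  also have "transpose_mat R * (C' * R) = transpose_mat R * C' * R"
    by (rule assoc_mult_mat[symmetric]) (use R Rtc C' in auto)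
  finally have "transpose_mat P * C * P = Matrix.mat ?N ?N (\<lambda>(i,j). if i = j then d i else 0)"
    using diag by simp
  with P 1 show ?case by blast
qed

lemma order_prod_linear_factors:
  fixes d :: "'i \<Rightarrow> real"
  assumes "finite J"
  shows "Polynomial.order l (\<Prod>j\<in>J. [:- d j, 1:]) = card {j\<in>J. d j = l}"
  using assms
proof (induction J rule: finite_induct)
  case empty
  then show ?case by (simp add: order_0I)
next
  case (insert j J)
  have nz: "[:- d j, 1:] * (\<Prod>j\<in>J. [:- d j, 1:]) \<noteq> 0"
    using insert by (intro no_zero_divisors) (simp_all add: prod_zero_iff)
  have lin: "Polynomial.order l [:- d j, 1:] = (if d j = l then 1 else 0)"
  proof (cases "d j = l")
    case True
    then show ?thesis using order_power_n_n[of l 1] by simp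
  next
    case False
    then show ?thesis by (simp add: order_0I)
  qed
  have set: "{i\<in>insert j J. d i = l} = (if d j = l then insert j {i\<in>J. d i = l} else {i\<in>J. d i = l})"
    by auto
  show ?case
    unfolding set using insert.hyps insert.IH order_mult[OF nz, of l]
    by (simp add: lin del: mult_pCons_left)
qed

text \<open>
  The spectral theorem in coordinates: the vectors \<open>w j\<close> with entries \<open>w j i\<close> are orthonormal
  eigenvectors, and the characteristic polynomial records their eigenvalues \<open>d j\<close> with multiplicity.
\<close>
lemma symmetric_real_mat_orthonormal_eigenbasis:
  fixes C :: "real mat"
  assumes C: "C \<in> carrier_mat n n" and sym: "transpose_mat C = C"
  obtains w :: "nat \<Rightarrow> nat \<Rightarrow> real" and d :: "nat \<Rightarrow> real"
  where "\<And>j l. j < n \<Longrightarrow> l < n \<Longrightarrow> (\<Sum>i<n. w j i * w l i) = (if j = l then 1 else 0)"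
    and "\<And>j i. j < n \<Longrightarrow> i < n \<Longrightarrow> (\<Sum>k<n. C $$ (i,k) * w j k) = d j * w j i"
    and "char_poly C = (\<Prod>j<n. [:- d j, 1:])"
proof -
  obtain P d where P: "P \<in> carrier_mat n n" "transpose_mat P * P = 1\<^sub>m n"
      "transpose_mat P * C * P = Matrix.mat n n (\<lambda>(i,j). if i = j then d i else 0)" (is "_ = ?D")
    using real_spectral_decomposition[OF assms] by auto
  have Pt: "transpose_mat P \<in> carrier_mat n n" using P by simp
  have PPt: "P * transpose_mat P = 1\<^sub>m n" using mat_mult_left_right_inverse[OF Pt P(1,2)] .
  have D: "?D \<in> carrier_mat n n" by simp
  have "P * ?D = P * (transpose_mat P * (C * P))"
    using P(3) assoc_mult_mat[OF Pt C P(1)] by simp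
  also have "\<dots> = (P * transpose_mat P) * (C * P)"
    by (rule assoc_mult_mat[symmetric]) (use P Pt C in auto)
  finally have PD: "C * P = P * ?D" using PPt P(1) C by simp
  have "P * ?D * transpose_mat P = C * P * transpose_mat P" using PD by simp
  also have "\<dots> = C * (P * transpose_mat P)" by (rule assoc_mult_mat) (use P Pt C in auto)
  finally have CPD: "C = P * ?D * transpose_mat P" using PPt C by simp
  have "similar_mat_wit C ?D P (transpose_mat P)"
    by (rule similar_mat_witI[OF PPt P(2) CPD C D P(1) Pt])
  then have "char_poly C = char_poly ?D" using char_poly_similar similar_mat_def by blast
  also have "\<dots> = (\<Prod>a \<leftarrow> diag_mat ?D. [:- a, 1:])"
    by (rule char_poly_upper_triangular[OF D]) auto
  also have "diag_mat ?D = map d [0..<n]"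
    by (auto simp: diag_mat_def intro!: nth_equalityI)
  also have "(\<Prod>a \<leftarrow> map d [0..<n]. [:- a, 1:]) = (\<Prod>j<n. [:- d j, 1:])"
    using prod.distinct_set_conv_list[of "[0..<n]" "\<lambda>j. [:- d j, 1:]"]
    by (simp add: o_def lessThan_atLeast0)
  finally have cp: "char_poly C = (\<Prod>j<n. [:- d j, 1:])" .
  show ?thesis
  proof (rule that[of "\<lambda>j i. P $$ (i,j)" d])
    fix j l assume jl: "j < n" "l < n"
    have "(transpose_mat P * P) $$ (j,l) = (\<Sum>i<n. P $$ (i,j) * P $$ (i,l))"
      using P(1) jl by (simp add: scalar_prod_def lessThan_atLeast0)
    with P(2) jl show "(\<Sum>i<n. P $$ (i,j) * P $$ (i,l)) = (if j = l then 1 else 0)" by simp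
  next
    fix j i assume ji: "j < n" "i < n"
    have "(C * P) $$ (i,j) = (\<Sum>k<n. C $$ (i,k) * P $$ (k,j))"
      using P(1) C ji by (simp add: scalar_prod_def lessThan_atLeast0)
    moreover have "(P * ?D) $$ (i,j) = (\<Sum>k<n. P $$ (i,k) * (if k = j then d k else 0))"
      using P(1) ji by (simp add: scalar_prod_def lessThan_atLeast0)
    moreover have "\<dots> = d j * P $$ (i,j)"
      using ji by (simp add: if_distrib if_distribR sum.delta cong: if_cong)
    ultimately show "(\<Sum>k<n. C $$ (i,k) * P $$ (k,j)) = d j * P $$ (i,j)" using PD by simp
  qed (rule cp)
qed

section \<open>Symmetric circulants of odd order and the Hartley basis\<close>

lemma sum_cis_roots_of_unity:
  fixes r :: int and m :: nat
  assumes "m > 0"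
  shows "(\<Sum>j<m. cis (2 * pi * r * j / m)) = (if int m dvd r then of_nat m else 0)"
proof -
  define z where "z = cis (2 * pi * r / m)"
  have zj: "cis (2 * pi * r * j / m) = z ^ j" for j :: nat
  proof -
    have "z ^ j = cis (real j * (2 * pi * r / m))" unfolding z_def by (rule Complex.DeMoivre)
    then show ?thesis by (simp add: mult.commute)
  qed
  have z1: "z = 1 \<longleftrightarrow> int m dvd r"
  proof
    assume "z = 1"
    then have "cos (2 * pi * r / m) = 1" by (simp add: z_def complex_eq_iff)
    then obtain q :: int where "2 * pi * r / m = of_int q * 2 * pi" by (auto simp: cos_one_2pi_int)
    then have "real_of_int r = of_int (q * int m)" using assms by (simp add: field_simps)
    then have "r = q * int m" by linarith
    then show "int m dvd r" by simp
  next
    assume "int m dvd r"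
    then obtain q where "r = int m * q" by auto
    then have "2 * pi * r / m = 2 * pi * of_int q" using assms by simp
    then show "z = 1" by (simp add: z_def)
  qed
  show ?thesis
  proof (cases "int m dvd r")
    case True
    then show ?thesis using z1 by (simp add: zj)
  next
    case False
    have "z ^ m = cis (2 * pi * r)" unfolding z_def Complex.DeMoivre using assms by simp
    also have "\<dots> = 1" by simp
    finally have "(\<Sum>j<m. z ^ j) = 0" using False z1 by (simp add: geometric_sum)
    then show ?thesis using False by (simp add: zj)
  qed
qed

lemma sum_cos_roots_of_unity:
  fixes r :: int and m :: nat
  assumes "m > 0"
  shows "(\<Sum>j<m. cos (2 * pi * r * j / m)) = (if int m dvd r then real m else 0)"
  using arg_cong[OF sum_cis_roots_of_unity[OF assms, of r], of Re] by simp

lemma sum_sin_roots_of_unity: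
  fixes r :: int and m :: nat
  assumes "m > 0"
  shows "(\<Sum>j<m. sin (2 * pi * r * j / m)) = 0"
  using arg_cong[OF sum_cis_roots_of_unity[OF assms, of r], of Im] by simp

lemma sum_even_on_odd_cycle:
  fixes f :: "nat \<Rightarrow> real"
  assumes h: "h > 0" and even: "\<And>d. 0 < d \<Longrightarrow> d < 2 * h - 1 \<Longrightarrow> f (2 * h - 1 - d) = f d"
  shows "(\<Sum>d<2 * h - 1. f d) = f 0 + 2 * (\<Sum>d\<in>{1..<h}. f d)"
proof -
  have even': "f (2 * h - Suc d) = f d" if "0 < d" "d < 2 * h - 1" for d
    using even[OF that] by simp
  have "{..<2 * h - 1} = insert 0 ({1..<h} \<union> {h..<2 * h - 1})" using h by auto
  then have "(\<Sum>d<2 * h - 1. f d) = f 0 + (\<Sum>d\<in>{1..<h} \<union> {h..<2 * h - 1}. f d)" using h by simp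
  also have "(\<Sum>d\<in>{1..<h} \<union> {h..<2 * h - 1}. f d) = (\<Sum>d\<in>{1..<h}. f d) + (\<Sum>d\<in>{h..<2 * h - 1}. f d)"
    by (rule sum.union_disjoint) auto
  also have "(\<Sum>d\<in>{h..<2 * h - 1}. f d) = (\<Sum>d\<in>{1..<h}. f d)"
    by (rule sum.reindex_bij_witness[of _ "\<lambda>d. 2 * h - 1 - d" "\<lambda>d. 2 * h - 1 - d"])
       (use h in \<open>auto simp: even'\<close>)
  finally show ?thesis by simp
qed

lemma sum_odd_on_cycle:
  fixes g :: "nat \<Rightarrow> real"
  assumes "g 0 = 0" and odd: "\<And>d. 0 < d \<Longrightarrow> d < m \<Longrightarrow> g (m - d) = - g d"
  shows "(\<Sum>d<m. g d) = 0"
proof (cases "m = 0")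
  case False
  then have "{..<m} = insert 0 {1..<m}" by auto
  then have s: "(\<Sum>d<m. g d) = (\<Sum>d\<in>{1..<m}. g d)" using assms by simp
  have "(\<Sum>d\<in>{1..<m}. g d) = (\<Sum>d\<in>{1..<m}. - g d)"
    by (rule sum.reindex_bij_witness[of _ "\<lambda>d. m - d" "\<lambda>d. m - d"]) (auto simp: odd)
  also have "\<dots> = - (\<Sum>d\<in>{1..<m}. g d)" by (simp add: sum_negf)
  finally show ?thesis using s by simp
qed simp

lemma sum_periodic_shift:
  fixes f :: "int \<Rightarrow> real"
  assumes "\<And>z. f (z + int m) = f z"
  shows "(\<Sum>j<m. f (int j - int i)) = (\<Sum>j<m. f (int j))"
proof (induction i)
  case (Suc i)
  have "(\<Sum>j<m. f (int j - int (Suc i))) = (\<Sum>j<m. f (int j - int i))"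
  proof (cases m)
    case (Suc m')
    define g where "g = (\<lambda>z. f (z - int i))"
    have "f (int j - int (Suc i)) = g (int j - 1)" for j
      by (simp add: g_def algebra_simps)
    then have "(\<Sum>j<m. f (int j - int (Suc i))) = (\<Sum>j<Suc m'. g (int j - 1))"
      by (simp add: Suc)
    also have "\<dots> = g (- 1) + (\<Sum>j<m'. g (int j))"
      by (subst sum.lessThan_Suc_shift) simp
    also have "g (- 1) = g (int m')"
      using assms[of "- 1 - int i"] by (simp add: g_def Suc algebra_simps)
    finally show ?thesis by (simp add: g_def Suc)
  qed simp
  with Suc show ?case by simp
qed simp

text \<open>
  The entry \<open>j\<close> of the \<open>k\<close>-th vector of the real orthonormal Hartley basis of \<open>\<real>\<^sup>m\<close>. Unlike the complex
  Fourier basis it is real, and unlike cosines and sines taken separately it needs only one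
  formula for all frequencies.
\<close>
definition hartley :: "nat \<Rightarrow> nat \<Rightarrow> nat \<Rightarrow> real" where
  "hartley m k j = (cos (2 * pi * k * j / m) + sin (2 * pi * k * j / m)) / sqrt m"

lemma hartley_orthonormal:
  assumes "k < m" "l < m"
  shows "(\<Sum>j<m. hartley m k j * hartley m l j) = (if k = l then 1 else 0)"
proof -
  have m: "m > 0" using assms by simp
  have "hartley m k j * hartley m l j =
     (cos (2 * pi * real_of_int (int k - int l) * real j / m)
      + sin (2 * pi * real_of_int (int k + int l) * real j / m)) / m" for j
  proof -
    define x where "x = 2 * pi * k * j / m"
    define y where "y = 2 * pi * l * j / m"
    have e: "2 * pi * real_of_int (int k - int l) * real j / m = x - y"
            "2 * pi * real_of_int (int k + int l) * real j / m = x + y"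
      by (simp_all add: x_def y_def algebra_simps diff_divide_distrib add_divide_distrib)
    have "hartley m k j * hartley m l j = (cos x + sin x) * (cos y + sin y) / (sqrt m * sqrt m)"
      by (simp add: hartley_def x_def y_def)
    also have "sqrt m * sqrt m = m" by simp
    also have "(cos x + sin x) * (cos y + sin y) = cos (x - y) + sin (x + y)"
      by (simp add: cos_diff sin_add algebra_simps)
    finally show ?thesis unfolding e .
  qed
  then have "(\<Sum>j<m. hartley m k j * hartley m l j) =
     ((\<Sum>j<m. cos (2 * pi * real_of_int (int k - int l) * real j / m))
      + (\<Sum>j<m. sin (2 * pi * real_of_int (int k + int l) * real j / m))) / m"
    by (simp only: sum.distrib sum_divide_distrib[symmetric])
  also have "\<dots> = (if int m dvd int k - int l then 1 else 0)"
    unfolding sum_cos_roots_of_unity[OF m] sum_sin_roots_of_unity[OF m] using m by simp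
  also have "int m dvd int k - int l \<longleftrightarrow> k = l"
  proof
    assume "int m dvd int k - int l"
    moreover have "\<bar>int k - int l\<bar> < int m" using assms by linarith
    ultimately have "int k - int l = 0" using zdvd_imp_le[of "int m" "\<bar>int k - int l\<bar>"] by force
    then show "k = l" by simp
  qed simp
  finally show ?thesis .
qed

text \<open>
  The coefficient of the \<open>j\<close>-th random variable in the \<open>k\<close>-th eigenvalue of the circulant block of
  order \<open>2 * h - 1\<close>. The variable with index 0 sits on the diagonal and is counted once.
\<close>
definition circ_coeff :: "nat \<Rightarrow> nat \<Rightarrow> nat \<Rightarrow> real" where
  "circ_coeff h k j = (if j = 0 then 1 else 2 * cos (2 * pi * k * j / (2 * h - 1)))"

text \<open>
  The \<open>k\<close>-th eigenvalue, belonging to the Hartley vector \<open>k\<close>, of the leading principal block of order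
  \<open>2 * h - 1\<close> of the palindromic Toeplitz matrix of order \<open>2 * h\<close> with coefficients \<open>b\<close>.
\<close>
definition circ_eigenvalue :: "nat \<Rightarrow> nat \<Rightarrow> (nat \<Rightarrow> real) \<Rightarrow> real" where
  "circ_eigenvalue h k b = (\<Sum>j<h. circ_coeff h k j * b j)"

text \<open>
  The Hartley vectors are eigenvectors of the leading principal block.
\<close>
lemma palindromic_toeplitz_hartley:
  assumes h: "h > 0" and i: "i < 2 * h - 1"
  shows "(\<Sum>j<2 * h - 1. palindromic_toeplitz (2 * h) b $$ (i,j) * hartley (2 * h - 1) k j)
          = circ_eigenvalue h k b * hartley (2 * h - 1) k i"
proof -
  define m where "m = 2 * h - 1"
  have m: "m > 0" "real m = 2 * real h - 1" using h by (auto simp: m_def of_nat_diff)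
  define t where "t = 2 * pi * k / m"
  have tm: "t * m = 2 * pi * k" using m by (simp add: t_def)
  have cs: "cos (2 * pi * real k) = 1" "sin (2 * pi * real k) = 0"
    using cos_int_2pin[of "int k"] sin_int_2pin[of "int k"] by simp_all
  \<comment> \<open>\<open>c\<close> is the even periodic extension of the coefficients to the integers.\<close>
  define cc where "cc = (\<lambda>d. if d < h then b d else b (m - d))"
  define c where "c = (\<lambda>z. cc (nat (z mod int m)))"
  have cc_even: "cc (m - d) = cc d" if "0 < d" "d < m" for d
    using that by (auto simp: cc_def m_def)
  have c_nat: "c (int d) = cc d" if "d < m" for d
    using that by (simp add: c_def)
  have c_neg: "c (- int d) = cc d" if "d < m" for d
  proof (cases "d = 0")
    case False
    have "(- int d) mod int m = int m - int d"
      using that False by (simp add: zmod_zminus1_eq_if)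
    then have "c (- int d) = cc (m - d)" using that by (simp add: c_def nat_diff_distrib)
    then show ?thesis using cc_even[of d] that False by simp
  qed (simp add: c_def)
  have entry: "palindromic_toeplitz (2 * h) b $$ (i,j) = c (int j - int i)" if j: "j < m" for j
  proof -
    define d where "d = nat \<bar>int i - int j\<bar>"
    have d: "d < m" using i j by (auto simp: d_def m_def)
    have "palindromic_toeplitz (2 * h) b $$ (i,j) = cc d"
      using i j by (simp add: palindromic_toeplitz_def Let_def d_def cc_def m_def)
    also have "\<dots> = c (int j - int i)"
    proof (cases "i \<le> j")
      case True
      then have "int j - int i = int d" by (simp add: d_def)
      then show ?thesis using c_nat[OF d] by simp
    next
      case False
      then have "int j - int i = - int d" by (simp add: d_def)
      then show ?thesis using c_neg[OF d] by simp
    qed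
    finally show ?thesis .
  qed
  define f where "f = (\<lambda>z::int. c z * (cos (t * (z + int i)) + sin (t * (z + int i))))"
  have f_per: "f (z + int m) = f z" for z
  proof -
    have "t * of_int (z + int m + int i) = t * of_int (z + int i) + 2 * pi * real k"
      using tm by (simp add: algebra_simps)
    then show ?thesis
      unfolding f_def c_def by (simp add: sin_add cos_add cs del: of_int_add)
  qed
  have hart: "hartley m k j = (cos (t * j) + sin (t * j)) / sqrt m" for j
    by (simp add: hartley_def t_def)
  have "(\<Sum>j<m. palindromic_toeplitz (2 * h) b $$ (i,j) * hartley m k j)
      = (\<Sum>j<m. f (int j - int i)) / sqrt m"
    unfolding sum_divide_distrib by (intro sum.cong refl) (simp add: entry f_def hart)
  also have "(\<Sum>j<m. f (int j - int i)) = (\<Sum>d<m. f (int d))"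
    by (rule sum_periodic_shift) (rule f_per)
  \<comment> \<open>The addition theorem; the second sum vanishes because \<open>c\<close> is even.\<close>
  also have "\<dots> = (\<Sum>d<m. (cos (t * i) + sin (t * i)) * (cc d * cos (t * d))
                      + (cos (t * i) - sin (t * i)) * (cc d * sin (t * d)))"
    by (intro sum.cong refl) (simp add: f_def c_nat distrib_left cos_add sin_add algebra_simps)
  also have "\<dots> = (cos (t * i) + sin (t * i)) * (\<Sum>d<m. cc d * cos (t * d))
                + (cos (t * i) - sin (t * i)) * (\<Sum>d<m. cc d * sin (t * d))"
    by (simp add: sum.distrib sum_distrib_left)
  also have "(\<Sum>d<m. cc d * sin (t * d)) = 0"
  proof (rule sum_odd_on_cycle)
    fix d assume d: "0 < d" "d < m"
    have "t * real (m - d) = 2 * pi * of_int (int k) - t * d"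
      using tm d by (simp add: of_nat_diff algebra_simps)
    then show "cc (m - d) * sin (t * real (m - d)) = - (cc d * sin (t * real d))"
      using cc_even[OF d] by (simp add: sin_diff cs)
  qed simp
  also have "(\<Sum>d<m. cc d * cos (t * d)) = circ_eigenvalue h k b"
  proof -
    have "(\<Sum>d<m. cc d * cos (t * d)) = cc 0 * cos (t * real 0) + 2 * (\<Sum>d\<in>{1..<h}. cc d * cos (t * d))"
      unfolding m_def
    proof (rule sum_even_on_odd_cycle[OF h], fold m_def)
      fix d assume d: "0 < d" "d < m"
      have "t * real (m - d) = 2 * pi * of_int (int k) - t * d"
        using tm d by (simp add: of_nat_diff algebra_simps)
      then show "cc (m - d) * cos (t * real (m - d)) = cc d * cos (t * real d)"
        using cc_even[OF d] by (simp add: cos_diff cs)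
    qed
    also have "\<dots> = b 0 + (\<Sum>d\<in>{1..<h}. circ_coeff h k d * b d)"
      using h m unfolding sum_distrib_left
      by (intro arg_cong2[where f="(+)"] sum.cong) (auto simp: cc_def circ_coeff_def t_def)
    also have "\<dots> = (\<Sum>d\<in>insert 0 {1..<h}. circ_coeff h k d * b d)"
      by (simp add: circ_coeff_def)
    also have "insert 0 {1..<h} = {..<h}" using h by auto
    finally show ?thesis by (simp add: circ_eigenvalue_def)
  qed
  finally show ?thesis unfolding m_def[symmetric] by (simp add: hart mult.commute)
qed

text \<open>
  For \<open>k = l\<close> this computes the variance of an eigenvalue, and for \<open>k \<noteq> l\<close> it shows that two
  eigenvalues are almost uncorrelated.
\<close>
lemma sum_circ_coeff_prod:
  fixes k l :: nat
  assumes h: "h > 0"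
  defines "m \<equiv> 2 * h - 1"
  assumes "\<not> int m dvd int k + int l"
  shows "(\<Sum>j<h. circ_coeff h k j * circ_coeff h l j) = (if int m dvd int k - int l then real m - 1 else - 1)"
proof -
  have m: "m > 0" "real m = 2 * real h - 1" using h by (auto simp: m_def of_nat_diff)
  have half: "(\<Sum>j\<in>{1..<h}. cos (2 * pi * r * j / m)) = ((if int m dvd r then real m else 0) - 1) / 2" for r :: int
  proof -
    have "(\<Sum>d<m. cos (2 * pi * r * d / m)) = cos (2 * pi * r * real 0 / m) + 2 * (\<Sum>d\<in>{1..<h}. cos (2 * pi * r * d / m))"
      unfolding m_def
    proof (rule sum_even_on_odd_cycle[OF h], fold m_def)
      fix d assume d: "0 < d" "d < m"
      have "2 * pi * r * real (m - d) / m = 2 * pi * of_int r - 2 * pi * r * d / m"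
        using m(1) d by (simp add: of_nat_diff field_simps)
      then show "cos (2 * pi * r * real (m - d) / m) = cos (2 * pi * r * d / m)"
        by (simp add: cos_diff)
    qed
    then show ?thesis unfolding sum_cos_roots_of_unity[OF m(1)] by simp
  qed
  have split: "{..<h} = insert 0 {1..<h}" using h by auto
  have "(\<Sum>j<h. circ_coeff h k j * circ_coeff h l j)
      = 1 + (\<Sum>j\<in>{1..<h}. circ_coeff h k j * circ_coeff h l j)"
    unfolding split by (simp add: circ_coeff_def)
  also have "(\<Sum>j\<in>{1..<h}. circ_coeff h k j * circ_coeff h l j)
     = (\<Sum>j\<in>{1..<h}. 2 * cos (2 * pi * real_of_int (int k - int l) * real j / m)
        + 2 * cos (2 * pi * real_of_int (int k + int l) * real j / m))"
  proof (intro sum.cong refl)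
    fix j assume "j \<in> {1..<h}"
    define x where "x = 2 * pi * k * j / m"
    define y where "y = 2 * pi * l * j / m"
    have e: "2 * pi * real_of_int (int k - int l) * real j / m = x - y"
            "2 * pi * real_of_int (int k + int l) * real j / m = x + y"
      by (simp_all add: x_def y_def algebra_simps diff_divide_distrib add_divide_distrib)
    have "circ_coeff h k j * circ_coeff h l j = (2 * cos x) * (2 * cos y)"
      using \<open>j \<in> _\<close> m by (simp add: circ_coeff_def x_def y_def)
    also have "\<dots> = 2 * cos (x - y) + 2 * cos (x + y)"
      by (simp add: cos_diff cos_add algebra_simps)
    finally show "circ_coeff h k j * circ_coeff h l j
        = 2 * cos (2 * pi * real_of_int (int k - int l) * real j / m)
          + 2 * cos (2 * pi * real_of_int (int k + int l) * real j / m)"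
      unfolding e .
  qed
  also have "\<dots> = (if int m dvd int k - int l then real m else 0) - 1 + - 1"
    unfolding sum.distrib sum_distrib_left[symmetric] half using assms(3) by (simp add: field_simps)
  finally show ?thesis by simp
qed

section \<open>Comparing eigenvalue counts by dimension\<close>

lemma orthonormal_expansion_inner:
  fixes u :: "nat \<Rightarrow> nat \<Rightarrow> real"
  assumes "finite K" and orth: "\<And>k l. k \<in> K \<Longrightarrow> l \<in> K \<Longrightarrow> (\<Sum>i<n. u k i * u l i) = (if k = l then 1 else 0)"
  shows "(\<Sum>i<n. (\<Sum>k\<in>K. x k * u k i) * (\<Sum>l\<in>K. y l * u l i)) = (\<Sum>k\<in>K. x k * y k)"
proof -
  have "(\<Sum>i<n. (\<Sum>k\<in>K. x k * u k i) * (\<Sum>l\<in>K. y l * u l i))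
      = (\<Sum>i<n. \<Sum>k\<in>K. \<Sum>l\<in>K. x k * y l * (u k i * u l i))"
    by (simp add: sum_product mult_ac)
  also have "\<dots> = (\<Sum>k\<in>K. \<Sum>i<n. \<Sum>l\<in>K. x k * y l * (u k i * u l i))"
    by (rule sum.swap)
  also have "\<dots> = (\<Sum>k\<in>K. \<Sum>l\<in>K. \<Sum>i<n. x k * y l * (u k i * u l i))"
    by (rule sum.cong[OF refl], rule sum.swap)
  also have "\<dots> = (\<Sum>k\<in>K. \<Sum>l\<in>K. x k * y l * (if k = l then 1 else 0))"
    by (intro sum.cong refl) (simp add: sum_distrib_left[symmetric] orth)
  also have "\<dots> = (\<Sum>k\<in>K. x k * y k)"
    using assms(1) by (simp add: if_distrib sum.delta cong: if_cong)
  finally show ?thesis .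
qed

text \<open>
  The dimension count. The vectors \<open>w j\<close> are orthonormal eigenvectors of \<open>C\<close> with eigenvalues \<open>d j\<close>, and on the
  vectors orthogonal to \<open>a\<close> in the span of the orthonormal \<open>u k\<close> the quadratic form of \<open>C\<close> is diagonal with
  coefficients \<open>\<kappa> k\<close>. If
  the index sets \<open>K\<close> and \<open>J\<close> are large enough, the spans of \<open>u\<close> over \<open>K\<close> and of \<open>w\<close> over \<open>J\<close> have a
  common nonzero vector orthogonal to \<open>a\<close>; the conclusion compares the two expressions for its norm and for its
  quadratic form.
\<close>
lemma common_vector_of_orthonormal_families:
  fixes C :: "nat \<Rightarrow> nat \<Rightarrow> real" and w u :: "nat \<Rightarrow> nat \<Rightarrow> real" and a :: "nat \<Rightarrow> real"
  assumes w: "\<And>j l. j < n \<Longrightarrow> l < n \<Longrightarrow> (\<Sum>i<n. w j i * w l i) = (if j = l then 1 else 0)"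
    and Cw: "\<And>j i. j < n \<Longrightarrow> i < n \<Longrightarrow> (\<Sum>k<n. C i k * w j k) = d j * w j i"
    and u: "\<And>k l. k < m \<Longrightarrow> l < m \<Longrightarrow> (\<Sum>i<n. u k i * u l i) = (if k = l then 1 else 0)"
    and Cu: "\<And>\<alpha> K. K \<subseteq> {..<m} \<Longrightarrow> (\<Sum>k\<in>K. \<alpha> k * (\<Sum>i<n. a i * u k i)) = 0 \<Longrightarrow>
        (\<Sum>i<n. (\<Sum>k\<in>K. \<alpha> k * u k i) * (\<Sum>j<n. C i j * (\<Sum>k\<in>K. \<alpha> k * u k j))) = (\<Sum>k\<in>K. \<kappa> k * (\<alpha> k)\<^sup>2)"
    and K: "K \<subseteq> {..<m}" and J: "J \<subseteq> {..<n}" and card: "card K + card J > n + 1"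
  obtains \<alpha> \<beta> where "(\<Sum>k\<in>K. (\<alpha> k)\<^sup>2) = (\<Sum>j\<in>J. (\<beta> j)\<^sup>2)" "(\<Sum>j\<in>J. (\<beta> j)\<^sup>2) > 0"
    "(\<Sum>k\<in>K. \<kappa> k * (\<alpha> k)\<^sup>2) = (\<Sum>j\<in>J. d j * (\<beta> j)\<^sup>2)"
proof -
  have fin: "finite K" "finite J" using K J finite_subset by blast+
  \<comment> \<open>One equation for each coordinate, and equation \<open>n\<close> for orthogonality to \<open>a\<close>.\<close>
  define c where "c = (\<lambda>i s. case s of
      Inl k \<Rightarrow> if i < n then u k i else (\<Sum>i<n. a i * u k i)
    | Inr j \<Rightarrow> if i < n then - w j i else 0)"
  have "card (K <+> J) = card K + card J" using fin by (rule card_Plus)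
  then have "card {..n} < card (K <+> J)" using card by simp
  then obtain x where x: "\<exists>s\<in>K <+> J. x s \<noteq> 0" "\<forall>i\<in>{..n}. (\<Sum>s\<in>K <+> J. c i s * x s) = 0"
    using homogeneous_system_nontrivial[of "{..n}" "K <+> J" c] fin by auto
  define \<alpha> where "\<alpha> = (\<lambda>k. x (Inl k))"
  define \<beta> where "\<beta> = (\<lambda>j. x (Inr j))"
  have split: "(\<Sum>s\<in>K <+> J. c i s * x s) = (\<Sum>k\<in>K. c i (Inl k) * \<alpha> k) + (\<Sum>j\<in>J. c i (Inr j) * \<beta> j)" for i
    using fin by (simp add: sum.Plus \<alpha>_def \<beta>_def)
  have eq: "(\<Sum>k\<in>K. \<alpha> k * u k i) = (\<Sum>j\<in>J. \<beta> j * w j i)" if "i < n" for i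
  proof -
    have "(\<Sum>s\<in>K <+> J. c i s * x s) = 0" using x(2) that by simp
    then show ?thesis
      unfolding split using that by (simp add: c_def sum_negf mult.commute)
  qed
  have "(\<Sum>s\<in>K <+> J. c n s * x s) = 0" using x(2) by simp
  then have a0: "(\<Sum>k\<in>K. \<alpha> k * (\<Sum>i<n. a i * u k i)) = 0"
    unfolding split by (simp add: c_def mult.commute)
  have uK: "(\<Sum>i<n. u k i * u l i) = (if k = l then 1 else 0)" if "k \<in> K" "l \<in> K" for k l
    using u K that by blast
  have wJ: "(\<Sum>i<n. w k i * w l i) = (if k = l then 1 else 0)" if "k \<in> J" "l \<in> J" for k l
    using w J that by blast
  have "(\<Sum>k\<in>K. \<alpha> k * \<alpha> k) = (\<Sum>i<n. (\<Sum>k\<in>K. \<alpha> k * u k i) * (\<Sum>k\<in>K. \<alpha> k * u k i))"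
    by (rule orthonormal_expansion_inner[OF fin(1) uK, symmetric])
  also have "\<dots> = (\<Sum>i<n. (\<Sum>j\<in>J. \<beta> j * w j i) * (\<Sum>j\<in>J. \<beta> j * w j i))"
    by (intro sum.cong) (auto simp: eq)
  also have "\<dots> = (\<Sum>j\<in>J. \<beta> j * \<beta> j)"
    by (rule orthonormal_expansion_inner[OF fin(2) wJ])
  finally have norm: "(\<Sum>k\<in>K. (\<alpha> k)\<^sup>2) = (\<Sum>j\<in>J. (\<beta> j)\<^sup>2)" by (simp add: power2_eq_square)
  have pos: "(\<Sum>j\<in>J. (\<beta> j)\<^sup>2) > 0"
  proof (rule ccontr)
    assume "\<not> ?thesis"
    moreover have "(\<Sum>j\<in>J. (\<beta> j)\<^sup>2) \<ge> 0" by (simp add: sum_nonneg)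
    ultimately have z: "(\<Sum>j\<in>J. (\<beta> j)\<^sup>2) = 0" by simp
    then have "\<forall>j\<in>J. \<beta> j = 0" using fin by (simp add: sum_nonneg_eq_0_iff)
    moreover have "\<forall>k\<in>K. \<alpha> k = 0" using z norm fin by (simp add: sum_nonneg_eq_0_iff)
    ultimately show False using x(1) by (auto simp: \<alpha>_def \<beta>_def)
  qed
  have Cv: "(\<Sum>j<n. C i j * (\<Sum>l\<in>J. \<beta> l * w l j)) = (\<Sum>l\<in>J. (d l * \<beta> l) * w l i)" if "i < n" for i
  proof -
    have "(\<Sum>j<n. C i j * (\<Sum>l\<in>J. \<beta> l * w l j)) = (\<Sum>j<n. \<Sum>l\<in>J. \<beta> l * (C i j * w l j))"
      by (simp add: sum_distrib_left mult_ac)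
    also have "\<dots> = (\<Sum>l\<in>J. \<beta> l * (\<Sum>j<n. C i j * w l j))"
      by (subst sum.swap) (simp add: sum_distrib_left)
    also have "\<dots> = (\<Sum>l\<in>J. (d l * \<beta> l) * w l i)"
      using J that by (intro sum.cong refl) (auto simp: Cw subset_iff)
    finally show ?thesis .
  qed
  have "(\<Sum>k\<in>K. \<kappa> k * (\<alpha> k)\<^sup>2)
      = (\<Sum>i<n. (\<Sum>k\<in>K. \<alpha> k * u k i) * (\<Sum>j<n. C i j * (\<Sum>k\<in>K. \<alpha> k * u k j)))"
    by (rule Cu[OF K a0, symmetric])
  also have "\<dots> = (\<Sum>i<n. (\<Sum>l\<in>J. \<beta> l * w l i) * (\<Sum>l\<in>J. (d l * \<beta> l) * w l i))"
    by (intro sum.cong refl) (simp add: eq Cv)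
  also have "\<dots> = (\<Sum>l\<in>J. \<beta> l * (d l * \<beta> l))"
    by (rule orthonormal_expansion_inner[OF fin(2) wJ])
  finally have "(\<Sum>k\<in>K. \<kappa> k * (\<alpha> k)\<^sup>2) = (\<Sum>j\<in>J. d j * (\<beta> j)\<^sup>2)"
    by (simp add: power2_eq_square mult_ac)
  with norm pos show ?thesis by (rule that)
qed

text \<open>
  A weak form of Cauchy interlacing: passing to \<open>m\<close> of \<open>n\<close> dimensions and imposing one further linear
  condition changes the number of eigenvalues up to \<open>y\<close> by at most \<open>1\<close> and \<open>n - m + 1\<close>, respectively.
\<close>
lemma eigenvalue_count_compression:
  fixes C :: "nat \<Rightarrow> nat \<Rightarrow> real" and w u :: "nat \<Rightarrow> nat \<Rightarrow> real" and a :: "nat \<Rightarrow> real"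
  assumes w: "\<And>j l. j < n \<Longrightarrow> l < n \<Longrightarrow> (\<Sum>i<n. w j i * w l i) = (if j = l then 1 else 0)"
    and Cw: "\<And>j i. j < n \<Longrightarrow> i < n \<Longrightarrow> (\<Sum>k<n. C i k * w j k) = d j * w j i"
    and u: "\<And>k l. k < m \<Longrightarrow> l < m \<Longrightarrow> (\<Sum>i<n. u k i * u l i) = (if k = l then 1 else 0)"
    and Cu: "\<And>\<alpha> K. K \<subseteq> {..<m} \<Longrightarrow> (\<Sum>k\<in>K. \<alpha> k * (\<Sum>i<n. a i * u k i)) = 0 \<Longrightarrow>
        (\<Sum>i<n. (\<Sum>k\<in>K. \<alpha> k * u k i) * (\<Sum>j<n. C i j * (\<Sum>k\<in>K. \<alpha> k * u k j))) = (\<Sum>k\<in>K. \<kappa> k * (\<alpha> k)\<^sup>2)"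
  shows "card {k. k < m \<and> \<kappa> k \<le> y} \<le> card {j. j < n \<and> d j \<le> y} + 1"
    and "card {j. j < n \<and> d j \<le> y} + m \<le> card {k. k < m \<and> \<kappa> k \<le> y} + n + 1"
proof -
  let ?K = "{k. k < m \<and> \<kappa> k \<le> y}" and ?K' = "{k. k < m \<and> \<kappa> k > y}"
  let ?J = "{j. j < n \<and> d j \<le> y}" and ?J' = "{j. j < n \<and> d j > y}"
  have cK: "card ?K + card ?K' = m"
  proof -
    have "card (?K \<union> ?K') = card ?K + card ?K'" by (rule card_Un_disjoint) auto
    moreover have "?K \<union> ?K' = {..<m}" by auto
    ultimately show ?thesis by simp
  qed
  have cJ: "card ?J + card ?J' = n"
  proof -
    have "card (?J \<union> ?J') = card ?J + card ?J'" by (rule card_Un_disjoint) auto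
    moreover have "?J \<union> ?J' = {..<n}" by auto
    ultimately show ?thesis by simp
  qed
  note common = common_vector_of_orthonormal_families[of n w C d m u a \<kappa>, OF w Cw u Cu]
  have 1: "card ?K + card ?J' \<le> n + 1"
  proof (rule ccontr)
    assume "\<not> ?thesis"
    then have "card ?K + card ?J' > n + 1" by simp
    then obtain \<alpha> \<beta> where ab: "(\<Sum>k\<in>?K. (\<alpha> k)\<^sup>2) = (\<Sum>j\<in>?J'. (\<beta> j)\<^sup>2)" "(\<Sum>j\<in>?J'. (\<beta> j)\<^sup>2) > 0"
        "(\<Sum>k\<in>?K. \<kappa> k * (\<alpha> k)\<^sup>2) = (\<Sum>j\<in>?J'. d j * (\<beta> j)\<^sup>2)"
      using common[of ?K ?J'] by blast
    have "(\<Sum>k\<in>?K. \<kappa> k * (\<alpha> k)\<^sup>2) \<le> (\<Sum>k\<in>?K. y * (\<alpha> k)\<^sup>2)"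
      by (intro sum_mono mult_right_mono) auto
    moreover have "(\<Sum>j\<in>?J'. y * (\<beta> j)\<^sup>2) < (\<Sum>j\<in>?J'. d j * (\<beta> j)\<^sup>2)"
    proof -
      have "\<exists>j\<in>?J'. (\<beta> j)\<^sup>2 \<noteq> 0" using ab(2) by (metis (no_types, lifting) less_irrefl sum.neutral)
      then obtain j where j: "j \<in> ?J'" "(\<beta> j)\<^sup>2 > 0" by auto
      show ?thesis
        by (rule sum_strict_mono_ex1) (use j in \<open>auto intro!: mult_right_mono mult_strict_right_mono bexI[of _ j]\<close>)
    qed
    ultimately show False using ab by (simp add: sum_distrib_left[symmetric])
  qed
  have 2: "card ?K' + card ?J \<le> n + 1"
  proof (rule ccontr)
    assume "\<not> ?thesis"
    then have "card ?K' + card ?J > n + 1" by simp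
    then obtain \<alpha> \<beta> where ab: "(\<Sum>k\<in>?K'. (\<alpha> k)\<^sup>2) = (\<Sum>j\<in>?J. (\<beta> j)\<^sup>2)" "(\<Sum>j\<in>?J. (\<beta> j)\<^sup>2) > 0"
        "(\<Sum>k\<in>?K'. \<kappa> k * (\<alpha> k)\<^sup>2) = (\<Sum>j\<in>?J. d j * (\<beta> j)\<^sup>2)"
      using common[of ?K' ?J] by blast
    have "(\<Sum>j\<in>?J. d j * (\<beta> j)\<^sup>2) \<le> (\<Sum>j\<in>?J. y * (\<beta> j)\<^sup>2)"
      by (intro sum_mono mult_right_mono) auto
    moreover have "(\<Sum>k\<in>?K'. y * (\<alpha> k)\<^sup>2) < (\<Sum>k\<in>?K'. \<kappa> k * (\<alpha> k)\<^sup>2)"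
    proof -
      have "\<exists>k\<in>?K'. (\<alpha> k)\<^sup>2 \<noteq> 0" using ab(1,2) by (metis (no_types, lifting) less_irrefl sum.neutral)
      then obtain k where k: "k \<in> ?K'" "(\<alpha> k)\<^sup>2 > 0" by auto
      show ?thesis
        by (rule sum_strict_mono_ex1) (use k in \<open>auto intro!: mult_right_mono mult_strict_right_mono bexI[of _ k]\<close>)
    qed
    ultimately show False using ab by (simp add: sum_distrib_left[symmetric])
  qed
  show "card ?K \<le> card ?J + 1" using 1 cJ by linarith
  show "card ?J + m \<le> card ?K + n + 1" using 2 cK by linarith
qed

lemma palindromic_toeplitz_symmetric:
  "i < n \<Longrightarrow> j < n \<Longrightarrow> palindromic_toeplitz n b $$ (i,j) = palindromic_toeplitz n b $$ (j,i)"
  by (simp add: palindromic_toeplitz_def abs_minus_commute)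

lemma scaled_esd_eq_count:
  fixes C :: "real mat"
  assumes C: "C \<in> carrier_mat n n"
    and cp: "char_poly C = (\<Prod>j<n. [:- d j, 1:])"
  shows "scaled_esd C x = real (card {j. j < n \<and> d j / n \<le> x}) / n"
proof -
  define J where "J = {j. j < n \<and> d j / n \<le> x}"
  have fin: "finite J" by (simp add: J_def)
  have ev: "eigenvalue C l \<longleftrightarrow> (\<exists>j<n. d j = l)" for l
    by (auto simp: eigenvalue_root_char_poly[OF C] cp poly_prod)
  have set: "{l. eigenvalue C l \<and> l / real n \<le> x} = d ` J"
    by (auto simp: ev J_def)
  have "(\<Sum>l\<in>d ` J. Polynomial.order l (char_poly C)) = (\<Sum>l\<in>d ` J. card {j\<in>J. d j = l})"
  proof (intro sum.cong refl)
    fix l assume "l \<in> d ` J"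
    then have "{j\<in>{..<n}. d j = l} = {j\<in>J. d j = l}" by (auto simp: J_def)
    then show "Polynomial.order l (char_poly C) = card {j\<in>J. d j = l}"
      unfolding cp by (simp add: order_prod_linear_factors)
  qed
  also have "\<dots> = card J"
    using sum.image_gen[OF fin, of "\<lambda>_. 1::nat" d] by simp
  finally have "(\<Sum>l\<in>d ` J. Polynomial.order l (char_poly C)) = card J" .
  moreover have "dim_row C = n" using C by simp
  ultimately show ?thesis by (simp add: scaled_esd_def set J_def)
qed

lemma scaled_esd_anticommutator_palindromic_toeplitz:
  fixes b c :: "nat \<Rightarrow> real"
  assumes h: "h > 0"
  defines "m \<equiv> 2 * h - 1"
  defines "A \<equiv> palindromic_toeplitz (2 * h) b" and "B \<equiv> palindromic_toeplitz (2 * h) c"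
  shows "\<bar>scaled_esd (anticommutator A B) x
     - real (card {k. k < m \<and> 2 * circ_eigenvalue h k b * circ_eigenvalue h k c / real (2 * h) \<le> x}) / m\<bar>
     \<le> 3 / real (2 * h)"
proof -
  define n where "n = 2 * h"
  have nm: "n = Suc m" "m > 0" using h by (auto simp: n_def m_def)
  define C where "C = anticommutator A B"
  have car: "A \<in> carrier_mat n n" "B \<in> carrier_mat n n"
    by (simp_all add: A_def B_def n_def palindromic_toeplitz_def)
  have C: "C \<in> carrier_mat n n" using car by (simp add: C_def anticommutator_def)
  have symA: "A $$ (i,j) = A $$ (j,i)" and symB: "B $$ (i,j) = B $$ (j,i)" if "i < n" "j < n" for i j
    using that by (auto simp: A_def B_def n_def intro: palindromic_toeplitz_symmetric)
  have C_entry: "C $$ (i,j) = (\<Sum>l<n. A $$ (i,l) * B $$ (l,j) + B $$ (i,l) * A $$ (l,j))"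
    if "i < n" "j < n" for i j
    using car that by (simp add: C_def anticommutator_def scalar_prod_def lessThan_atLeast0 sum.distrib)
  have "transpose_mat C = C"
  proof (intro eq_matI)
    fix i j assume "i < dim_row C" "j < dim_col C"
    then have ij: "i < n" "j < n" using C by auto
    have "C $$ (j,i) = C $$ (i,j)"
      unfolding C_entry[OF ij] C_entry[OF ij(2,1)]
      by (intro sum.cong refl) (use ij in \<open>simp add: symA[of _ i] symA[of j] symB[of _ i] symB[of j] mult.commute\<close>)
    then show "transpose_mat C $$ (i,j) = C $$ (i,j)" using C ij by simp
  qed (use C in auto)
  with C obtain w d where
      w: "\<And>j l. j < n \<Longrightarrow> l < n \<Longrightarrow> (\<Sum>i<n. w j i * w l i) = (if j = l then 1 else (0::real))"
      and Cw: "\<And>j i. j < n \<Longrightarrow> i < n \<Longrightarrow> (\<Sum>k<n. C $$ (i,k) * w j k) = d j * w j i"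
      and cp: "char_poly C = (\<Prod>j<n. [:- d j, 1:])"
    using symmetric_real_mat_orthonormal_eigenbasis by blast
  define u where "u = (\<lambda>k i. if i < m then hartley m k i else 0)"
  define la where "la = (\<lambda>k. circ_eigenvalue h k b)"
  define mu where "mu = (\<lambda>k. circ_eigenvalue h k c)"
  have u: "(\<Sum>i<n. u k i * u l i) = (if k = l then 1 else 0)" if "k < m" "l < m" for k l
    using hartley_orthonormal[OF that] by (simp add: nm u_def)
  have form: "(\<Sum>i<n. (\<Sum>k\<in>K. \<alpha> k * u k i) * (\<Sum>j<n. C $$ (i,j) * (\<Sum>k\<in>K. \<alpha> k * u k j)))
      = (\<Sum>k\<in>K. 2 * la k * mu k * (\<alpha> k)\<^sup>2)"
    if K: "K \<subseteq> {..<m}" and a: "(\<Sum>k\<in>K. \<alpha> k * (\<Sum>i<n. A $$ (m,i) * u k i)) = 0" for \<alpha> K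
  proof -
    define v where "v = (\<lambda>i. \<Sum>k\<in>K. \<alpha> k * u k i)"
    define Av where "Av = (\<lambda>i. \<Sum>j<n. A $$ (i,j) * v j)"
    define Bv where "Bv = (\<lambda>i. \<Sum>j<n. B $$ (i,j) * v j)"
    have vm: "v m = 0" by (simp add: v_def u_def)
    have "(\<Sum>i<n. v i * (\<Sum>j<n. C $$ (i,j) * v j)) = (\<Sum>i<n. v i * (\<Sum>l<n. A $$ (i,l) * Bv l + B $$ (i,l) * Av l))"
    proof (rule sum.cong[OF refl], rule arg_cong2[where f="(*)", OF refl])
      fix i assume i: "i \<in> {..<n}"
      have "(\<Sum>j<n. C $$ (i,j) * v j) = (\<Sum>j<n. \<Sum>l<n. A $$ (i,l) * (B $$ (l,j) * v j) + B $$ (i,l) * (A $$ (l,j) * v j))"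
        using i by (intro sum.cong refl) (simp add: C_entry sum_distrib_left sum_distrib_right algebra_simps)
      also have "\<dots> = (\<Sum>l<n. \<Sum>j<n. A $$ (i,l) * (B $$ (l,j) * v j) + B $$ (i,l) * (A $$ (l,j) * v j))"
        by (rule sum.swap)
      also have "\<dots> = (\<Sum>l<n. A $$ (i,l) * Bv l + B $$ (i,l) * Av l)"
        by (simp add: Av_def Bv_def sum.distrib sum_distrib_left)
      finally show "(\<Sum>j<n. C $$ (i,j) * v j) = (\<Sum>l<n. A $$ (i,l) * Bv l + B $$ (i,l) * Av l)" .
    qed
    also have "\<dots> = (\<Sum>i<n. \<Sum>l<n. (A $$ (l,i) * v i) * Bv l + (B $$ (l,i) * v i) * Av l)"
      unfolding sum_distrib_left
      by (intro sum.cong refl) (simp add: symA symB algebra_simps)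
    also have "\<dots> = (\<Sum>l<n. \<Sum>i<n. (A $$ (l,i) * v i) * Bv l + (B $$ (l,i) * v i) * Av l)"
      by (rule sum.swap)
    also have "\<dots> = (\<Sum>l<n. 2 * (Av l * Bv l))"
      by (intro sum.cong refl) (simp add: Av_def Bv_def sum.distrib sum_distrib_right[symmetric] mult.commute)
    also have "\<dots> = (\<Sum>l<m. 2 * (Av l * Bv l)) + 2 * (Av m * Bv m)" by (simp add: nm)
    also have "Av m = 0"
    proof -
      \<comment> \<open>This is the linear condition imposed on \<open>v\<close>.\<close>
      have "Av m = (\<Sum>j<n. \<Sum>k\<in>K. \<alpha> k * (A $$ (m,j) * u k j))"
        by (simp add: Av_def v_def sum_distrib_left mult_ac)
      also have "\<dots> = (\<Sum>k\<in>K. \<alpha> k * (\<Sum>i<n. A $$ (m,i) * u k i))"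
        by (subst sum.swap) (simp add: sum_distrib_left)
      finally show ?thesis using a by simp
    qed
    finally have step: "(\<Sum>i<n. v i * (\<Sum>j<n. C $$ (i,j) * v j)) = (\<Sum>l<m. 2 * (Av l * Bv l))" by simp
    have circ: "(\<Sum>j<n. palindromic_toeplitz (2 * h) x $$ (i,j) * v j) = (\<Sum>k\<in>K. (\<alpha> k * circ_eigenvalue h k x) * hartley m k i)"
      if i: "i < m" for i x
    proof -
      have "(\<Sum>j<n. palindromic_toeplitz (2 * h) x $$ (i,j) * v j) = (\<Sum>j<m. palindromic_toeplitz (2 * h) x $$ (i,j) * v j)"
        by (simp add: nm vm)
      also have "\<dots> = (\<Sum>j<m. \<Sum>k\<in>K. \<alpha> k * (palindromic_toeplitz (2 * h) x $$ (i,j) * hartley m k j))"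
        by (intro sum.cong refl) (simp add: v_def u_def sum_distrib_left sum_distrib_right mult_ac)
      also have "\<dots> = (\<Sum>k\<in>K. \<alpha> k * (\<Sum>j<m. palindromic_toeplitz (2 * h) x $$ (i,j) * hartley m k j))"
        by (subst sum.swap) (simp add: sum_distrib_left)
      also have "\<dots> = (\<Sum>k\<in>K. \<alpha> k * (circ_eigenvalue h k x * hartley m k i))"
        using palindromic_toeplitz_hartley[OF h, of i x] i by (simp add: m_def)
      finally show ?thesis by (simp add: mult.assoc)
    qed
    have "(\<Sum>l<m. 2 * (Av l * Bv l)) = 2 * (\<Sum>l<m. (\<Sum>k\<in>K. (\<alpha> k * la k) * hartley m k l) * (\<Sum>k\<in>K. (\<alpha> k * mu k) * hartley m k l))"
      unfolding sum_distrib_left[of 2]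
      by (intro sum.cong refl) (simp add: Av_def Bv_def A_def B_def circ la_def mu_def)
    also have "(\<Sum>l<m. (\<Sum>k\<in>K. (\<alpha> k * la k) * hartley m k l) * (\<Sum>k\<in>K. (\<alpha> k * mu k) * hartley m k l))
       = (\<Sum>k\<in>K. (\<alpha> k * la k) * (\<alpha> k * mu k))"
    proof (rule orthonormal_expansion_inner)
      show "finite K" using K by (rule finite_subset) simp
      show "(\<Sum>i<m. hartley m k i * hartley m l i) = (if k = l then 1 else 0)" if "k \<in> K" "l \<in> K" for k l
        by (rule hartley_orthonormal) (use that K in auto)
    qed
    finally have "(\<Sum>l<m. 2 * (Av l * Bv l)) = (\<Sum>k\<in>K. 2 * la k * mu k * (\<alpha> k)\<^sup>2)"
      by (simp add: sum_distrib_left power2_eq_square mult_ac)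
    with step show ?thesis by (simp add: v_def)
  qed
  define p where "p = card {k. k < m \<and> 2 * la k * mu k / n \<le> x}"
  define q where "q = card {j. j < n \<and> d j / n \<le> x}"
  have n0: "real n > 0" using nm by simp
  have conv: "t / real n \<le> x \<longleftrightarrow> t \<le> n * x" for t using n0 by (simp add: field_simps)
  note cnt = eigenvalue_count_compression[of n w "\<lambda>i j. C $$ (i,j)" d m u "\<lambda>i. A $$ (m,i)" "\<lambda>k. 2 * la k * mu k" "n * x",
      OF w Cw u form]
  have pq: "p \<le> q + 1" "q \<le> p + 2"
    using cnt unfolding p_def q_def conv by (simp_all add: nm(1))
  have pm: "p \<le> m" unfolding p_def using card_mono[of "{..<m}" "{k. k < m \<and> 2 * la k * mu k / n \<le> x}"] by fastforce
  have "scaled_esd C x = q / n" unfolding q_def by (rule scaled_esd_eq_count[OF C cp])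
  moreover have "\<bar>q / n - p / m\<bar> \<le> 3 / real n"
  proof -
    define c where "c = 1 / real n"
    have c: "c > 0" using n0 by (simp add: c_def)
    have "real p / m - real p / n = real p / (real m * real n)"
      using nm by (simp add: field_simps)
    moreover have "real p / (real m * real n) \<le> c"
    proof -
      have "real p / (real m * real n) \<le> real m / (real m * real n)"
        using pm by (intro divide_right_mono) auto
      then show ?thesis using nm by (simp add: c_def)
    qed
    moreover have "0 \<le> real p / (real m * real n)" by simp
    moreover have "real q / n \<le> real p / n + 2 * c" "real p / n \<le> real q / n + c"
      using pq n0 by (simp_all add: c_def add_divide_distrib[symmetric] divide_right_mono)
    ultimately have "\<bar>q / n - p / m\<bar> \<le> 3 * c" using c by linarith
    then show ?thesis by (simp add: c_def)
  qed
  ultimately show ?thesis by (simp add: C_def p_def n_def la_def mu_def)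
qed

section \<open>Characteristic functions of linear forms in i.i.d. variables\<close>

lemma char_pte_law_approx:
  assumes "pte_law D"
  shows "cmod (char D a - (1 - a\<^sup>2 / 2)) \<le> (\<integral>x. \<bar>x\<bar>^3 \<partial>D) / 6 * \<bar>a\<bar>^3"
proof -
  interpret real_distribution D using assms by (simp add: pte_law_def)
  have int: "integrable D (\<lambda>x. x ^ k)" for k using assms by (simp add: pte_law_def)
  have mean: "expectation (\<lambda>x. x) = 0" and var: "variance (\<lambda>x. x) = 1"
    using assms unfolding pte_law_def by blast+
  have int3: "integrable D (\<lambda>x. \<bar>x\<bar>^3)" using integrable_abs[OF int[of 3]] by (simp add: power_abs)
  have "cmod (char D a - (1 - a\<^sup>2 * 1 / 2)) \<le> (a\<^sup>2 / 6) * expectation (\<lambda>x. min (6 * x\<^sup>2) (\<bar>a\<bar> * \<bar>x\<bar>^3))"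
    using char_approx3[OF _ mean int[of 2] var] int[of 1] by simp
  also have "\<dots> \<le> (a\<^sup>2 / 6) * expectation (\<lambda>x. \<bar>a\<bar> * \<bar>x\<bar>^3)"
    by (intro mult_left_mono Bochner_Integration.integral_mono integrable_mult_right int3
        Bochner_Integration.integrable_bound[OF integrable_mult_right[OF int[of 2], of 6]]) auto
  also have "\<dots> = expectation (\<lambda>x. \<bar>x\<bar>^3) / 6 * \<bar>a\<bar>^3"
    unfolding integral_mult_right_zero by (simp add: power2_eq_square power3_eq_cube)
  finally show ?thesis by simp
qed

lemma pte_law_std_normal: "pte_law std_normal_distribution"
  unfolding pte_law_def
proof (intro conjI allI)
  show "real_distribution std_normal_distribution" by (rule real_dist_normal_dist)
  show "integrable std_normal_distribution (\<lambda>x. x ^ k)" for k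
    by (rule integrable_std_normal_distribution_moment)
  have "integral\<^sup>L std_normal_distribution (\<lambda>x. x ^ 1) = 0"
    by (rule integral_std_normal_distribution_moment_odd) simp
  then show mean: "integral\<^sup>L std_normal_distribution (\<lambda>x. x) = 0" by simp
  show "prob_space.variance std_normal_distribution (\<lambda>x. x) = 1"
    unfolding mean using std_normal_distribution_even_moments(1)[of 1] by simp
qed

lemma pte_law_second_moment:
  assumes "pte_law D"
  shows "(\<integral>x. x\<^sup>2 \<partial>D) = 1"
proof -
  have "(\<integral>x. x \<partial>D) = 0" "(\<integral>x. (x - (\<integral>x. x \<partial>D))\<^sup>2 \<partial>D) = 1"
    using assms unfolding pte_law_def by blast+
  then show ?thesis by simp
qed

text \<open>
  The constant in the comparison of the characteristic function of an entry law with the one of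
  the standard normal law; both are compared with \<open>1 - a\<^sup>2 / 2\<close>.
\<close>
definition third_moment_const :: "real measure \<Rightarrow> real" where
  "third_moment_const D = (\<integral>x. \<bar>x\<bar>^3 \<partial>D) / 6 + (\<integral>x. \<bar>x\<bar>^3 \<partial>std_normal_distribution) / 6"

lemma third_moment_const_nonneg: "third_moment_const D \<ge> 0"
  unfolding third_moment_const_def by (intro add_nonneg_nonneg divide_nonneg_nonneg) simp_all

lemma char_pte_law_normal:
  assumes "pte_law D"
  shows "cmod (char D a - exp (- a\<^sup>2 / 2)) \<le> third_moment_const D * \<bar>a\<bar>^3"
proof -
  have "cmod (char std_normal_distribution a - (1 - a\<^sup>2 / 2))
        \<le> (\<integral>x. \<bar>x\<bar>^3 \<partial>std_normal_distribution) / 6 * \<bar>a\<bar>^3"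
    by (rule char_pte_law_approx[OF pte_law_std_normal])
  then have "cmod ((1 - a\<^sup>2 / 2) - exp (- a\<^sup>2 / 2)) \<le> (\<integral>x. \<bar>x\<bar>^3 \<partial>std_normal_distribution) / 6 * \<bar>a\<bar>^3"
    by (simp add: char_std_normal_distribution norm_minus_commute)
  moreover have "cmod (char D a - (1 - a\<^sup>2 / 2)) \<le> (\<integral>x. \<bar>x\<bar>^3 \<partial>D) / 6 * \<bar>a\<bar>^3"
    by (rule char_pte_law_approx[OF assms])
  ultimately show ?thesis
    using norm_triangle_ineq[of "char D a - (1 - a\<^sup>2 / 2)" "(1 - a\<^sup>2 / 2) - exp (- a\<^sup>2 / 2)"]
    by (simp add: third_moment_const_def distrib_right)
qed

lemma pte_law_prob_space: "pte_law D \<Longrightarrow> prob_space D"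
  by (simp add: pte_law_def real_distribution_def)

lemma pte_law_sets: "pte_law D \<Longrightarrow> sets D = sets borel"
  by (simp add: pte_law_def real_distribution_def real_distribution_axioms_def)

text \<open>
  The joint law of the \<open>h\<close> independent entries that determine a palindromic Toeplitz matrix of order
  \<open>2 * h\<close>.
\<close>
definition iid_law :: "real measure \<Rightarrow> nat \<Rightarrow> (nat \<Rightarrow> real) measure" where
  "iid_law D h = (\<Pi>\<^sub>M i\<in>{..<h}. D)"

lemma prob_space_iid_law: "pte_law D \<Longrightarrow> prob_space (iid_law D h)"
  unfolding iid_law_def by (intro prob_space_PiM pte_law_prob_space)

lemma iid_law_component_measurable:
  assumes "pte_law D" "j < h"
  shows "(\<lambda>x. x j) \<in> borel_measurable (iid_law D h)"
proof -
  have "(\<lambda>x. x j) \<in> measurable (iid_law D h) D"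
    unfolding iid_law_def using assms by (intro measurable_component_singleton) auto
  then show ?thesis using pte_law_sets[OF assms(1)] measurable_cong_sets by blast
qed

lemma iid_law_linear_measurable:
  assumes "pte_law D"
  shows "(\<lambda>x. \<Sum>j<h. a j * x j) \<in> borel_measurable (iid_law D h)"
  by (intro borel_measurable_sum borel_measurable_times borel_measurable_const
      iid_law_component_measurable[OF assms]) auto

lemma char_iid_linear:
  assumes D: "pte_law D"
  shows "(CLINT x|iid_law D h. iexp (\<Sum>j<h. a j * x j)) = (\<Prod>j<h. char D (a j))"
proof -
  interpret D: prob_space D using D by (rule pte_law_prob_space)
  interpret product_sigma_finite "\<lambda>_::nat. D" by standard
  have "iexp (\<Sum>j<h. a j * x j) = (\<Prod>j<h. iexp (a j * x j))" for x
    by (simp add: exp_sum[symmetric] sum_distrib_left)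
  then have "(CLINT x|iid_law D h. iexp (\<Sum>j<h. a j * x j)) = (CLINT x|iid_law D h. (\<Prod>j<h. iexp (a j * x j)))"
    by simp
  also have "\<dots> = (\<Prod>j<h. CLINT x|D. iexp (a j * x))"
    unfolding iid_law_def
  proof (rule product_integral_prod)
    fix j
    show "integrable D (\<lambda>x. iexp (a j * x))"
      using pte_law_sets[OF D] by (intro D.integrable_iexp) (auto cong: measurable_cong_sets)
  qed simp
  finally show ?thesis by (simp add: char_def)
qed

text \<open>
  A quantitative central limit theorem for weighted sums, on the level of characteristic functions.
  The argument of the characteristic function is absorbed into the weights \<open>a\<close>.
\<close>
lemma char_iid_linear_normal:
  assumes D: "pte_law D"
  shows "cmod ((CLINT x|iid_law D h. iexp (\<Sum>j<h. a j * x j)) - exp (- (\<Sum>j<h. (a j)\<^sup>2) / 2))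
          \<le> third_moment_const D * (\<Sum>j<h. \<bar>a j\<bar>^3)"
proof -
  have "exp (- (\<Sum>j<h. (a j)\<^sup>2) / 2) = (\<Prod>j<h. exp (- (a j)\<^sup>2 / 2))"
    by (simp add: exp_sum[symmetric] sum_negf[symmetric] sum_divide_distrib)
  then have "cmod ((CLINT x|iid_law D h. iexp (\<Sum>j<h. a j * x j)) - exp (- (\<Sum>j<h. (a j)\<^sup>2) / 2))
     = cmod ((\<Prod>j<h. char D (a j)) - (\<Prod>j<h. complex_of_real (exp (- (a j)\<^sup>2 / 2))))"
    unfolding char_iid_linear[OF D] by (simp add: of_real_prod)
  also have "\<dots> \<le> (\<Sum>j<h. cmod (char D (a j) - complex_of_real (exp (- (a j)\<^sup>2 / 2))))"
    using D by (intro norm_prod_diff) (auto simp: pte_law_def real_distribution.cmod_char_le_1)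
  also have "\<dots> \<le> (\<Sum>j<h. third_moment_const D * \<bar>a j\<bar>^3)"
    by (intro sum_mono char_pte_law_normal D)
  finally show ?thesis by (simp add: sum_distrib_left)
qed

lemma iid_law_linear_second_moment:
  assumes D: "pte_law D"
  shows "integrable (iid_law D h) (\<lambda>x. (\<Sum>j<h. a j * x j)\<^sup>2)"
    and "(\<integral>x. (\<Sum>j<h. a j * x j)\<^sup>2 \<partial>iid_law D h) = (\<Sum>j<h. (a j)\<^sup>2)"
proof -
  interpret D: prob_space D using D by (rule pte_law_prob_space)
  interpret P: prob_space "iid_law D h" using D by (rule prob_space_iid_law)
  interpret product_sigma_finite "\<lambda>_::nat. D" by standard
  have int: "integrable D (\<lambda>x. x ^ k)" for k using D by (simp add: pte_law_def)
  \<comment> \<open>Write \<open>x i * x j\<close> as a product over all coordinates, with exponents \<open>e i j k\<close>.\<close>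
  define e where "e = (\<lambda>i j k::nat. (if k = i then 1 else 0) + (if k = j then 1 else (0::nat)))"
  have pr: "x i * x j = (\<Prod>k<h. x k ^ e i j k)" if "i < h" "j < h" for i j and x :: "nat \<Rightarrow> real"
  proof -
    have "(\<Prod>k<h. x k ^ e i j k) = (\<Prod>k<h. (if k = i then x k else 1) * (if k = j then x k else 1))"
      by (intro prod.cong refl) (auto simp: e_def)
    also have "\<dots> = x i * x j" using that by (simp add: prod.distrib prod.delta)
    finally show ?thesis by simp
  qed
  have int2: "integrable (iid_law D h) (\<lambda>x. x i * x j)" if "i < h" "j < h" for i j
    unfolding pr[OF that] iid_law_def by (rule product_integrable_prod) (auto intro: int)
  have cov: "(\<integral>x. x i * x j \<partial>iid_law D h) = (if i = j then 1 else 0)" if ij: "i < h" "j < h" for i j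
  proof -
    have "(\<integral>x. x i * x j \<partial>iid_law D h) = (\<Prod>k<h. \<integral>x. x ^ e i j k \<partial>D)"
      unfolding pr[OF ij] iid_law_def by (rule product_integral_prod) (auto intro: int)
    also have "\<dots> = (if i = j then 1 else 0)"
    proof (cases "i = j")
      case True
      have "(\<integral>x. x ^ e i j k \<partial>D) = 1" for k
        using pte_law_second_moment[OF D] True by (simp add: e_def D.prob_space power2_eq_square)
      then show ?thesis using True by simp
    next
      case False
      have "(\<integral>x. x ^ e i j i \<partial>D) = 0" using D False by (simp add: e_def pte_law_def)
      then show ?thesis using ij False by (auto intro!: prod_zero)
    qed
    finally show ?thesis .
  qed
  have sq: "(\<Sum>j<h. a j * x j)\<^sup>2 = (\<Sum>i<h. \<Sum>j<h. a i * a j * (x i * x j))" for x :: "nat \<Rightarrow> real"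
    by (simp add: power2_eq_square sum_product mult_ac)
  show "integrable (iid_law D h) (\<lambda>x. (\<Sum>j<h. a j * x j)\<^sup>2)"
    unfolding sq by (intro Bochner_Integration.integrable_sum integrable_mult_right int2) auto
  have "(\<integral>x. (\<Sum>j<h. a j * x j)\<^sup>2 \<partial>iid_law D h) = (\<Sum>i<h. \<Sum>j<h. a i * a j * (\<integral>x. x i * x j \<partial>iid_law D h))"
    unfolding sq
    by (subst Bochner_Integration.integral_sum, intro Bochner_Integration.integrable_sum integrable_mult_right int2; simp?)
       (intro sum.cong refl, subst Bochner_Integration.integral_sum, auto intro!: integrable_mult_right int2)
  also have "\<dots> = (\<Sum>i<h. \<Sum>j<h. a i * a j * (if i = j then 1 else 0))"
    by (intro sum.cong refl) (simp add: cov)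
  also have "\<dots> = (\<Sum>j<h. (a j)\<^sup>2)"
    by (simp add: if_distrib sum.delta power2_eq_square cong: if_cong)
  finally show "(\<integral>x. (\<Sum>j<h. a j * x j)\<^sup>2 \<partial>iid_law D h) = (\<Sum>j<h. (a j)\<^sup>2)" .
qed

section \<open>The limit law\<close>

text \<open>
  The characteristic function of the product of two independent standard normal variables, after
  integrating out one of them.
\<close>
definition normal_product_char :: "real \<Rightarrow> real" where
  "normal_product_char t = (\<integral>z. exp (- (t * z)\<^sup>2 / 2) \<partial>std_normal_distribution)"

lemma chi_squared_density_nonneg: "chi_squared_density 1 x \<ge> 0"
  by (auto simp: chi_squared_density_def Gamma_one_half_real intro!: divide_nonneg_nonneg mult_nonneg_nonneg)

lemma chi_squared_density_measurable [measurable]: "chi_squared_density k \<in> borel_measurable borel"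
  unfolding chi_squared_density_def[abs_def] by measurable

lemma chi_squared_density_square:
  assumes "z > 0"
  shows "chi_squared_density 1 (z\<^sup>2) * (2 * z) = 2 * std_normal_density z"
proof -
  have "(z\<^sup>2) powr (1 / 2 - 1) = inverse z"
  proof -
    have "(z\<^sup>2) powr (1 / 2 - 1) = (z powr 2) powr (- (1 / 2))" using assms by (simp add: powr_numeral)
    also have "\<dots> = z powr (- 1)" unfolding powr_powr by simp
    also have "\<dots> = inverse z" using assms by (simp add: powr_minus)
    finally show ?thesis .
  qed
  moreover have "2 powr (1 / 2 :: real) = sqrt 2" by (simp add: powr_half_sqrt)
  ultimately show ?thesis
    using assms by (simp add: chi_squared_density_def std_normal_density_def Gamma_one_half_real
        real_sqrt_mult field_simps)
qed

text \<open>
  The square of a standard normal variable is chi-squared with one degree of freedom: substitute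
  \<open>x = z\<^sup>2\<close> on \<open>[0, n]\<close>, let \<open>n\<close> tend to infinity, and use the symmetry of the normal density.
\<close>
lemma nn_integral_chi_squared:
  assumes [measurable]: "A \<in> sets borel"
  shows "(\<integral>\<^sup>+x. ennreal (chi_squared_density 1 x) * indicator A x \<partial>lborel)
       = (\<integral>\<^sup>+z. ennreal (std_normal_density z) * indicator A (z\<^sup>2) \<partial>lborel)"
proof -
  define f where "f = (\<lambda>x. chi_squared_density 1 x * indicator A x)"
  have [measurable]: "f \<in> borel_measurable borel" unfolding f_def by measurable
  have f0: "f x \<ge> 0" for x by (simp add: f_def chi_squared_density_nonneg del: One_nat_def)
  have f_neg: "f x = 0" if "x \<le> 0" for x using that by (simp add: f_def chi_squared_density_def)
  define G where "G = (\<lambda>z. ennreal (f (z\<^sup>2) * (2 * z)))"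
  have [measurable]: "G \<in> borel_measurable borel" unfolding G_def by measurable
  have step: "(\<integral>\<^sup>+x. ennreal (f x) * indicator {0..(real n)\<^sup>2} x \<partial>lborel)
      = (\<integral>\<^sup>+z. G z * indicator {0..real n} z \<partial>lborel)" for n :: nat
  proof -
    have "(\<integral>\<^sup>+x. ennreal (f x * indicator {0\<^sup>2..(real n)\<^sup>2} x) \<partial>lborel)
        = (\<integral>\<^sup>+z. ennreal (f (z\<^sup>2) * (2 * z) * indicator {0..real n} z) \<partial>lborel)"
      by (rule nn_integral_substitution)
         (auto simp: set_borel_measurable_def intro!: derivative_eq_intros continuous_intros)
    moreover have "ennreal (f x * indicator {0\<^sup>2..(real n)\<^sup>2} x) = ennreal (f x) * indicator {0..(real n)\<^sup>2} x" for x
      by (simp split: split_indicator)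
    moreover have "ennreal (f (z\<^sup>2) * (2 * z) * indicator {0..real n} z) = G z * indicator {0..real n} z" for z
      by (simp add: G_def split: split_indicator)
    ultimately show ?thesis by simp
  qed
  have mono_sq: "incseq (\<lambda>n::nat. \<lambda>x. ennreal (f x) * indicator {0..(real n)\<^sup>2} x)"
    by (auto simp: incseq_def le_fun_def intro!: mult_left_mono split: split_indicator)
       (meson of_nat_0_le_iff of_nat_le_iff order_trans power_mono)
  have mono_G: "incseq (\<lambda>n::nat. \<lambda>z. G z * indicator {0..real n} z)"
    by (auto simp: incseq_def le_fun_def intro!: mult_left_mono split: split_indicator)
  have sup_f: "(SUP n::nat. ennreal (f x) * indicator {0..(real n)\<^sup>2} x) = ennreal (f x)" for x
  proof (cases "x \<le> 0")
    case False
    obtain n :: nat where n: "real n \<ge> max 1 x" using real_arch_simple by blast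
    have "x \<le> (real n)\<^sup>2"
      using n mult_mono[of 1 "real n" x "real n"] False by (simp add: power2_eq_square)
    then have "ennreal (f x) * indicator {0..(real n)\<^sup>2} x = ennreal (f x)" using False by simp
    then show ?thesis
      by (intro antisym SUP_least SUP_upper2[of n]) (auto split: split_indicator)
  qed (simp add: f_neg)
  have sup_G: "(SUP n::nat. G z * indicator {0..real n} z) = G z * indicator {0..} z" for z
  proof (cases "z < 0")
    case False
    obtain n :: nat where n: "real n \<ge> z" using real_arch_simple by blast
    then have "G z * indicator {0..real n} z = G z * indicator {0..} z" using False by simp
    then show ?thesis
      by (intro antisym SUP_least SUP_upper2[of n]) (auto split: split_indicator)
  qed simp
  have "(\<integral>\<^sup>+x. ennreal (f x) \<partial>lborel) = (SUP n::nat. \<integral>\<^sup>+x. ennreal (f x) * indicator {0..(real n)\<^sup>2} x \<partial>lborel)"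
    using nn_integral_monotone_convergence_SUP[OF mono_sq, of lborel] by (simp add: sup_f)
  also have "\<dots> = (SUP n::nat. \<integral>\<^sup>+z. G z * indicator {0..real n} z \<partial>lborel)" by (simp only: step)
  also have "\<dots> = (\<integral>\<^sup>+z. G z * indicator {0..} z \<partial>lborel)"
    using nn_integral_monotone_convergence_SUP[OF mono_G, of lborel] by (simp add: sup_G)
  finally have lhs: "(\<integral>\<^sup>+x. ennreal (f x) \<partial>lborel) = (\<integral>\<^sup>+z. G z * indicator {0..} z \<partial>lborel)" .
  define g where "g = (\<lambda>z. ennreal (std_normal_density z) * indicator A (z\<^sup>2) * indicator {0<..} z)"
  have [measurable]: "g \<in> borel_measurable borel" unfolding g_def by measurable
  have G_eq: "G z * indicator {0..} z = 2 * g z" for z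
  proof (cases "z > 0")
    case True
    have "f (z\<^sup>2) * (2 * z) = (2 * std_normal_density z) * indicator A (z\<^sup>2)"
      using chi_squared_density_square[OF True] by (simp add: f_def split: split_indicator)
    then have "G z = ennreal (2 * std_normal_density z * indicator A (z\<^sup>2))" by (simp only: G_def)
    then show ?thesis using True
      by (simp add: g_def ennreal_mult' split: split_indicator)
  qed (auto simp: G_def g_def split: split_indicator)
  have "(\<integral>\<^sup>+z. ennreal (std_normal_density z) * indicator A (z\<^sup>2) \<partial>lborel) = (\<integral>\<^sup>+z. g z + g (- z) \<partial>lborel)"
  proof (rule nn_integral_cong_AE)
    have "AE z in lborel. z \<noteq> (0::real)" by (rule AE_lborel_singleton)
    then show "AE z in lborel. ennreal (std_normal_density z) * indicator A (z\<^sup>2) = g z + g (- z)"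
      by eventually_elim (auto simp: g_def std_normal_density_def split: split_indicator)
  qed
  also have "\<dots> = (\<integral>\<^sup>+z. g z \<partial>lborel) + (\<integral>\<^sup>+z. g (- z) \<partial>lborel)"
    by (rule nn_integral_add) auto
  also have "(\<integral>\<^sup>+z. g (- z) \<partial>lborel) = (\<integral>\<^sup>+z. g z \<partial>lborel)"
    using nn_integral_real_affine[of g "-1" 0] by simp
  also have "(\<integral>\<^sup>+z. g z \<partial>lborel) + (\<integral>\<^sup>+z. g z \<partial>lborel) = (\<integral>\<^sup>+z. 2 * g z \<partial>lborel)"
    unfolding mult_2 by (rule nn_integral_add[symmetric]) auto
  also have "\<dots> = (\<integral>\<^sup>+x. ennreal (f x) \<partial>lborel)"
    unfolding lhs G_eq ..
  finally show ?thesis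
    by (simp add: f_def ennreal_mult' ennreal_indicator chi_squared_density_nonneg del: One_nat_def)
qed

lemma chi_squared_eq_distr_normal:
  "density lborel (\<lambda>x. ennreal (chi_squared_density 1 x)) = distr std_normal_distribution borel (\<lambda>z. z\<^sup>2)"
proof (rule measure_eqI)
  fix A assume "A \<in> sets (density lborel (\<lambda>x. ennreal (chi_squared_density 1 x)))"
  then have [measurable]: "A \<in> sets borel" by simp
  show "emeasure (density lborel (\<lambda>x. ennreal (chi_squared_density 1 x))) A
      = emeasure (distr std_normal_distribution borel (\<lambda>z. z\<^sup>2)) A"
  proof -
    have "emeasure (distr std_normal_distribution borel (\<lambda>z. z\<^sup>2)) A
        = emeasure std_normal_distribution ((\<lambda>z. z\<^sup>2) -` A)"
      by (subst emeasure_distr) auto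
    also have "\<dots> = (\<integral>\<^sup>+z. ennreal (std_normal_density z) * indicator ((\<lambda>z. z\<^sup>2) -` A) z \<partial>lborel)"
    proof (rule emeasure_density)
      have "(\<lambda>z::real. z\<^sup>2) \<in> borel \<rightarrow>\<^sub>M borel" by measurable
      then have "(\<lambda>z::real. z\<^sup>2) -` A \<inter> space borel \<in> sets borel" by (rule measurable_sets) simp
      then show "(\<lambda>z::real. z\<^sup>2) -` A \<in> sets lborel" by simp
    qed simp
    also have "\<dots> = (\<integral>\<^sup>+z. ennreal (std_normal_density z) * indicator A (z\<^sup>2) \<partial>lborel)"
      by (intro nn_integral_cong) (simp split: split_indicator)
    finally show ?thesis
      by (simp add: emeasure_density nn_integral_chi_squared del: One_nat_def)
  qed
qed simp

lemma neg_chi_squared_eq_distr_normal: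
  "density lborel (\<lambda>x. ennreal (neg_chi_squared_density 1 x)) = distr std_normal_distribution borel (\<lambda>z. - (z\<^sup>2))"
proof -
  have "density (distr lborel borel uminus) (\<lambda>x. ennreal (neg_chi_squared_density 1 x))
      = distr (density lborel (\<lambda>x. ennreal (neg_chi_squared_density 1 (- x)))) borel uminus"
    by (rule density_distr) (auto simp: neg_chi_squared_density_def)
  then have "density lborel (\<lambda>x. ennreal (neg_chi_squared_density 1 x))
      = distr (distr std_normal_distribution borel (\<lambda>z. z\<^sup>2)) borel uminus"
    by (simp add: lborel_distr_uminus neg_chi_squared_density_def chi_squared_eq_distr_normal del: One_nat_def)
  also have "\<dots> = distr std_normal_distribution borel (\<lambda>z. - (z\<^sup>2))"
    by (subst distr_distr) (auto simp: o_def)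
  finally show ?thesis .
qed

text \<open>
  The density of the limiting spectral distribution.
\<close>
abbreviation (input) chi_conv :: "real \<Rightarrow> ennreal" where
  "chi_conv \<equiv> density_convolution (chi_squared_density 1) (neg_chi_squared_density 1)"

lemma neg_chi_squared_density_measurable [measurable]: "neg_chi_squared_density k \<in> borel_measurable borel"
  unfolding neg_chi_squared_density_def[abs_def] by measurable

lemma chi_conv_measurable: "chi_conv \<in> borel_measurable borel"
  unfolding density_convolution_def[abs_def] by measurable

text \<open>
  The convolution in the theorem is the law of \<open>U\<^sup>2 - V\<^sup>2\<close> for independent standard normal \<open>U\<close> and \<open>V\<close>.
\<close>
lemma density_chi_conv:
  "density lborel chi_conv = distr (std_normal_distribution \<Otimes>\<^sub>M std_normal_distribution) borel (\<lambda>(u, v). u\<^sup>2 - v\<^sup>2)"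
proof -
  interpret S: prob_space std_normal_distribution by (rule pte_law_prob_space[OF pte_law_std_normal])
  interpret SS: pair_prob_space std_normal_distribution std_normal_distribution ..
  let ?f = "\<lambda>x. ennreal (chi_squared_density 1 x)" and ?g = "\<lambda>x. ennreal (neg_chi_squared_density 1 x)"
  have fin: "finite_measure (density lborel ?f)" "finite_measure (density lborel ?g)"
    unfolding chi_squared_eq_distr_normal neg_chi_squared_eq_distr_normal
    by (auto intro!: prob_space.finite_measure S.prob_space_distr)
  have "density lborel chi_conv = convolution (density lborel ?f) (density lborel ?g)"
    unfolding density_convolution_def[abs_def]
    by (rule convolution_density[OF _ _ fin, symmetric]) auto
  also have "\<dots> = distr (distr std_normal_distribution borel (\<lambda>z. z\<^sup>2) \<Otimes>\<^sub>M distr std_normal_distribution borel (\<lambda>z. - (z\<^sup>2))) borel (\<lambda>(x, y). x + y)"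
    unfolding convolution_def chi_squared_eq_distr_normal neg_chi_squared_eq_distr_normal ..
  also have "distr std_normal_distribution borel (\<lambda>z. z\<^sup>2) \<Otimes>\<^sub>M distr std_normal_distribution borel (\<lambda>z. - (z\<^sup>2))
      = distr (std_normal_distribution \<Otimes>\<^sub>M std_normal_distribution) (borel \<Otimes>\<^sub>M borel) (\<lambda>(u, v). (u\<^sup>2, - (v\<^sup>2)))"
    by (rule pair_measure_distr) (auto intro!: prob_space_imp_sigma_finite S.prob_space_distr)
  also have "distr \<dots> borel (\<lambda>(x, y). x + y) = distr (std_normal_distribution \<Otimes>\<^sub>M std_normal_distribution) borel (\<lambda>(u, v). u\<^sup>2 - v\<^sup>2)"
    by (subst distr_distr) (auto simp: o_def split_beta')
  finally show ?thesis .
qed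

lemma real_distribution_chi_conv: "real_distribution (density lborel chi_conv)"
proof -
  interpret S: prob_space std_normal_distribution by (rule pte_law_prob_space[OF pte_law_std_normal])
  interpret SS: pair_prob_space std_normal_distribution std_normal_distribution ..
  show ?thesis
    unfolding density_chi_conv
    by (rule SS.P.real_distribution_distr) (simp add: split_beta')
qed

lemma char_chi_conv_prod:
  "char (density lborel chi_conv) t
    = (CLINT u|std_normal_distribution. iexp (t * u\<^sup>2)) * (CLINT v|std_normal_distribution. iexp (- t * v\<^sup>2))"
proof -
  let ?S = std_normal_distribution
  interpret S: prob_space ?S by (rule pte_law_prob_space[OF pte_law_std_normal])
  interpret SS: pair_prob_space ?S ?S ..
  have "char (density lborel chi_conv) t = (CLINT p|?S \<Otimes>\<^sub>M ?S. iexp (t * ((fst p)\<^sup>2 - (snd p)\<^sup>2)))"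
    unfolding density_chi_conv char_def by (subst integral_distr) (auto simp: split_beta' simp del: of_real_mult of_real_diff)
  also have "\<dots> = (CLINT u|?S. CLINT v|?S. iexp (t * (u\<^sup>2 - v\<^sup>2)))"
    by (subst SS.integral_fst'[symmetric])
       (auto intro!: SS.P.integrable_const_bound[where B = 1] simp: split_beta' simp del: of_real_mult of_real_diff)
  also have "\<dots> = (CLINT u|?S. CLINT v|?S. iexp (t * u\<^sup>2) * iexp (- t * v\<^sup>2))"
    by (simp add: exp_add[symmetric] algebra_simps)
  also have "\<dots> = (CLINT u|?S. iexp (t * u\<^sup>2)) * (CLINT v|?S. iexp (- t * v\<^sup>2))"
    by (simp only: integral_mult_right_zero integral_mult_left_zero)
  finally show ?thesis .
qed

text \<open>
  The variables \<open>U\<^sup>2 - V\<^sup>2\<close> and \<open>2 Z W\<close> have the same law. The rotation of the plane is carried out as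
  a sequence of one-dimensional affine substitutions: \<open>u = v + s\<close>, then
  \<open>v = w / sqrt 2 - s / 2\<close>, and finally \<open>s = sqrt 2 * z\<close>. The integral over \<open>w\<close> is a
  characteristic function of the normal law.
\<close>
lemma char_square_shear:
  "(CLINT u|std_normal_distribution. iexp (t * u\<^sup>2)) * (CLINT v|std_normal_distribution. iexp (- t * v\<^sup>2))
     = normal_product_char (2 * t)"
proof -
  let ?S = std_normal_distribution and ?n = std_normal_density
  interpret S: prob_space ?S by (rule pte_law_prob_space[OF pte_law_std_normal])
  have n0: "?n x \<ge> 0" for x by (simp add: normal_density_nonneg)
  have dens: "(CLINT x|?S. F x) = (CLINT x|lborel. ?n x *\<^sub>R F x)" if [measurable]: "F \<in> borel_measurable borel" for F :: "real \<Rightarrow> complex"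
    by (rule integral_density) (auto simp: n0)
  \<comment> \<open>The integrand after the substitution \<open>u = v + s\<close>.\<close>
  define f where "f = (\<lambda>v s. (?n (v + s) * ?n v) *\<^sub>R iexp (t * (s * (s + 2 * v))))"
  have f_meas: "case_prod f \<in> borel_measurable (lborel \<Otimes>\<^sub>M lborel)"
    unfolding f_def split_beta' by measurable
  have n_int: "integrable lborel ?n" "(\<integral>x. ?n x \<partial>lborel) = 1"
    by (auto intro: integrable_normal_density integral_normal_density)
  have shift: "integrable lborel (\<lambda>s. ?n (v + s))" "(\<integral>s. ?n (v + s) \<partial>lborel) = 1" for v
    using lborel_integrable_real_affine[OF n_int(1), of 1 v] lborel_integral_real_affine[of 1 ?n v] n_int by simp_all
  have f_norm: "norm (f v s) = ?n (v + s) * ?n v" for v s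
    by (simp add: f_def n0 abs_mult)
  have f_int: "integrable (lborel \<Otimes>\<^sub>M lborel) (case_prod f)"
  proof (rule lborel_pair.Fubini_integrable[OF f_meas])
    have "(\<lambda>v. \<integral>s. norm (f v s) \<partial>lborel) = ?n" unfolding f_norm by (simp add: shift)
    then show "integrable lborel (\<lambda>v. \<integral>s. norm (case_prod f (v, s)) \<partial>lborel)" using n_int by simp
    have "integrable lborel (f v)" for v
    proof (rule Bochner_Integration.integrable_bound)
      show "integrable lborel (\<lambda>s. ?n (v + s) * ?n v)" by (intro integrable_mult_left shift)
      show "f v \<in> borel_measurable lborel" unfolding f_def by measurable
      show "AE s in lborel. norm (f v s) \<le> norm (?n (v + s) * ?n v)" by (simp add: f_norm)
    qed
    then show "AE v in lborel. integrable lborel (\<lambda>s. case_prod f (v, s))" by simp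
  qed
  define C where "C = (CLINT u|?S. iexp (t * u\<^sup>2))"
  have "C * (CLINT v|?S. iexp (- t * v\<^sup>2)) = (CLINT v|?S. C * iexp (- t * v\<^sup>2))"
    by (simp only: integral_mult_right_zero)
  also have "\<dots> = (CLINT v|lborel. ?n v *\<^sub>R (C * iexp (- t * v\<^sup>2)))"
    by (rule dens) measurable
  also have "\<dots> = (CLINT v|lborel. CLINT s|lborel. f v s)"
  proof (intro Bochner_Integration.integral_cong refl)
    fix v :: real
    have "C = (CLINT u|lborel. ?n u *\<^sub>R iexp (t * u\<^sup>2))" unfolding C_def by (rule dens) measurable
    also have "\<dots> = (CLINT s|lborel. ?n (v + s) *\<^sub>R iexp (t * (v + s)\<^sup>2))"
      using lborel_integral_real_affine[of 1 "\<lambda>u. ?n u *\<^sub>R iexp (t * u\<^sup>2)" v] by simp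
    finally have "?n v *\<^sub>R (C * iexp (- t * v\<^sup>2)) = (CLINT s|lborel. (?n v *\<^sub>R iexp (- t * v\<^sup>2)) * (?n (v + s) *\<^sub>R iexp (t * (v + s)\<^sup>2)))"
      by (simp only: integral_mult_right_zero) (simp add: mult_ac)
    also have "\<dots> = (CLINT s|lborel. f v s)"
    proof (intro Bochner_Integration.integral_cong refl)
      fix s :: real
      have "iexp (- t * v\<^sup>2) * iexp (t * (v + s)\<^sup>2) = iexp (t * (s * (s + 2 * v)))"
        unfolding exp_add[symmetric]
        by (rule arg_cong[where f = exp]) (simp add: power2_eq_square algebra_simps)
      then show "(?n v *\<^sub>R iexp (- t * v\<^sup>2)) * (?n (v + s) *\<^sub>R iexp (t * (v + s)\<^sup>2)) = f v s"
        by (simp add: f_def mult.commute[of "?n v"])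
    qed
    finally show "?n v *\<^sub>R (C * iexp (- t * v\<^sup>2)) = (CLINT s|lborel. f v s)" .
  qed
  also have "\<dots> = (CLINT s|lborel. CLINT v|lborel. f v s)"
    by (rule lborel_pair.Fubini_integral[OF f_int, symmetric])
  also have "\<dots> = (CLINT s|lborel. complex_of_real (exp (- s\<^sup>2 / 4) / sqrt (2 * pi) / sqrt 2 * exp (- (t * s)\<^sup>2)))"
  proof (intro Bochner_Integration.integral_cong refl)
    fix s :: real
    have "(CLINT v|lborel. f v s) = (1 / sqrt 2) *\<^sub>R (CLINT w|lborel. f (- s / 2 + 1 / sqrt 2 * w) s)"
      using lborel_integral_real_affine[of "1 / sqrt 2" "\<lambda>v. f v s" "- s / 2"] by simp
    also have "(\<lambda>w. f (- s / 2 + 1 / sqrt 2 * w) s) = (\<lambda>w. complex_of_real (exp (- s\<^sup>2 / 4) / sqrt (2 * pi)) * (?n w *\<^sub>R iexp ((sqrt 2 * t * s) * w)))"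
    proof
      fix w :: real
      define y where "y = w / sqrt 2"
      have y2: "2 * y\<^sup>2 = w\<^sup>2" by (simp add: y_def power_divide)
      have y1: "2 * y = sqrt 2 * w" by (simp add: y_def real_div_sqrt field_simps)
      have "?n (y - s / 2 + s) * ?n (y - s / 2) = 1 / (2 * pi) * exp (- (y + s / 2)\<^sup>2 / 2 + - (y - s / 2)\<^sup>2 / 2)"
      proof -
        have "y - s / 2 + s = y + s / 2" by simp
        then show ?thesis by (simp only: std_normal_density_def exp_add) simp
      qed
      also have "- (y + s / 2)\<^sup>2 / 2 + - (y - s / 2)\<^sup>2 / 2 = - s\<^sup>2 / 4 + - w\<^sup>2 / 2"
      proof -
        have "(y + s / 2)\<^sup>2 + (y - s / 2)\<^sup>2 = 2 * y\<^sup>2 + s\<^sup>2 / 2"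
          by (simp add: power2_sum power2_diff power_divide)
        then show ?thesis using y2 by simp
      qed
      also have "1 / (2 * pi) * exp (- s\<^sup>2 / 4 + - w\<^sup>2 / 2) = exp (- s\<^sup>2 / 4) / sqrt (2 * pi) * ?n w"
        unfolding exp_add by (simp add: std_normal_density_def)
      finally have 1: "?n (y - s / 2 + s) * ?n (y - s / 2) = exp (- s\<^sup>2 / 4) / sqrt (2 * pi) * ?n w" .
      have 2: "t * (s * (s + 2 * (y - s / 2))) = (sqrt 2 * t * s) * w"
        using y1 by (simp add: right_diff_distrib mult_ac)
      have 3: "- s / 2 + 1 / sqrt 2 * w = y - s / 2" by (simp add: y_def)
      show "f (- s / 2 + 1 / sqrt 2 * w) s = complex_of_real (exp (- s\<^sup>2 / 4) / sqrt (2 * pi)) * (?n w *\<^sub>R iexp ((sqrt 2 * t * s) * w))"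
        unfolding 3 f_def 1 2 by (simp add: scaleR_conv_of_real mult.assoc)
    qed
    also have "(CLINT w|lborel. complex_of_real (exp (- s\<^sup>2 / 4) / sqrt (2 * pi)) * (?n w *\<^sub>R iexp ((sqrt 2 * t * s) * w)))
        = complex_of_real (exp (- s\<^sup>2 / 4) / sqrt (2 * pi)) * (CLINT w|lborel. ?n w *\<^sub>R iexp ((sqrt 2 * t * s) * w))"
      by (rule integral_mult_right_zero)
    also have "(CLINT w|lborel. ?n w *\<^sub>R iexp ((sqrt 2 * t * s) * w)) = char ?S (sqrt 2 * t * s)"
      unfolding char_def by (rule dens[symmetric]) measurable
    also have "\<dots> = complex_of_real (exp (- (t * s)\<^sup>2))"
      unfolding char_std_normal_distribution by (simp add: power_mult_distrib)
    finally show "(CLINT v|lborel. f v s) = complex_of_real (exp (- s\<^sup>2 / 4) / sqrt (2 * pi) / sqrt 2 * exp (- (t * s)\<^sup>2))"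
      by (simp add: scaleR_conv_of_real)
  qed
  also have "\<dots> = complex_of_real (\<integral>s. exp (- s\<^sup>2 / 4) / sqrt (2 * pi) / sqrt 2 * exp (- (t * s)\<^sup>2) \<partial>lborel)"
    by (rule integral_complex_of_real)
  also have "(\<integral>s. exp (- s\<^sup>2 / 4) / sqrt (2 * pi) / sqrt 2 * exp (- (t * s)\<^sup>2) \<partial>lborel)
      = sqrt 2 * (\<integral>z. exp (- (sqrt 2 * z)\<^sup>2 / 4) / sqrt (2 * pi) / sqrt 2 * exp (- (t * (sqrt 2 * z))\<^sup>2) \<partial>lborel)"
    using lborel_integral_real_affine[of "sqrt 2" "\<lambda>s. exp (- s\<^sup>2 / 4) / sqrt (2 * pi) / sqrt 2 * exp (- (t * s)\<^sup>2)" 0] by simp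
  also have "\<dots> = (\<integral>z. sqrt 2 * (exp (- (sqrt 2 * z)\<^sup>2 / 4) / sqrt (2 * pi) / sqrt 2 * exp (- (t * (sqrt 2 * z))\<^sup>2)) \<partial>lborel)"
    by (simp only: integral_mult_right_zero)
  also have "\<dots> = (\<integral>z. ?n z *\<^sub>R exp (- (2 * t * z)\<^sup>2 / 2) \<partial>lborel)"
    by (intro Bochner_Integration.integral_cong refl)
       (simp add: std_normal_density_def power_mult_distrib)
  also have "\<dots> = normal_product_char (2 * t)"
    unfolding normal_product_char_def by (rule integral_density[symmetric]) (auto simp: n0)
  finally show ?thesis by (simp add: C_def)
qed

lemma char_chi_conv: "char (density lborel chi_conv) t = normal_product_char (2 * t)"
  unfolding char_chi_conv_prod char_square_shear ..

section \<open>Asymptotic normality of the circulant eigenvalues\<close>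

text \<open>
  The eigenvalue in the normalisation in which its variance tends to 1, for every frequency \<open>k \<noteq> 0\<close>.
\<close>
definition scaled_eigenvalue :: "nat \<Rightarrow> nat \<Rightarrow> (nat \<Rightarrow> real) \<Rightarrow> real" where
  "scaled_eigenvalue h k x = circ_eigenvalue h k x / sqrt (2 * h)"

lemma scaled_eigenvalue_linear: "scaled_eigenvalue h k x = (\<Sum>j<h. circ_coeff h k j / sqrt (2 * h) * x j)"
  by (simp add: scaled_eigenvalue_def circ_eigenvalue_def sum_divide_distrib)

lemma scaled_eigenvalue_measurable:
  assumes "pte_law D"
  shows "scaled_eigenvalue h k \<in> borel_measurable (iid_law D h)"
  unfolding scaled_eigenvalue_linear[abs_def] by (rule iid_law_linear_measurable[OF assms])

text \<open>
  Pairs of frequencies with asymptotically independent eigenvalues. The frequencies \<open>k\<close> and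
  \<open>2 * h - 1 - k\<close> share their eigenvalue, and frequency 0 has a larger variance.
\<close>
definition generic_pair :: "nat \<Rightarrow> nat \<Rightarrow> nat \<Rightarrow> bool" where
  "generic_pair h k l \<longleftrightarrow> k < 2 * h - 1 \<and> l < 2 * h - 1 \<and> k \<noteq> 0 \<and> l \<noteq> 0 \<and> k \<noteq> l \<and> k + l \<noteq> 2 * h - 1"

lemma generic_pair_coeff_sums:
  assumes g: "generic_pair h k l"
  shows "(\<Sum>j<h. (circ_coeff h k j)\<^sup>2) = 2 * real h - 2" "(\<Sum>j<h. (circ_coeff h l j)\<^sup>2) = 2 * real h - 2"
    "(\<Sum>j<h. circ_coeff h k j * circ_coeff h l j) = - 1"
proof -
  have h: "h > 0" using g by (auto simp: generic_pair_def)
  have self: "(\<Sum>j<h. (circ_coeff h p j)\<^sup>2) = 2 * real h - 2" if p: "p \<noteq> 0" "p < 2 * h - 1" for p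
  proof -
    \<comment> \<open>The order \<open>2 * h - 1\<close> is odd, so that it does not divide \<open>2 * p\<close>.\<close>
    have "\<not> int (2 * h - 1) dvd int p + int p"
    proof
      assume "int (2 * h - 1) dvd int p + int p"
      then have "2 * h - 1 dvd 2 * p" by (metis int_dvd_int_iff mult_2 of_nat_add)
      moreover have "coprime (2 * h - 1) 2" using h by (simp add: coprime_right_2_iff_odd)
      ultimately have "2 * h - 1 dvd p" using coprime_dvd_mult_right_iff by blast
      then show False using p by (meson dvd_imp_le not_le zero_less_iff_neq_zero)
    qed
    from sum_circ_coeff_prod[OF h this] show ?thesis
      using h by (simp add: power2_eq_square of_nat_diff)
  qed
  show "(\<Sum>j<h. (circ_coeff h k j)\<^sup>2) = 2 * real h - 2" "(\<Sum>j<h. (circ_coeff h l j)\<^sup>2) = 2 * real h - 2"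
    using g by (auto intro: self simp: generic_pair_def)
  have 1: "\<not> int (2 * h - 1) dvd int k + int l"
  proof
    assume "int (2 * h - 1) dvd int k + int l"
    then have "2 * h - 1 dvd k + l" by (metis int_dvd_int_iff of_nat_add)
    then obtain q where q: "k + l = (2 * h - 1) * q" by (auto elim: dvdE)
    have "q < 2"
    proof (rule ccontr)
      assume "\<not> q < 2"
      then have "(2 * h - 1) * 2 \<le> (2 * h - 1) * q" by (intro mult_le_mono) auto
      then have "(2 * h - 1) * 2 \<le> k + l" using q by simp
      then show False using g unfolding generic_pair_def by linarith
    qed
    then have "q = 0 \<or> q = 1" by auto
    then show False using q g by (auto simp: generic_pair_def)
  qed
  have 2: "\<not> int (2 * h - 1) dvd int k - int l"
  proof
    assume "int (2 * h - 1) dvd int k - int l"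
    then have "int (2 * h - 1) dvd \<bar>int k - int l\<bar>" by simp
    moreover have "\<bar>int k - int l\<bar> > 0" "\<bar>int k - int l\<bar> < int (2 * h - 1)" using g by (auto simp: generic_pair_def)
    ultimately show False using zdvd_imp_le by fastforce
  qed
  show "(\<Sum>j<h. circ_coeff h k j * circ_coeff h l j) = - 1"
    using sum_circ_coeff_prod[OF h 1] 2 by simp
qed

text \<open>
  The rate in the normal approximation of a pair of eigenvalues.
\<close>
definition clt_error :: "real measure \<Rightarrow> nat \<Rightarrow> real" where
  "clt_error D h = 2 * (4 * third_moment_const D * sqrt (sqrt (2 * h)) / sqrt (2 * h)
      + 2 / sqrt (2 * h) + 3 / (2 * (2 * h)))"

lemma clt_error_nonneg: "clt_error D h \<ge> 0"
  unfolding clt_error_def using third_moment_const_nonneg[of D] by simp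

lemma clt_error_tendsto: "clt_error D \<longlonglongrightarrow> 0"
  unfolding clt_error_def by real_asymp

lemma cmod_expectation_iexp_le_1:
  assumes "prob_space Q"
  shows "cmod (CLINT x|Q. iexp (f x)) \<le> 1"
proof -
  interpret prob_space Q by fact
  have "cmod (CLINT x|Q. iexp (f x)) \<le> (\<integral>x. cmod (iexp (f x)) \<partial>Q)" by (rule integral_norm_bound)
  then show ?thesis by (simp add: prob_space)
qed

lemma abs_exp_minus_diff_le:
  fixes s t :: real
  assumes "s \<ge> 0" "t \<ge> 0"
  shows "\<bar>exp (- s) - exp (- t)\<bar> \<le> \<bar>s - t\<bar>"
proof -
  have *: "exp (- s) - exp (- t) \<le> t - s" if "0 \<le> s" "s \<le> t" for s t :: real
  proof -
    have "exp (- s) - exp (- t) = exp (- s) * (1 - exp (s - t))"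
      by (simp add: right_diff_distrib exp_add[symmetric])
    also have "\<dots> \<le> 1 * (t - s)"
    proof (intro mult_mono)
      show "1 - exp (s - t) \<le> t - s" using exp_ge_add_one_self[of "s - t"] by linarith
    qed (use that in auto)
    finally show ?thesis by simp
  qed
  show ?thesis
    using *[of s t] *[of t s] assms by (cases "s \<le> t") auto
qed

text \<open>
  The error is a multiple of \<open>u\<^sup>2 + v\<^sup>2\<close>, although third moments enter: this allows an
  average over random \<open>u\<close> and \<open>v\<close> of which only second moments are controlled.
\<close>
lemma char_scaled_eigenvalue_pair:
  assumes D: "pte_law D" and g: "generic_pair h k l"
  shows "cmod ((CLINT x|iid_law D h. iexp (u * scaled_eigenvalue h k x + v * scaled_eigenvalue h l x)) - exp (- (u\<^sup>2 + v\<^sup>2) / 2))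
          \<le> clt_error D h * (u\<^sup>2 + v\<^sup>2)"
proof -
  have h: "h > 0" using g by (auto simp: generic_pair_def)
  define N where "N = 2 * real h"
  have N: "N > 0" using h by (simp add: N_def)
  define K where "K = third_moment_const D"
  have K: "K \<ge> 0" by (simp add: K_def third_moment_const_nonneg)
  define a where "a = (\<lambda>j. (u * circ_coeff h k j + v * circ_coeff h l j) / sqrt N)"
  define q where "q = \<bar>u\<bar> + \<bar>v\<bar>"
  have q0: "q \<ge> 0" by (simp add: q_def)
  have q2: "q\<^sup>2 \<le> 2 * (u\<^sup>2 + v\<^sup>2)" "u\<^sup>2 + v\<^sup>2 \<le> q\<^sup>2"
    using sum_squares_bound[of "\<bar>u\<bar>" "\<bar>v\<bar>"] by (auto simp: q_def power2_sum)
  define I where "I = (CLINT x|iid_law D h. iexp (u * scaled_eigenvalue h k x + v * scaled_eigenvalue h l x))"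
  have lin: "u * scaled_eigenvalue h k x + v * scaled_eigenvalue h l x = (\<Sum>j<h. a j * x j)" for x
    unfolding scaled_eigenvalue_linear sum_distrib_left sum.distrib[symmetric]
    by (intro sum.cong refl) (simp add: a_def N_def add_divide_distrib distrib_right)
  have coeff: "\<bar>circ_coeff h p j\<bar> \<le> 2" for p j
    using abs_cos_le_one by (auto simp: circ_coeff_def abs_mult)
  have aj: "\<bar>a j\<bar> \<le> 2 * q / sqrt N" for j
  proof -
    have "\<bar>u * circ_coeff h k j + v * circ_coeff h l j\<bar> \<le> \<bar>u\<bar> * \<bar>circ_coeff h k j\<bar> + \<bar>v\<bar> * \<bar>circ_coeff h l j\<bar>"
      by (metis abs_mult abs_triangle_ineq)
    also have "\<dots> \<le> \<bar>u\<bar> * 2 + \<bar>v\<bar> * 2"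
      by (intro add_mono mult_left_mono coeff) auto
    finally show ?thesis using N by (simp add: a_def q_def divide_right_mono)
  qed
  have "(\<Sum>j<h. \<bar>a j\<bar>^3) \<le> (\<Sum>j<h. (2 * q / sqrt N)^3)"
    by (intro sum_mono power_mono aj) auto
  also have "\<dots> = h * (2 * q / sqrt N)^3" by simp
  also have "\<dots> = 4 * q^3 / sqrt N"
  proof -
    have "sqrt N ^ 3 = N * sqrt N" using N by (simp add: power3_eq_cube)
    then show ?thesis using N by (simp add: power_mult_distrib power_divide N_def)
  qed
  finally have cube: "(\<Sum>j<h. \<bar>a j\<bar>^3) \<le> 4 * q^3 / sqrt N" .
  have "(\<Sum>j<h. (a j)\<^sup>2) = (\<Sum>j<h. (u\<^sup>2 * (circ_coeff h k j)\<^sup>2 + v\<^sup>2 * (circ_coeff h l j)\<^sup>2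
       + 2 * u * v * (circ_coeff h k j * circ_coeff h l j)) / N)"
    using N by (intro sum.cong refl) (simp add: a_def power_divide power2_sum power_mult_distrib algebra_simps)
  also have "\<dots> = (u\<^sup>2 * (\<Sum>j<h. (circ_coeff h k j)\<^sup>2) + v\<^sup>2 * (\<Sum>j<h. (circ_coeff h l j)\<^sup>2)
       + 2 * u * v * (\<Sum>j<h. circ_coeff h k j * circ_coeff h l j)) / N"
    by (simp only: sum_divide_distrib[symmetric] sum.distrib sum_distrib_left)
  also have "\<dots> = (u\<^sup>2 + v\<^sup>2) - 2 * (u\<^sup>2 + v\<^sup>2 + u * v) / N"
    unfolding generic_pair_coeff_sums[OF g] using N by (simp add: N_def field_simps)
  finally have sq: "(\<Sum>j<h. (a j)\<^sup>2) = (u\<^sup>2 + v\<^sup>2) - 2 * (u\<^sup>2 + v\<^sup>2 + u * v) / N" .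
  have "\<bar>exp (- ((\<Sum>j<h. (a j)\<^sup>2) / 2)) - exp (- ((u\<^sup>2 + v\<^sup>2) / 2))\<bar> \<le> \<bar>(\<Sum>j<h. (a j)\<^sup>2) / 2 - (u\<^sup>2 + v\<^sup>2) / 2\<bar>"
    by (intro abs_exp_minus_diff_le) (auto intro: sum_nonneg)
  also have "\<dots> = \<bar>u\<^sup>2 + v\<^sup>2 + u * v\<bar> / N"
  proof -
    have "(\<Sum>j<h. (a j)\<^sup>2) / 2 - (u\<^sup>2 + v\<^sup>2) / 2 = - ((u\<^sup>2 + v\<^sup>2 + u * v) / N)"
      unfolding sq using N by (simp add: field_simps)
    then show ?thesis using N by (simp only: abs_minus_cancel abs_divide abs_of_pos)
  qed
  also have "\<dots> \<le> 3 / 2 * q\<^sup>2 / N"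
  proof -
    have "\<bar>u * v\<bar> \<le> (u\<^sup>2 + v\<^sup>2) / 2"
      using sum_squares_bound[of "\<bar>u\<bar>" "\<bar>v\<bar>"] by (simp add: abs_mult)
    then have "\<bar>u\<^sup>2 + v\<^sup>2 + u * v\<bar> \<le> 3 / 2 * q\<^sup>2"
      using q2 by (simp add: abs_le_iff)
    from divide_right_mono[OF this, of N] N show ?thesis by simp
  qed
  finally have e2: "\<bar>exp (- ((\<Sum>j<h. (a j)\<^sup>2) / 2)) - exp (- ((u\<^sup>2 + v\<^sup>2) / 2))\<bar> \<le> 3 / 2 * q\<^sup>2 / N" .
  have "cmod (I - exp (- (\<Sum>j<h. (a j)\<^sup>2) / 2)) \<le> K * (\<Sum>j<h. \<bar>a j\<bar>^3)"
    unfolding I_def lin K_def by (rule char_iid_linear_normal[OF D])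
  also have "\<dots> \<le> K * (4 * q^3 / sqrt N)" by (intro mult_left_mono cube K)
  finally have e1: "cmod (I - exp (- (\<Sum>j<h. (a j)\<^sup>2) / 2)) \<le> K * (4 * q^3 / sqrt N)" .
  have "cmod (complex_of_real (exp (- (\<Sum>j<h. (a j)\<^sup>2) / 2)) - complex_of_real (exp (- (u\<^sup>2 + v\<^sup>2) / 2))) \<le> 3 / 2 * q\<^sup>2 / N"
    unfolding of_real_diff[symmetric] norm_of_real minus_divide_left[symmetric] by (rule e2)
  then have e: "cmod (I - exp (- (u\<^sup>2 + v\<^sup>2) / 2)) \<le> K * (4 * q^3 / sqrt N) + 3 / 2 * q\<^sup>2 / N"
    using e1 norm_triangle_ineq[of "I - complex_of_real (exp (- (\<Sum>j<h. (a j)\<^sup>2) / 2))"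
        "complex_of_real (exp (- (\<Sum>j<h. (a j)\<^sup>2) / 2)) - complex_of_real (exp (- (u\<^sup>2 + v\<^sup>2) / 2))"] by simp
  \<comment> \<open>For small \<open>q\<close> the third moment bound applies; for large \<open>q\<close> the trivial bound 2 is at most \<open>2 * q\<^sup>2 / R\<^sup>2\<close>. The choice of \<open>R\<close> makes both coefficients tend to 0.\<close>
  define R where "R = sqrt (sqrt N)"
  have R: "R > 0" "R\<^sup>2 = sqrt N" using N by (auto simp: R_def)
  have "cmod (I - exp (- (u\<^sup>2 + v\<^sup>2) / 2)) \<le> (4 * K * R / sqrt N + 2 / sqrt N + 3 / (2 * N)) * q\<^sup>2"
  proof (cases "q \<le> R")
    case True
    have "q^3 \<le> R * q\<^sup>2" using mult_right_mono[OF True, of "q\<^sup>2"] by (simp add: power3_eq_cube power2_eq_square mult.assoc)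
    then have "K * (4 * q^3 / sqrt N) \<le> K * (4 * (R * q\<^sup>2) / sqrt N)"
      using K N by (intro mult_left_mono divide_right_mono) auto
    moreover have "0 \<le> 2 / sqrt N * q\<^sup>2" using N by simp
    ultimately show ?thesis using e by (simp add: algebra_simps)
  next
    case False
    then have "R\<^sup>2 \<le> q\<^sup>2" using R by (intro power_mono) auto
    then have "2 \<le> 2 / sqrt N * q\<^sup>2" using R N by (simp add: field_simps)
    moreover have "cmod I \<le> 1"
      unfolding I_def by (rule cmod_expectation_iexp_le_1[OF prob_space_iid_law[OF D]])
    moreover have "cmod (complex_of_real (exp (- (u\<^sup>2 + v\<^sup>2) / 2))) \<le> 1"
      unfolding norm_of_real by (simp add: add_nonneg_nonneg)
    moreover have "cmod (I - exp (- (u\<^sup>2 + v\<^sup>2) / 2)) \<le> cmod I + cmod (complex_of_real (exp (- (u\<^sup>2 + v\<^sup>2) / 2)))"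
      by (rule norm_triangle_ineq4)
    moreover have "0 \<le> 4 * K * R / sqrt N * q\<^sup>2" "0 \<le> 3 / (2 * N) * q\<^sup>2" using K R N by auto
    ultimately show ?thesis unfolding distrib_right by linarith
  qed
  also have "\<dots> \<le> (4 * K * R / sqrt N + 2 / sqrt N + 3 / (2 * N)) * (2 * (u\<^sup>2 + v\<^sup>2))"
    using K R N q2 by (intro mult_left_mono) auto
  also have "\<dots> = clt_error D h * (u\<^sup>2 + v\<^sup>2)"
  proof -
    have "clt_error D h = 2 * (4 * K * R / sqrt N + 2 / sqrt N + 3 / (2 * N))"
      by (simp add: clt_error_def K_def R_def N_def)
    then show ?thesis by (simp only: mult_ac)
  qed
  finally show ?thesis by (simp add: I_def)
qed

lemma cmod_expectation_diff_le:
  assumes "prob_space Q"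
    and [measurable]: "F \<in> borel_measurable Q" "G \<in> borel_measurable Q"
    and F1: "\<And>y. cmod (F y) \<le> 1" and G1: "\<And>y. cmod (G y) \<le> 1"
    and le: "\<And>y. cmod (F y - G y) \<le> g y" and g: "integrable Q g"
  shows "cmod ((CLINT y|Q. F y) - (CLINT y|Q. G y)) \<le> (\<integral>y. g y \<partial>Q)"
proof -
  interpret prob_space Q by fact
  have int: "integrable Q F" "integrable Q G"
    using F1 G1 by (auto intro!: integrable_const_bound[where B = 1])
  have "cmod ((CLINT y|Q. F y) - (CLINT y|Q. G y)) = cmod (CLINT y|Q. F y - G y)"
    by (simp add: int)
  also have "\<dots> \<le> (\<integral>y. cmod (F y - G y) \<partial>Q)" by (rule integral_norm_bound)
  also have "\<dots> \<le> (\<integral>y. g y \<partial>Q)" using int g le by (intro integral_mono) auto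
  finally show ?thesis .
qed

text \<open>
  Two independent standard normal variables.
\<close>
abbreviation gauss2 :: "(nat \<Rightarrow> real) measure" where
  "gauss2 \<equiv> iid_law std_normal_distribution 2"

lemma gauss2_char: "(CLINT z|gauss2. iexp (a * z 0 + b * z 1)) = exp (- (a\<^sup>2 + b\<^sup>2) / 2)"
proof -
  have "a * z 0 + b * z 1 = (\<Sum>j<2. (if j = 0 then a else b) * z j)" for z :: "nat \<Rightarrow> real"
    by (simp add: numeral_2_eq_2)
  then have "(CLINT z|gauss2. iexp (a * z 0 + b * z 1)) = (\<Prod>j<2::nat. char std_normal_distribution (if j = 0 then a else b))"
    using char_iid_linear[OF pte_law_std_normal, where h = 2 and a = "\<lambda>j. if j = 0 then a else b"] by simp
  also have "\<dots> = exp (- a\<^sup>2 / 2) * exp (- b\<^sup>2 / 2)"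
    by (simp add: numeral_2_eq_2 char_std_normal_distribution)
  also have "\<dots> = exp (- (a\<^sup>2 + b\<^sup>2) / 2)"
    by (simp add: exp_add[symmetric] diff_divide_distrib flip: of_real_mult)
  finally show ?thesis .
qed

lemma gauss2_normal_product_char:
  "(CLINT z|gauss2. exp (- ((a * z 0)\<^sup>2 + (b * z 1)\<^sup>2) / 2)) = normal_product_char a * normal_product_char b"
proof -
  interpret S: prob_space std_normal_distribution by (rule pte_law_prob_space[OF pte_law_std_normal])
  interpret product_sigma_finite "\<lambda>_::nat. std_normal_distribution" by standard
  define c where "c = (\<lambda>j::nat. if j = 0 then a else b)"
  have "complex_of_real (exp (- ((a * z 0)\<^sup>2 + (b * z 1)\<^sup>2) / 2))
      = (\<Prod>j<2. complex_of_real (exp (- (c j * z j)\<^sup>2 / 2)))" for z :: "nat \<Rightarrow> real"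
    by (simp add: numeral_2_eq_2 c_def exp_add[symmetric] diff_divide_distrib flip: of_real_mult)
  then have "(CLINT z|gauss2. exp (- ((a * z 0)\<^sup>2 + (b * z 1)\<^sup>2) / 2))
      = (CLINT z|gauss2. (\<Prod>j<2. complex_of_real (exp (- (c j * z j)\<^sup>2 / 2))))" by simp
  also have "\<dots> = (\<Prod>j<2. CLINT z|std_normal_distribution. complex_of_real (exp (- (c j * z)\<^sup>2 / 2)))"
    unfolding iid_law_def
    by (rule product_integral_prod) (auto intro!: S.integrable_const_bound[where B = 1])
  also have "\<dots> = normal_product_char a * normal_product_char b"
    by (simp add: numeral_2_eq_2 c_def normal_product_char_def)
  finally show ?thesis .
qed

lemma scaled_eigenvalue_second_moment:
  assumes D: "pte_law D" and g: "generic_pair h k l"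
  shows "integrable (iid_law D h) (\<lambda>x. (scaled_eigenvalue h k x)\<^sup>2)" "(\<integral>x. (scaled_eigenvalue h k x)\<^sup>2 \<partial>iid_law D h) \<le> 1"
    "integrable (iid_law D h) (\<lambda>x. (scaled_eigenvalue h l x)\<^sup>2)" "(\<integral>x. (scaled_eigenvalue h l x)\<^sup>2 \<partial>iid_law D h) \<le> 1"
proof -
  have h: "real h > 0" using g by (auto simp: generic_pair_def)
  show "integrable (iid_law D h) (\<lambda>x. (scaled_eigenvalue h k x)\<^sup>2)" "integrable (iid_law D h) (\<lambda>x. (scaled_eigenvalue h l x)\<^sup>2)"
    unfolding scaled_eigenvalue_linear by (rule iid_law_linear_second_moment[OF D])+
  have *: "(\<Sum>j<h. (circ_coeff h p j / sqrt (2 * h))\<^sup>2) \<le> 1" if "(\<Sum>j<h. (circ_coeff h p j)\<^sup>2) = 2 * real h - 2" for p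
  proof -
    have "(\<Sum>j<h. (circ_coeff h p j / sqrt (2 * h))\<^sup>2) = (\<Sum>j<h. (circ_coeff h p j)\<^sup>2) / (2 * h)"
      by (simp add: power_divide sum_divide_distrib)
    then show ?thesis using that h by simp
  qed
  show "(\<integral>x. (scaled_eigenvalue h k x)\<^sup>2 \<partial>iid_law D h) \<le> 1" "(\<integral>x. (scaled_eigenvalue h l x)\<^sup>2 \<partial>iid_law D h) \<le> 1"
    unfolding scaled_eigenvalue_linear iid_law_linear_second_moment[OF D] using * generic_pair_coeff_sums[OF g] by auto
qed

lemma gauss2_second_moment:
  "integrable gauss2 (\<lambda>z. (z 0)\<^sup>2)" "(\<integral>z. (z 0)\<^sup>2 \<partial>gauss2) = 1"
  "integrable gauss2 (\<lambda>z. (z 1)\<^sup>2)" "(\<integral>z. (z 1)\<^sup>2 \<partial>gauss2) = 1"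
  using iid_law_linear_second_moment[OF pte_law_std_normal, where h = 2 and a = "\<lambda>j. if j = 0 then 1 else 0"]
    iid_law_linear_second_moment[OF pte_law_std_normal, where h = 2 and a = "\<lambda>j. if j = 0 then 0 else 1"]
  by (simp_all add: numeral_2_eq_2)

text \<open>
  The normal approximation is used first for the matrix with entry law \<open>D\<close>, with the eigenvalues of the
  other matrix held fixed, and then for the matrix with entry law \<open>E\<close>.
\<close>
lemma two_point_char:
  assumes D: "pte_law D" and E: "pte_law E" and g: "generic_pair h k l"
  shows "cmod ((CLINT y|iid_law E h. CLINT x|iid_law D h.
              iexp (a * (scaled_eigenvalue h k x * scaled_eigenvalue h k y) + b * (scaled_eigenvalue h l x * scaled_eigenvalue h l y)))
            - normal_product_char a * normal_product_char b)
         \<le> (clt_error D h + clt_error E h) * (a\<^sup>2 + b\<^sup>2)"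
proof -
  let ?P = "iid_law D h" and ?Q = "iid_law E h"
  interpret P: prob_space ?P by (rule prob_space_iid_law[OF D])
  interpret Q: prob_space ?Q by (rule prob_space_iid_law[OF E])
  interpret G: prob_space gauss2 by (rule prob_space_iid_law[OF pte_law_std_normal])
  interpret QP: pair_sigma_finite ?Q ?P ..
  interpret QG: pair_sigma_finite ?Q gauss2 ..
  interpret QG: pair_prob_space ?Q gauss2 ..
  note [measurable] = scaled_eigenvalue_measurable[OF D] scaled_eigenvalue_measurable[OF E]
  have [measurable]: "(\<lambda>z. z 0) \<in> borel_measurable gauss2" "(\<lambda>z. z 1) \<in> borel_measurable gauss2"
    "(\<lambda>z. z (Suc 0)) \<in> borel_measurable gauss2"
    by (simp_all add: iid_law_component_measurable[OF pte_law_std_normal])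
  define F where "F = (\<lambda>y. CLINT x|?P. iexp (a * (scaled_eigenvalue h k x * scaled_eigenvalue h k y) + b * (scaled_eigenvalue h l x * scaled_eigenvalue h l y)))"
  define H where "H = (\<lambda>y. complex_of_real (exp (- ((a * scaled_eigenvalue h k y)\<^sup>2 + (b * scaled_eigenvalue h l y)\<^sup>2) / 2)))"
  have F_meas: "F \<in> borel_measurable ?Q"
    unfolding F_def by measurable
  have H_meas: "H \<in> borel_measurable ?Q"
    unfolding H_def by measurable
  have F_eq: "F y = (CLINT x|?P. iexp ((a * scaled_eigenvalue h k y) * scaled_eigenvalue h k x + (b * scaled_eigenvalue h l y) * scaled_eigenvalue h l x))" for y
    unfolding F_def by (simp add: mult_ac)
  have intQ: "integrable ?Q (\<lambda>y. clt_error D h * ((a * scaled_eigenvalue h k y)\<^sup>2 + (b * scaled_eigenvalue h l y)\<^sup>2))"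
    unfolding power_mult_distrib
    by (intro integrable_mult_right Bochner_Integration.integrable_add scaled_eigenvalue_second_moment[OF E g])
  have "cmod ((CLINT y|?Q. F y) - (CLINT y|?Q. H y)) \<le> (\<integral>y. clt_error D h * ((a * scaled_eigenvalue h k y)\<^sup>2 + (b * scaled_eigenvalue h l y)\<^sup>2) \<partial>?Q)"
  proof (rule cmod_expectation_diff_le[OF Q.prob_space_axioms F_meas H_meas _ _ _ intQ])
    show "cmod (F y) \<le> 1" for y unfolding F_eq by (rule cmod_expectation_iexp_le_1) (rule P.prob_space_axioms)
    show "cmod (H y) \<le> 1" for y unfolding H_def norm_of_real by (simp add: add_nonneg_nonneg)
    show "cmod (F y - H y) \<le> clt_error D h * ((a * scaled_eigenvalue h k y)\<^sup>2 + (b * scaled_eigenvalue h l y)\<^sup>2)" for y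
      unfolding F_eq H_def by (rule char_scaled_eigenvalue_pair[OF D g])
  qed
  also have "\<dots> = clt_error D h * (a\<^sup>2 * (\<integral>y. (scaled_eigenvalue h k y)\<^sup>2 \<partial>?Q) + b\<^sup>2 * (\<integral>y. (scaled_eigenvalue h l y)\<^sup>2 \<partial>?Q))"
    using scaled_eigenvalue_second_moment[OF E g] by (simp add: power_mult_distrib)
  also have "\<dots> \<le> clt_error D h * (a\<^sup>2 * 1 + b\<^sup>2 * 1)"
    by (intro mult_left_mono add_mono scaled_eigenvalue_second_moment[OF E g] clt_error_nonneg) auto
  finally have 1: "cmod ((CLINT y|?Q. F y) - (CLINT y|?Q. H y)) \<le> clt_error D h * (a\<^sup>2 + b\<^sup>2)" by simp

  \<comment> \<open>The normal factor in \<open>H\<close> is itself a characteristic function, so that after exchanging the integrals the same estimate applies to the law \<open>E\<close>.\<close>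
  define F' where "F' = (\<lambda>z::nat \<Rightarrow> real. CLINT y|?Q. iexp ((a * z 0) * scaled_eigenvalue h k y + (b * z 1) * scaled_eigenvalue h l y))"
  define H' where "H' = (\<lambda>z::nat \<Rightarrow> real. complex_of_real (exp (- ((a * z 0)\<^sup>2 + (b * z 1)\<^sup>2) / 2)))"
  have F'_meas: "F' \<in> borel_measurable gauss2"
    unfolding F'_def by measurable
  have H'_meas: "H' \<in> borel_measurable gauss2"
    unfolding H'_def by measurable
  have H_eq: "H y = (CLINT z|gauss2. iexp ((a * scaled_eigenvalue h k y) * z 0 + (b * scaled_eigenvalue h l y) * z 1))" for y
    unfolding H_def gauss2_char ..
  have "(CLINT y|?Q. H y) = (CLINT y|?Q. CLINT z|gauss2. iexp ((a * z 0) * scaled_eigenvalue h k y + (b * z 1) * scaled_eigenvalue h l y))"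
    unfolding H_eq by (simp add: mult_ac)
  also have "\<dots> = (CLINT z|gauss2. F' z)"
    unfolding F'_def
  proof (rule QG.Fubini_integral[symmetric])
    show "integrable (?Q \<Otimes>\<^sub>M gauss2) (\<lambda>(y, z). iexp ((a * z 0) * scaled_eigenvalue h k y + (b * z 1) * scaled_eigenvalue h l y))"
      by (rule QG.P.integrable_const_bound[where B = 1]) (auto simp: split_beta' simp del: of_real_add of_real_mult)
  qed
  finally have swap: "(CLINT y|?Q. H y) = (CLINT z|gauss2. F' z)" .
  have intG: "integrable gauss2 (\<lambda>z. clt_error E h * ((a * z 0)\<^sup>2 + (b * z 1)\<^sup>2))"
    unfolding power_mult_distrib
    by (intro integrable_mult_right Bochner_Integration.integrable_add gauss2_second_moment)
  have "cmod ((CLINT z|gauss2. F' z) - (CLINT z|gauss2. H' z)) \<le> (\<integral>z. clt_error E h * ((a * z 0)\<^sup>2 + (b * z 1)\<^sup>2) \<partial>gauss2)"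
  proof (rule cmod_expectation_diff_le[OF G.prob_space_axioms F'_meas H'_meas _ _ _ intG])
    show "cmod (F' z) \<le> 1" for z unfolding F'_def by (rule cmod_expectation_iexp_le_1) (rule Q.prob_space_axioms)
    show "cmod (H' z) \<le> 1" for z unfolding H'_def norm_of_real by (simp add: add_nonneg_nonneg)
    show "cmod (F' z - H' z) \<le> clt_error E h * ((a * z 0)\<^sup>2 + (b * z 1)\<^sup>2)" for z
      unfolding F'_def H'_def by (rule char_scaled_eigenvalue_pair[OF E g])
  qed
  also have "\<dots> = clt_error E h * (a\<^sup>2 + b\<^sup>2)"
    using gauss2_second_moment by (simp add: power_mult_distrib)
  finally have 2: "cmod ((CLINT z|gauss2. F' z) - (CLINT z|gauss2. H' z)) \<le> clt_error E h * (a\<^sup>2 + b\<^sup>2)" .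
  have 3: "(CLINT z|gauss2. H' z) = normal_product_char a * normal_product_char b"
    unfolding H'_def by (rule gauss2_normal_product_char)
  show ?thesis
    using 1 2 norm_triangle_ineq[of "(CLINT y|?Q. F y) - (CLINT y|?Q. H y)" "(CLINT z|gauss2. F' z) - (CLINT z|gauss2. H' z)"]
    unfolding swap 3 F_def by (simp add: distrib_right)
qed

section \<open>From characteristic functions to distribution functions\<close>

lemma tight_of_first_moment_bound:
  fixes \<nu> :: "nat \<Rightarrow> real measure"
  assumes \<nu>: "\<And>n. real_distribution (\<nu> n)" and int: "\<And>n. integrable (\<nu> n) (\<lambda>y. y)"
    and K: "\<And>n. (\<integral>y. \<bar>y\<bar> \<partial>\<nu> n) \<le> K"
  shows "tight \<nu>"
  unfolding tight_def
proof (intro conjI allI impI \<nu>)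
  fix \<epsilon> :: real assume \<epsilon>: "\<epsilon> > 0"
  have "0 \<le> (\<integral>y. \<bar>y\<bar> \<partial>\<nu> 0)" by simp
  then have K0: "K \<ge> 0" using K[of 0] by linarith
  \<comment> \<open>Markov's inequality at level \<open>c\<close>.\<close>
  define c where "c = K / \<epsilon> + 1"
  have c: "c > 0" "K / c < \<epsilon>" using K0 \<epsilon> by (auto simp: c_def field_simps add_nonneg_pos)
  have "1 - \<epsilon> < measure (\<nu> n) {-c<..c}" for n
  proof -
    interpret real_distribution "\<nu> n" by (rule \<nu>)
    have "measure (\<nu> n) {y \<in> space (\<nu> n). c \<le> \<bar>y\<bar>} \<le> (\<integral>y. \<bar>y\<bar> \<partial>\<nu> n) / c"
      by (rule integral_Markov_inequality_measure[where A = "{}"]) (use c int in auto)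
    also have "\<dots> \<le> K / c" using K c by (simp add: divide_right_mono)
    finally have "measure (\<nu> n) {y. c \<le> \<bar>y\<bar>} < \<epsilon>" using c by simp
    moreover have "measure (\<nu> n) (UNIV - {y. c \<le> \<bar>y\<bar>}) = 1 - measure (\<nu> n) {y. c \<le> \<bar>y\<bar>}"
      using prob_compl[of "{y. c \<le> \<bar>y\<bar>}"] by simp
    moreover have "measure (\<nu> n) (UNIV - {y. c \<le> \<bar>y\<bar>}) \<le> measure (\<nu> n) {-c<..c}"
      by (rule finite_measure_mono) auto
    ultimately show ?thesis by linarith
  qed
  then show "\<exists>a b. a < b \<and> (\<forall>n. 1 - \<epsilon> < measure (\<nu> n) {a<..b})"
    using c by (intro exI[of _ "-c"] exI[of _ c]) auto
qed

text \<open>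
  A compactness statement. At a continuity point of a limit law, a distribution function is close
  to the limit as soon as the characteristic functions are close at finitely many rational points,
  provided that the first absolute moment is at most \<open>K\<close>. The points and the closeness depend on
  \<open>K\<close>, but not on the distribution. Rational points are enumerated by \<open>from_nat\<close>.
\<close>
lemma cdf_close_of_char_close:
  assumes \<mu>: "real_distribution \<mu>" and x: "isCont (cdf \<mu>) x" and \<epsilon>: "\<epsilon> > 0"
  shows "\<exists>(n0 :: nat) \<delta>. \<delta> > 0 \<and> (\<forall>\<nu>. real_distribution \<nu> \<longrightarrow> integrable \<nu> (\<lambda>y. y) \<longrightarrow> (\<integral>y. \<bar>y\<bar> \<partial>\<nu>) \<le> K \<longrightarrow>
      (\<forall>i\<le>n0. cmod (char \<nu> (of_rat (from_nat i)) - char \<mu> (of_rat (from_nat i))) < \<delta>) \<longrightarrow>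
      \<bar>cdf \<nu> x - cdf \<mu> x\<bar> \<le> \<epsilon>)"
proof (rule ccontr)
  assume neg: "\<not> ?thesis"
  define t where "t = (\<lambda>i::nat. of_rat (from_nat i) :: real)"
  have "\<exists>\<nu>. real_distribution \<nu> \<and> integrable \<nu> (\<lambda>y. y) \<and> (\<integral>y. \<bar>y\<bar> \<partial>\<nu>) \<le> K \<and>
      (\<forall>i\<le>n. cmod (char \<nu> (t i) - char \<mu> (t i)) < 1 / real (Suc n)) \<and> \<not> \<bar>cdf \<nu> x - cdf \<mu> x\<bar> \<le> \<epsilon>" for n
  proof -
    have "1 / real (Suc n) > 0" by simp
    with neg show ?thesis unfolding t_def by blast
  qed
  then obtain \<nu> where \<nu>: "\<And>n. real_distribution (\<nu> n)" "\<And>n. integrable (\<nu> n) (\<lambda>y. y)" "\<And>n. (\<integral>y. \<bar>y\<bar> \<partial>\<nu> n) \<le> K"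
      "\<And>n i. i \<le> n \<Longrightarrow> cmod (char (\<nu> n) (t i) - char \<mu> (t i)) < 1 / real (Suc n)"
      "\<And>n. \<not> \<bar>cdf (\<nu> n) x - cdf \<mu> x\<bar> \<le> \<epsilon>" by metis
  have char_t: "(\<lambda>n. char (\<nu> n) (t i)) \<longlonglongrightarrow> char \<mu> (t i)" for i
  proof (rule LIM_zero_cancel, rule Lim_null_comparison)
    show "\<forall>\<^sub>F n in sequentially. norm (char (\<nu> n) (t i) - char \<mu> (t i)) \<le> 1 / real (Suc n)"
      unfolding eventually_sequentially using \<nu>(4) by (intro exI[of _ i]) (auto intro: less_imp_le)
    show "(\<lambda>n. 1 / real (Suc n)) \<longlonglongrightarrow> 0" by (rule lim_1_over_n[THEN LIMSEQ_Suc])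
  qed
  have "weak_conv_m \<nu> \<mu>"
  proof (rule tight_subseq_weak_converge[OF \<nu>(1) \<mu> tight_of_first_moment_bound[OF \<nu>(1-3)]])
    fix s \<rho> assume s: "strict_mono s" and \<rho>: "real_distribution \<rho>" and conv: "weak_conv_m (\<nu> \<circ> s) \<rho>"
    have rd: "real_distribution ((\<nu> \<circ> s) n)" for n using \<nu>(1) by simp
    have eq: "char \<rho> (t i) = char \<mu> (t i)" for i
    proof (rule LIMSEQ_unique)
      show "(\<lambda>n. char ((\<nu> \<circ> s) n) (t i)) \<longlonglongrightarrow> char \<rho> (t i)" by (rule levy_continuity1[OF rd \<rho> conv])
      show "(\<lambda>n. char ((\<nu> \<circ> s) n) (t i)) \<longlonglongrightarrow> char \<mu> (t i)"
        using LIMSEQ_subseq_LIMSEQ[OF char_t s] by (simp add: o_def)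
    qed
    \<comment> \<open>Characteristic functions are continuous, and the rationals are dense.\<close>
    have "closed {y. char \<rho> y = char \<mu> y}"
      by (intro closed_Collect_eq continuous_at_imp_continuous_on ballI
          real_distribution.isCont_char[OF \<rho>] real_distribution.isCont_char[OF \<mu>])
    moreover have "\<rat> \<subseteq> {y. char \<rho> y = char \<mu> y}"
    proof
      fix y :: real assume "y \<in> \<rat>"
      then obtain r where "y = of_rat r" by (auto elim: Rats_cases)
      then have "y = t (to_nat r)" by (simp add: t_def)
      then show "y \<in> {y. char \<rho> y = char \<mu> y}" using eq by simp
    qed
    ultimately have "closure \<rat> \<subseteq> {y. char \<rho> y = char \<mu> y}" by (rule closure_minimal[rotated])
    then have "char \<rho> = char \<mu>" by (auto simp: Rats_closure_real)
    then have "\<rho> = \<mu>" by (rule Levy_uniqueness[OF \<rho> \<mu>])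
    with conv show "weak_conv_m (\<nu> \<circ> s) \<mu>" by simp
  qed
  then have "(\<lambda>n. cdf (\<nu> n) x) \<longlonglongrightarrow> cdf \<mu> x"
    using x by (simp add: weak_conv_m_def weak_conv_def)
  then have "\<forall>\<^sub>F n in sequentially. dist (cdf (\<nu> n) x) (cdf \<mu> x) < \<epsilon>" using \<epsilon> by (rule tendstoD)
  then obtain n where "dist (cdf (\<nu> n) x) (cdf \<mu> x) < \<epsilon>" by (auto simp: eventually_sequentially)
  with \<nu>(5)[of n] show False by (simp add: dist_real_def)
qed

text \<open>
  The uniform distribution on the values \<open>f 0, \<dots>, f (m - 1)\<close>, counted with multiplicity.
\<close>
definition empirical :: "nat \<Rightarrow> (nat \<Rightarrow> real) \<Rightarrow> real measure" where
  "empirical m f = distr (measure_pmf (pmf_of_set {..<m})) borel f"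

lemma real_distribution_empirical: "real_distribution (empirical m f)"
  unfolding empirical_def by (rule prob_space.real_distribution_distr[OF measure_pmf.prob_space_axioms]) simp

lemma integral_empirical:
  fixes F :: "real \<Rightarrow> 'b::{banach, second_countable_topology}"
  assumes m: "m > 0" and [measurable]: "F \<in> borel_measurable borel"
  shows "(\<integral>y. F y \<partial>empirical m f) = (1 / m) *\<^sub>R (\<Sum>k<m. F (f k))"
proof -
  have ne: "finite {..<m}" "{..<m} \<noteq> {}" using m by auto
  have "(\<integral>y. F y \<partial>empirical m f) = (\<integral>k. F (f k) \<partial>measure_pmf (pmf_of_set {..<m}))"
    unfolding empirical_def by (rule integral_distr) auto
  also have "\<dots> = (\<Sum>k<m. pmf (pmf_of_set {..<m}) k *\<^sub>R F (f k))"
    using ne by (intro integral_measure_pmf) (auto simp: set_pmf_of_set)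
  also have "\<dots> = (\<Sum>k<m. (1 / m) *\<^sub>R F (f k))"
    using ne by (intro sum.cong refl) (simp add: pmf_of_set)
  finally show ?thesis by (simp add: scaleR_sum_right)
qed

lemma integrable_empirical:
  assumes m: "m > 0" and [measurable]: "F \<in> borel_measurable borel"
  shows "integrable (empirical m f) (F :: real \<Rightarrow> real)"
  unfolding empirical_def
proof (subst integrable_distr_eq)
  have "finite (set_pmf (pmf_of_set {..<m}))" using m by (subst set_pmf_of_set) auto
  then show "integrable (measure_pmf (pmf_of_set {..<m})) (\<lambda>k. F (f k))"
    by (rule integrable_measure_pmf_finite)
qed auto

lemma cdf_empirical:
  assumes m: "m > 0"
  shows "cdf (empirical m f) x = real (card {k. k < m \<and> f k \<le> x}) / m"
proof -
  have ne: "finite {..<m}" "{..<m} \<noteq> {}" using m by auto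
  have "cdf (empirical m f) x = measure (measure_pmf (pmf_of_set {..<m})) (f -` {..x})"
    unfolding empirical_def cdf_def by (subst measure_distr) auto
  also have "\<dots> = real (card ({..<m} \<inter> f -` {..x})) / m"
    using measure_pmf_of_set[OF ne(2,1), of "f -` {..x}"] by simp
  also have "{..<m} \<inter> f -` {..x} = {k. k < m \<and> f k \<le> x}" by auto
  finally show ?thesis .
qed

section \<open>The empirical distribution of the eigenvalue products\<close>

text \<open>
  The joint law of the coefficients of the two independent matrices.
\<close>
definition coeff_law :: "real measure \<Rightarrow> real measure \<Rightarrow> nat \<Rightarrow> ((nat \<Rightarrow> real) \<times> (nat \<Rightarrow> real)) measure" where
  "coeff_law D E h = iid_law D h \<Otimes>\<^sub>M iid_law E h"

text \<open>
  The \<open>k\<close>-th eigenvalue of the anticommutator of the two circulant blocks, divided by the order \<open>2 * h\<close>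
  of the full matrices. The pair \<open>p\<close> consists of the coefficients of the two matrices.
\<close>
definition circ_product :: "nat \<Rightarrow> (nat \<Rightarrow> real) \<times> (nat \<Rightarrow> real) \<Rightarrow> nat \<Rightarrow> real" where
  "circ_product h p k = 2 * (scaled_eigenvalue h k (fst p) * scaled_eigenvalue h k (snd p))"

lemma prob_space_coeff_law:
  assumes "pte_law D" "pte_law E"
  shows "prob_space (coeff_law D E h)"
proof -
  interpret P: prob_space "iid_law D h" by (rule prob_space_iid_law[OF assms(1)])
  interpret Q: prob_space "iid_law E h" by (rule prob_space_iid_law[OF assms(2)])
  interpret PQ: pair_prob_space "iid_law D h" "iid_law E h" ..
  show ?thesis unfolding coeff_law_def by (rule PQ.prob_space_axioms)
qed

lemma scaled_eigenvalue_fst_measurable: "pte_law D \<Longrightarrow> (\<lambda>p. scaled_eigenvalue h k (fst p)) \<in> borel_measurable (coeff_law D E h)"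
  unfolding coeff_law_def by (rule measurable_compose[OF measurable_fst scaled_eigenvalue_measurable])

lemma scaled_eigenvalue_snd_measurable: "pte_law E \<Longrightarrow> (\<lambda>p. scaled_eigenvalue h k (snd p)) \<in> borel_measurable (coeff_law D E h)"
  unfolding coeff_law_def by (rule measurable_compose[OF measurable_snd scaled_eigenvalue_measurable])

lemma circ_product_measurable:
  assumes "pte_law D" "pte_law E"
  shows "(\<lambda>p. circ_product h p k) \<in> borel_measurable (coeff_law D E h)"
  unfolding circ_product_def
  by (intro borel_measurable_times borel_measurable_const scaled_eigenvalue_fst_measurable scaled_eigenvalue_snd_measurable assms)

lemma normal_product_char_0 [simp]: "normal_product_char 0 = 1"
proof -
  interpret S: prob_space std_normal_distribution by (rule pte_law_prob_space[OF pte_law_std_normal])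
  show ?thesis using S.prob_space by (simp add: normal_product_char_def)
qed

lemma normal_product_char_minus [simp]: "normal_product_char (- t) = normal_product_char t"
  by (simp add: normal_product_char_def)

lemma normal_product_char_bounds: "0 \<le> normal_product_char t" "normal_product_char t \<le> 1"
proof -
  interpret S: prob_space std_normal_distribution by (rule pte_law_prob_space[OF pte_law_std_normal])
  show "0 \<le> normal_product_char t" by (simp add: normal_product_char_def)
  have "(\<integral>z. exp (- (t * z)\<^sup>2 / 2) \<partial>std_normal_distribution) \<le> (\<integral>z. 1 \<partial>std_normal_distribution)"
    by (intro integral_mono S.integrable_const_bound[where B = 1]) auto
  then show "normal_product_char t \<le> 1" using S.prob_space by (simp add: normal_product_char_def)
qed

lemma coeff_law_two_point:
  assumes D: "pte_law D" and E: "pte_law E" and g: "generic_pair h k l"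
  shows "cmod ((CLINT p|coeff_law D E h. iexp (a * circ_product h p k + b * circ_product h p l))
            - normal_product_char (2 * a) * normal_product_char (2 * b))
         \<le> 4 * (clt_error D h + clt_error E h) * (a\<^sup>2 + b\<^sup>2)"
proof -
  interpret P: prob_space "iid_law D h" by (rule prob_space_iid_law[OF D])
  interpret Q: prob_space "iid_law E h" by (rule prob_space_iid_law[OF E])
  interpret PQ: pair_prob_space "iid_law D h" "iid_law E h" ..
  note [measurable] = scaled_eigenvalue_measurable[OF D] scaled_eigenvalue_measurable[OF E]
  let ?f = "\<lambda>x y. iexp (2 * a * (scaled_eigenvalue h k x * scaled_eigenvalue h k y) + 2 * b * (scaled_eigenvalue h l x * scaled_eigenvalue h l y))"
  have "(CLINT p|coeff_law D E h. iexp (a * circ_product h p k + b * circ_product h p l))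
      = integral\<^sup>L (iid_law D h \<Otimes>\<^sub>M iid_law E h) (case_prod ?f)"
    unfolding coeff_law_def circ_product_def
    by (intro Bochner_Integration.integral_cong refl) (simp add: split_beta' mult_ac)
  also have "\<dots> = (CLINT y|iid_law E h. CLINT x|iid_law D h. ?f x y)"
  proof (rule PQ.integral_snd[symmetric])
    show "integrable (iid_law D h \<Otimes>\<^sub>M iid_law E h) (case_prod ?f)"
      by (rule PQ.P.integrable_const_bound[where B = 1]) (auto simp: split_beta' simp del: of_real_add of_real_mult)
  qed
  finally have "(CLINT p|coeff_law D E h. iexp (a * circ_product h p k + b * circ_product h p l))
      = (CLINT y|iid_law E h. CLINT x|iid_law D h. ?f x y)" .
  then show ?thesis
    using two_point_char[OF D E g, of "2 * a" "2 * b"] by (simp add: power_mult_distrib distrib_left mult_ac)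
qed

text \<open>
  Among the pairs of frequencies at most \<open>4 * (2 * h - 1)\<close> are not generic.
\<close>
lemma sum_generic_pair_bound:
  assumes "c \<ge> 0"
  shows "(\<Sum>k<2 * h - 1. \<Sum>l<2 * h - 1. if generic_pair h k l then c else (4::real))
       \<le> (real (2 * h - 1))\<^sup>2 * c + 16 * real (2 * h - 1)"
proof -
  define m where "m = 2 * h - 1"
  have one: "(\<Sum>l<m. if l = a then 1 else 0) \<le> (1::real)" for a
    by (simp add: sum.delta)
  have "(\<Sum>k<m. \<Sum>l<m. if generic_pair h k l then c else 4)
     \<le> (\<Sum>k<m. \<Sum>l<m. c + 4 * (if k = 0 then 1 else 0) + 4 * (if l = 0 then 1 else 0)
           + 4 * (if l = k then 1 else 0) + 4 * (if l = m - k then 1 else 0))"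
    using assms by (intro sum_mono) (auto simp: generic_pair_def m_def)
  also have "\<dots> \<le> (\<Sum>k<m. real m * c + 4 * real m * (if k = 0 then 1 else 0) + 4 + 4 + 4)"
  proof (rule sum_mono)
    fix k
    have "(\<Sum>l<m. c + 4 * (if k = 0 then 1 else 0) + 4 * (if l = 0 then 1 else 0)
           + 4 * (if l = k then 1 else 0) + 4 * (if l = m - k then 1 else 0))
        = real m * c + 4 * real m * (if k = 0 then 1 else 0) + 4 * (\<Sum>l<m. if l = 0 then 1 else 0)
           + 4 * (\<Sum>l<m. if l = k then 1 else 0) + 4 * (\<Sum>l<m. if l = m - k then 1 else 0)"
      unfolding sum.distrib sum_distrib_left[symmetric] by simp
    then show "(\<Sum>l<m. c + 4 * (if k = 0 then 1 else 0) + 4 * (if l = 0 then 1 else 0)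
           + 4 * (if l = k then 1 else 0) + 4 * (if l = m - k then 1 else 0))
        \<le> real m * c + 4 * real m * (if k = 0 then 1 else 0) + 4 + 4 + 4"
      using one[of 0] one[of k] one[of "m - k"] by linarith
  qed
  also have "\<dots> = real m * (real m * c) + 4 * real m * (\<Sum>k<m. if k = 0 then 1 else 0) + 12 * real m"
    unfolding sum.distrib sum_distrib_left[symmetric] by simp
  also have "\<dots> \<le> real m * (real m * c) + 4 * real m * 1 + 12 * real m"
    by (intro add_mono mult_left_mono one) auto
  finally show ?thesis by (simp add: m_def power2_eq_square)
qed

text \<open>
  The mean square distance is an average over pairs \<open>k, l\<close> of frequencies. Generic pairs contribute
  little by the two-point estimate, and the other pairs are few.
\<close>
lemma empirical_char_second_moment:
  assumes D: "pte_law D" and E: "pte_law E" and h: "h > 0"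
  shows "(\<integral>p. (cmod (char (empirical (2 * h - 1) (circ_product h p)) t - normal_product_char (2 * t)))\<^sup>2 \<partial>coeff_law D E h)
     \<le> 16 * (clt_error D h + clt_error E h) * t\<^sup>2 + 16 / real (2 * h - 1)"
proof -
  let ?J = "coeff_law D E h"
  interpret J: prob_space ?J by (rule prob_space_coeff_law[OF D E])
  note [measurable] = circ_product_measurable[OF D E]
  define m where "m = 2 * h - 1"
  have m: "m > 0" using h by (simp add: m_def)
  define \<eta> where "\<eta> = clt_error D h + clt_error E h"
  have \<eta>: "\<eta> \<ge> 0" by (simp add: \<eta>_def clt_error_nonneg)
  define \<psi> where "\<psi> = normal_product_char (2 * t)"
  have \<psi>: "0 \<le> \<psi>" "\<psi> \<le> 1" by (simp_all add: \<psi>_def normal_product_char_bounds)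
  define e where "e = (\<lambda>k p. iexp (t * circ_product h p k))"
  have e_cnj: "cnj (e k p) = iexp (- t * circ_product h p k)" for k p
    by (simp add: e_def exp_cnj)
  have e_meas [measurable]: "e k \<in> borel_measurable ?J" for k unfolding e_def by measurable
  have [measurable]: "(\<lambda>p. cnj (e k p)) \<in> borel_measurable ?J" for k unfolding e_cnj by measurable
  have e_norm: "cmod (e k p) = 1" for k p unfolding e_def by (simp del: of_real_mult)
  have e_int: "integrable ?J (e k)" for k
    by (rule J.integrable_const_bound[where B = 1]) (auto simp: e_norm)
  have ec_int: "integrable ?J (\<lambda>p. cnj (e k p))" for k
    by (rule J.integrable_const_bound[where B = 1]) (auto simp: e_norm)
  have ee_int: "integrable ?J (\<lambda>p. e k p * cnj (e l p))" for k l
    by (rule J.integrable_const_bound[where B = 1]) (auto simp: e_norm norm_mult)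
  define Z where "Z = (\<lambda>p. char (empirical m (circ_product h p)) t - \<psi>)"
  have Z_eq: "Z p = (1 / m) *\<^sub>R (\<Sum>k<m. e k p - \<psi>)" for p
  proof -
    have "char (empirical m (circ_product h p)) t = (1 / m) *\<^sub>R (\<Sum>k<m. e k p)"
      unfolding char_def e_def by (rule integral_empirical[OF m]) measurable
    then show ?thesis using m by (simp add: Z_def sum_subtractf scaleR_conv_of_real field_simps)
  qed
  \<comment> \<open>Here \<open>\<bar>Z\<bar>\<^sup>2\<close> is the average of \<open>T k l\<close> over all pairs.\<close>
  define T where "T = (\<lambda>k l p. (e k p - \<psi>) * (cnj (e l p) - \<psi>))"
  have T_eq: "T k l p = e k p * cnj (e l p) - \<psi> * e k p - \<psi> * cnj (e l p) + \<psi> * \<psi>" for k l p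
    by (simp add: T_def algebra_simps)
  have T_int: "integrable ?J (T k l)" for k l
    unfolding T_eq using e_int ec_int ee_int by (intro Bochner_Integration.integrable_add Bochner_Integration.integrable_diff integrable_mult_right) auto
  have ZZ: "complex_of_real ((cmod (Z p))\<^sup>2) = (1 / (real m)\<^sup>2) *\<^sub>R (\<Sum>k<m. \<Sum>l<m. T k l p)" for p
  proof -
    have "complex_of_real ((cmod (Z p))\<^sup>2) = Z p * cnj (Z p)" by (rule complex_norm_square)
    also have "cnj (Z p) = (1 / m) *\<^sub>R (\<Sum>k<m. cnj (e k p) - \<psi>)"
      unfolding Z_eq by (simp add: scaleR_conv_of_real)
    finally show ?thesis
      unfolding Z_eq T_def by (simp add: sum_product power2_eq_square)
  qed
  have T_le: "cmod (CLINT p|?J. T k l p) \<le> (if generic_pair h k l then 16 * \<eta> * t\<^sup>2 else 4)" for k l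
  proof (cases "generic_pair h k l")
    case True
    have one: "cmod ((CLINT p|?J. e k p) - \<psi>) \<le> 4 * \<eta> * t\<^sup>2"
      using coeff_law_two_point[OF D E True, of t 0] by (simp add: e_def \<psi>_def \<eta>_def)
    have two: "cmod ((CLINT p|?J. cnj (e l p)) - \<psi>) \<le> 4 * \<eta> * t\<^sup>2"
      using coeff_law_two_point[OF D E True, of 0 "- t"] unfolding e_cnj by (simp add: \<psi>_def \<eta>_def)
    have three: "cmod ((CLINT p|?J. e k p * cnj (e l p)) - \<psi> * \<psi>) \<le> 8 * \<eta> * t\<^sup>2"
    proof -
      have "e k p * cnj (e l p) = iexp (t * circ_product h p k + (- t) * circ_product h p l)" for p
        unfolding e_cnj unfolding e_def exp_add[symmetric] by (simp add: algebra_simps)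
      moreover have "4 * (clt_error D h + clt_error E h) * (t\<^sup>2 + (- t)\<^sup>2) = 8 * \<eta> * t\<^sup>2"
        by (simp add: \<eta>_def)
      ultimately show ?thesis
        using coeff_law_two_point[OF D E True, of t "- t"]
        by (simp only: \<psi>_def mult_minus_right normal_product_char_minus)
    qed
    have "(CLINT p|?J. T k l p) = (CLINT p|?J. e k p * cnj (e l p)) - \<psi> * (CLINT p|?J. e k p)
        - \<psi> * (CLINT p|?J. cnj (e l p)) + \<psi> * \<psi>"
      unfolding T_eq using e_int ec_int ee_int J.prob_space by simp
    also have "\<dots> = ((CLINT p|?J. e k p * cnj (e l p)) - \<psi> * \<psi>) - \<psi> * ((CLINT p|?J. e k p) - \<psi>)
        - \<psi> * ((CLINT p|?J. cnj (e l p)) - \<psi>)"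
      by (simp add: algebra_simps)
    also have "cmod \<dots> \<le> cmod ((CLINT p|?J. e k p * cnj (e l p)) - \<psi> * \<psi>)
        + cmod (\<psi> * ((CLINT p|?J. e k p) - \<psi>)) + cmod (\<psi> * ((CLINT p|?J. cnj (e l p)) - \<psi>))"
      by (intro order_trans[OF norm_triangle_ineq4] add_mono order_refl)
    also have "\<dots> \<le> 8 * \<eta> * t\<^sup>2 + 1 * (4 * \<eta> * t\<^sup>2) + 1 * (4 * \<eta> * t\<^sup>2)"
      unfolding norm_mult by (intro add_mono mult_mono one two three) (use \<psi> in auto)
    finally show ?thesis using True by simp
  next
    case False
    have "cmod (T k l p) \<le> 4" for p
    proof -
      have "cmod (e k p - \<psi>) \<le> 2" "cmod (cnj (e l p) - \<psi>) \<le> 2"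
        using norm_triangle_ineq4[of "e k p" \<psi>] norm_triangle_ineq4[of "cnj (e l p)" \<psi>] \<psi>
        by (simp_all add: e_norm)
      then have "cmod (T k l p) \<le> 2 * 2" unfolding T_def norm_mult by (intro mult_mono) auto
      then show ?thesis by simp
    qed
    then have "(\<integral>p. cmod (T k l p) \<partial>?J) \<le> (\<integral>p. 4 \<partial>?J)"
      using T_int by (intro integral_mono) auto
    then have "(\<integral>p. cmod (T k l p) \<partial>?J) \<le> 4" using J.prob_space by simp
    moreover have "cmod (CLINT p|?J. T k l p) \<le> (\<integral>p. cmod (T k l p) \<partial>?J)" by (rule integral_norm_bound)
    ultimately have "cmod (CLINT p|?J. T k l p) \<le> 4" by linarith
    then show ?thesis using False by simp
  qed
  have "complex_of_real (\<integral>p. (cmod (Z p))\<^sup>2 \<partial>?J) = (CLINT p|?J. complex_of_real ((cmod (Z p))\<^sup>2))"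
    by (rule integral_complex_of_real[symmetric])
  also have "\<dots> = (1 / (real m)\<^sup>2) *\<^sub>R (\<Sum>k<m. \<Sum>l<m. CLINT p|?J. T k l p)"
    unfolding ZZ using T_int by simp
  finally have "\<bar>\<integral>p. (cmod (Z p))\<^sup>2 \<partial>?J\<bar> = cmod ((1 / (real m)\<^sup>2) *\<^sub>R (\<Sum>k<m. \<Sum>l<m. CLINT p|?J. T k l p))"
    by (metis norm_of_real)
  also have "\<dots> = (1 / (real m)\<^sup>2) * cmod (\<Sum>k<m. \<Sum>l<m. CLINT p|?J. T k l p)" by simp
  also have "\<dots> \<le> (1 / (real m)\<^sup>2) * (\<Sum>k<m. \<Sum>l<m. if generic_pair h k l then 16 * \<eta> * t\<^sup>2 else 4)"
    by (intro mult_left_mono order_trans[OF norm_sum] sum_mono T_le) auto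
  also have "\<dots> \<le> (1 / (real m)\<^sup>2) * ((real m)\<^sup>2 * (16 * \<eta> * t\<^sup>2) + 16 * real m)"
    unfolding m_def using \<eta> by (intro mult_left_mono sum_generic_pair_bound) auto
  also have "\<dots> = 16 * \<eta> * t\<^sup>2 + 16 / real m"
    using m by (simp add: field_simps power2_eq_square)
  finally show ?thesis by (simp add: Z_def \<psi>_def \<eta>_def m_def)
qed

lemma empirical_first_moment:
  assumes D: "pte_law D" and E: "pte_law E" and h: "h > 0"
  shows "integrable (coeff_law D E h) (\<lambda>p. \<integral>y. \<bar>y\<bar> \<partial>empirical (2 * h - 1) (circ_product h p))"
    and "(\<integral>p. (\<integral>y. \<bar>y\<bar> \<partial>empirical (2 * h - 1) (circ_product h p)) \<partial>coeff_law D E h) \<le> 4"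
proof -
  let ?J = "coeff_law D E h"
  interpret P: prob_space "iid_law D h" by (rule prob_space_iid_law[OF D])
  interpret Q: prob_space "iid_law E h" by (rule prob_space_iid_law[OF E])
  interpret PQ: pair_prob_space "iid_law D h" "iid_law E h" ..
  interpret J: prob_space ?J by (rule prob_space_coeff_law[OF D E])
  note [measurable] = circ_product_measurable[OF D E] scaled_eigenvalue_fst_measurable[OF D] scaled_eigenvalue_snd_measurable[OF E]
  define m where "m = 2 * h - 1"
  have m: "m > 0" using h by (simp add: m_def)
  have coeff: "(circ_coeff h k j)\<^sup>2 \<le> 4" for k j
  proof -
    have "\<bar>circ_coeff h k j\<bar> \<le> 2" using abs_cos_le_one by (auto simp: circ_coeff_def abs_mult)
    then have "\<bar>circ_coeff h k j\<bar>\<^sup>2 \<le> 2\<^sup>2" by (intro power_mono) auto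
    then show ?thesis by simp
  qed
  have sq: "integrable (iid_law F h) (\<lambda>x. (scaled_eigenvalue h k x)\<^sup>2)" "(\<integral>x. (scaled_eigenvalue h k x)\<^sup>2 \<partial>iid_law F h) \<le> 2"
    if F: "pte_law F" for F k
  proof -
    show "integrable (iid_law F h) (\<lambda>x. (scaled_eigenvalue h k x)\<^sup>2)"
      unfolding scaled_eigenvalue_linear by (rule iid_law_linear_second_moment[OF F])
    have "(\<integral>x. (scaled_eigenvalue h k x)\<^sup>2 \<partial>iid_law F h) = (\<Sum>j<h. (circ_coeff h k j)\<^sup>2 / (2 * h))"
      unfolding scaled_eigenvalue_linear iid_law_linear_second_moment(2)[OF F] by (simp add: power_divide)
    also have "\<dots> \<le> (\<Sum>j<h. 4 / (2 * h))" by (intro sum_mono divide_right_mono coeff) auto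
    also have "\<dots> = 2" using h by simp
    finally show "(\<integral>x. (scaled_eigenvalue h k x)\<^sup>2 \<partial>iid_law F h) \<le> 2" .
  qed
  have dfst: "distr ?J (iid_law D h) fst = iid_law D h"
    unfolding coeff_law_def by (rule Q.distr_pair_fst)
  have dsnd: "distr ?J (iid_law E h) snd = iid_law E h"
  proof -
    have "distr ?J (iid_law E h) snd
        = distr (distr (iid_law E h \<Otimes>\<^sub>M iid_law D h) (iid_law D h \<Otimes>\<^sub>M iid_law E h) (\<lambda>(x, y). (y, x))) (iid_law E h) snd"
      unfolding coeff_law_def using PQ.distr_pair_swap by simp
    also have "\<dots> = distr (iid_law E h \<Otimes>\<^sub>M iid_law D h) (iid_law E h) fst"
      by (subst distr_distr) (auto simp: o_def split_beta')
    also have "\<dots> = iid_law E h" by (rule P.distr_pair_fst)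
    finally show ?thesis .
  qed
  have fst_meas: "fst \<in> measurable ?J (iid_law D h)" and snd_meas: "snd \<in> measurable ?J (iid_law E h)"
    unfolding coeff_law_def by auto
  have J1: "integrable ?J (\<lambda>p. (scaled_eigenvalue h k (fst p))\<^sup>2)" "(\<integral>p. (scaled_eigenvalue h k (fst p))\<^sup>2 \<partial>?J) \<le> 2" for k
  proof -
    have meas: "(\<lambda>x. (scaled_eigenvalue h k x)\<^sup>2) \<in> borel_measurable (iid_law D h)" using scaled_eigenvalue_measurable[OF D] by measurable
    show "integrable ?J (\<lambda>p. (scaled_eigenvalue h k (fst p))\<^sup>2)"
      using integrable_distr_eq[OF fst_meas meas] sq(1)[OF D] dfst by simp
    show "(\<integral>p. (scaled_eigenvalue h k (fst p))\<^sup>2 \<partial>?J) \<le> 2"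
      using integral_distr[OF fst_meas meas] sq(2)[OF D, of k] dfst by simp
  qed
  have J2: "integrable ?J (\<lambda>p. (scaled_eigenvalue h k (snd p))\<^sup>2)" "(\<integral>p. (scaled_eigenvalue h k (snd p))\<^sup>2 \<partial>?J) \<le> 2" for k
  proof -
    have meas: "(\<lambda>x. (scaled_eigenvalue h k x)\<^sup>2) \<in> borel_measurable (iid_law E h)" using scaled_eigenvalue_measurable[OF E] by measurable
    show "integrable ?J (\<lambda>p. (scaled_eigenvalue h k (snd p))\<^sup>2)"
      using integrable_distr_eq[OF snd_meas meas] sq(1)[OF E] dsnd by simp
    show "(\<integral>p. (scaled_eigenvalue h k (snd p))\<^sup>2 \<partial>?J) \<le> 2"
      using integral_distr[OF snd_meas meas] sq(2)[OF E, of k] dsnd by simp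
  qed
  \<comment> \<open>Second moments of the eigenvalues bound the first moment of the product.\<close>
  have le: "\<bar>circ_product h p k\<bar> \<le> (scaled_eigenvalue h k (fst p))\<^sup>2 + (scaled_eigenvalue h k (snd p))\<^sup>2" for p k
    using sum_squares_bound[of "\<bar>scaled_eigenvalue h k (fst p)\<bar>" "\<bar>scaled_eigenvalue h k (snd p)\<bar>"] by (simp add: circ_product_def abs_mult)
  have int_k: "integrable ?J (\<lambda>p. \<bar>circ_product h p k\<bar>)" for k
    by (rule Bochner_Integration.integrable_bound[OF Bochner_Integration.integrable_add[OF J1(1)[of k] J2(1)[of k]]])
       (use le in auto)
  have le_k: "(\<integral>p. \<bar>circ_product h p k\<bar> \<partial>?J) \<le> 4" for k
  proof -
    have "(\<integral>p. \<bar>circ_product h p k\<bar> \<partial>?J) \<le> (\<integral>p. (scaled_eigenvalue h k (fst p))\<^sup>2 + (scaled_eigenvalue h k (snd p))\<^sup>2 \<partial>?J)"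
      by (intro integral_mono int_k Bochner_Integration.integrable_add J1 J2 le)
    also have "\<dots> \<le> 4" using J1[of k] J2[of k] by simp
    finally show ?thesis .
  qed
  have emp: "(\<integral>y. \<bar>y\<bar> \<partial>empirical m (circ_product h p)) = (1 / m) *\<^sub>R (\<Sum>k<m. \<bar>circ_product h p k\<bar>)" for p
    by (rule integral_empirical[OF m]) measurable
  show "integrable ?J (\<lambda>p. \<integral>y. \<bar>y\<bar> \<partial>empirical (2 * h - 1) (circ_product h p))"
    unfolding m_def[symmetric] emp
    by (intro integrable_scaleR_right Bochner_Integration.integrable_sum int_k)
  have "(\<integral>p. (\<integral>y. \<bar>y\<bar> \<partial>empirical m (circ_product h p)) \<partial>?J) = (1 / m) * (\<Sum>k<m. \<integral>p. \<bar>circ_product h p k\<bar> \<partial>?J)"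
    unfolding emp using int_k by simp
  also have "\<dots> \<le> (1 / m) * (\<Sum>k<m. 4)" by (intro mult_left_mono sum_mono le_k) auto
  also have "\<dots> = 4" using m by simp
  finally show "(\<integral>p. (\<integral>y. \<bar>y\<bar> \<partial>empirical (2 * h - 1) (circ_product h p)) \<partial>?J) \<le> 4" by (simp add: m_def)
qed

lemma empirical_cdf_tendsto_in_prob:
  assumes D: "pte_law D" and E: "pte_law E"
    and x: "isCont (cdf (density lborel chi_conv)) x" and \<epsilon>: "\<epsilon> > 0"
  defines "bad \<equiv> \<lambda>h. {p \<in> space (coeff_law D E h).
      \<epsilon> < \<bar>cdf (empirical (2 * h - 1) (circ_product h p)) x - cdf (density lborel chi_conv) x\<bar>}"
  shows "\<And>h. h > 0 \<Longrightarrow> bad h \<in> sets (coeff_law D E h)"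
    and "(\<lambda>h. measure (coeff_law D E h) (bad h)) \<longlonglongrightarrow> 0"
proof -
  let ?J = "coeff_law D E" and ?\<mu> = "density lborel chi_conv"
  let ?emp = "\<lambda>h p. empirical (2 * h - 1) (circ_product h p)"
  note [measurable] = circ_product_measurable[OF D E]
  have cdf_meas: "(\<lambda>p. cdf (?emp h p) x) \<in> borel_measurable (?J h)" if h: "h > 0" for h
  proof -
    have m: "2 * h - 1 > 0" using h by simp
    have "cdf (?emp h p) x = (\<Sum>k<2 * h - 1. indicator {..x} (circ_product h p k)) / real (2 * h - 1)" for p
    proof -
      have "real (card {k. k < 2 * h - 1 \<and> circ_product h p k \<le> x})
          = (\<Sum>k\<in>{..<2 * h - 1} \<inter> {k. circ_product h p k \<le> x}. 1)"
        by (simp add: Collect_conj_eq lessThan_def)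
      also have "\<dots> = (\<Sum>k<2 * h - 1. indicator {..x} (circ_product h p k))"
        by (subst sum.inter_restrict) (auto intro!: sum.cong split: split_indicator)
      finally show ?thesis by (simp only: cdf_empirical[OF m])
    qed
    then show ?thesis by simp
  qed
  show bad_meas: "bad h \<in> sets (?J h)" if h: "h > 0" for h
    unfolding bad_def using cdf_meas[OF h] by measurable
  show "(\<lambda>h. measure (?J h) (bad h)) \<longlonglongrightarrow> 0"
  proof (rule tendstoI)
    fix e :: real assume e: "e > 0"
    \<comment> \<open>The expected first absolute moment is at most 4, so that it exceeds \<open>8 / e\<close> with probability at most \<open>e / 2\<close>.\<close>
    obtain n0 :: nat and \<delta> :: real where \<delta>: "\<delta> > 0"
      and close: "\<forall>\<nu>. real_distribution \<nu> \<longrightarrow> integrable \<nu> (\<lambda>y. y) \<longrightarrow> (\<integral>y. \<bar>y\<bar> \<partial>\<nu>) \<le> 8 / e \<longrightarrow>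
        (\<forall>i\<le>n0. cmod (char \<nu> (of_rat (from_nat i)) - char ?\<mu> (of_rat (from_nat i))) < \<delta>) \<longrightarrow>
        \<bar>cdf \<nu> x - cdf ?\<mu> x\<bar> \<le> \<epsilon>"
      using cdf_close_of_char_close[OF real_distribution_chi_conv x \<epsilon>, of "8 / e"] by (elim exE conjE)
    define t where "t = (\<lambda>i::nat. of_rat (from_nat i) :: real)"
    define V where "V = (\<lambda>h i p. (cmod (char (?emp h p) (t i) - normal_product_char (2 * t i)))\<^sup>2)"
    define S where "S = (\<lambda>h p. \<integral>y. \<bar>y\<bar> \<partial>?emp h p)"
    define B where "B = (\<lambda>h. (\<Sum>i\<le>n0. (16 * (clt_error D h + clt_error E h) * (t i)\<^sup>2 + 16 / real (2 * h - 1)) / \<delta>\<^sup>2))"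
    have bound: "measure (?J h) (bad h) \<le> B h + e / 2" if h: "h > 0" for h
    proof -
      interpret J: prob_space "?J h" by (rule prob_space_coeff_law[OF D E])
      have m: "2 * h - 1 > 0" using h by simp
      have char_eq: "char (?emp h p) s = (1 / real (2 * h - 1)) *\<^sub>R (\<Sum>k<2 * h - 1. iexp (s * circ_product h p k))" for p s
        unfolding char_def by (rule integral_empirical[OF m]) measurable
      have V_meas [measurable]: "V h i \<in> borel_measurable (?J h)" for i
        unfolding V_def char_eq by measurable
      have V_int: "integrable (?J h) (V h i)" for i
      proof (rule J.integrable_const_bound[where B = 4])
        have "cmod (char (?emp h p) (t i) - normal_product_char (2 * t i)) \<le> 1 + 1" for p
          using real_distribution.cmod_char_le_1[OF real_distribution_empirical, of "2 * h - 1" "circ_product h p" "t i"]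
            normal_product_char_bounds[of "2 * t i"]
          by (intro order_trans[OF norm_triangle_ineq4] add_mono) auto
        then have "V h i p \<le> 2\<^sup>2" for p unfolding V_def by (intro power_mono) auto
        then show "AE p in ?J h. norm (V h i p) \<le> 4" by (auto simp: V_def)
      qed simp
      have S_int: "integrable (?J h) (S h)" and S_le: "(\<integral>p. S h p \<partial>?J h) \<le> 4"
        unfolding S_def using empirical_first_moment[OF D E h] by auto
      note [measurable] = borel_measurable_integrable[OF S_int]
      define Bad1 where "Bad1 = (\<lambda>i. {p \<in> space (?J h). \<delta>\<^sup>2 \<le> V h i p})"
      define Bad2 where "Bad2 = {p \<in> space (?J h). 8 / e \<le> S h p}"
      have Bad1: "Bad1 i \<in> sets (?J h)" for i unfolding Bad1_def by measurable
      have Bad2: "Bad2 \<in> sets (?J h)" unfolding Bad2_def by measurable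
      have Bad1_UN: "(\<Union>i\<in>{..n0}. Bad1 i) \<in> sets (?J h)" using Bad1 by blast
      have "measure (?J h) (Bad1 i) \<le> (\<integral>p. V h i p \<partial>?J h) / \<delta>\<^sup>2" for i
        unfolding Bad1_def
        by (rule integral_Markov_inequality_measure[where A = "{}"]) (use \<delta> V_int in \<open>simp_all add: V_def\<close>)
      moreover have "(\<integral>p. V h i p \<partial>?J h) \<le> 16 * (clt_error D h + clt_error E h) * (t i)\<^sup>2 + 16 / real (2 * h - 1)" for i
        unfolding V_def by (rule empirical_char_second_moment[OF D E h])
      ultimately have b1: "measure (?J h) (Bad1 i) \<le> (16 * (clt_error D h + clt_error E h) * (t i)\<^sup>2 + 16 / real (2 * h - 1)) / \<delta>\<^sup>2" for i
        by (rule order_trans[OF _ divide_right_mono]) simp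
      have "measure (?J h) Bad2 \<le> (\<integral>p. S h p \<partial>?J h) / (8 / e)"
        unfolding Bad2_def
        by (rule integral_Markov_inequality_measure[where A = "{}"]) (use e S_int in \<open>simp_all add: S_def\<close>)
      also have "\<dots> \<le> 4 / (8 / e)" using S_le e by (intro divide_right_mono) auto
      finally have b2: "measure (?J h) Bad2 \<le> e / 2" by simp
      have "bad h \<subseteq> (\<Union>i\<in>{..n0}. Bad1 i) \<union> Bad2"
      proof
        fix p assume p: "p \<in> bad h"
        show "p \<in> (\<Union>i\<in>{..n0}. Bad1 i) \<union> Bad2"
        proof (rule ccontr)
          assume n: "p \<notin> (\<Union>i\<in>{..n0}. Bad1 i) \<union> Bad2"
          have sp: "p \<in> space (?J h)" using p by (simp add: bad_def)
          have "\<bar>cdf (?emp h p) x - cdf ?\<mu> x\<bar> \<le> \<epsilon>"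
          proof (rule close[rule_format, OF real_distribution_empirical])
            show "integrable (?emp h p) (\<lambda>y. y)" by (rule integrable_empirical[OF m]) simp
            show "(\<integral>y. \<bar>y\<bar> \<partial>?emp h p) \<le> 8 / e" using n sp by (auto simp: Bad2_def S_def)
            fix i assume "i \<le> n0"
            then have "V h i p < \<delta>\<^sup>2" using n sp by (auto simp: Bad1_def not_le)
            then have "cmod (char (?emp h p) (t i) - normal_product_char (2 * t i)) < \<delta>"
              unfolding V_def by (rule power_less_imp_less_base) (use \<delta> in simp)
            then show "cmod (char (?emp h p) (of_rat (from_nat i)) - char ?\<mu> (of_rat (from_nat i))) < \<delta>"
              unfolding char_chi_conv t_def .
          qed
          then show False using p by (simp add: bad_def)
        qed
      qed
      then have "measure (?J h) (bad h) \<le> measure (?J h) ((\<Union>i\<in>{..n0}. Bad1 i) \<union> Bad2)"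
        by (rule J.finite_measure_mono) (rule sets.Un[OF Bad1_UN Bad2])
      also have "\<dots> \<le> measure (?J h) (\<Union>i\<in>{..n0}. Bad1 i) + measure (?J h) Bad2"
        by (rule measure_Un_le[OF Bad1_UN Bad2])
      also have "\<dots> \<le> (\<Sum>i\<le>n0. measure (?J h) (Bad1 i)) + measure (?J h) Bad2"
        by (rule add_right_mono, rule J.finite_measure_subadditive_finite) (use Bad1 in blast)+
      also have "\<dots> \<le> B h + e / 2"
        unfolding B_def by (intro add_mono sum_mono b1 b2)
      finally show ?thesis .
    qed
    have "B \<longlonglongrightarrow> (\<Sum>i\<le>n0. (16 * (0 + 0) * (t i)\<^sup>2 + 0) / \<delta>\<^sup>2)"
      unfolding B_def
    proof (intro tendsto_intros clt_error_tendsto)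
      show "(\<lambda>h. 16 / real (2 * h - 1)) \<longlonglongrightarrow> 0" by real_asymp
    qed (use \<delta> in auto)
    then have "\<forall>\<^sub>F h in sequentially. B h < e / 2" using e by (intro order_tendstoD(2)[where y = 0]) auto
    then show "\<forall>\<^sub>F h in sequentially. dist (measure (?J h) (bad h)) 0 < e"
      using eventually_gt_at_top[of 0]
    proof eventually_elim
      case (elim h)
      then show ?case using bound[of h] by simp
    qed
  qed
qed

section \<open>The random matrices\<close>

lemma palindromic_toeplitz_cong:
  assumes "h > 0" and "\<And>i. i < h \<Longrightarrow> b i = c i"
  shows "palindromic_toeplitz (2 * h) b = palindromic_toeplitz (2 * h) c"
  unfolding palindromic_toeplitz_def
  by (intro eq_matI) (use assms in \<open>auto simp: Let_def intro!: assms(2)\<close>)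

text \<open>
  The first half of the first row of a palindromic Toeplitz matrix of order \<open>2 * h\<close>: the coefficients
  that determine the matrix, as a measurable function of the matrix. In this way the independence of
  the two matrices passes to their coefficients.
\<close>
definition first_row :: "nat \<Rightarrow> real mat \<Rightarrow> nat \<Rightarrow> real" where
  "first_row h X = (\<lambda>i\<in>{..<h}. X $$ (0, i))"

lemma first_row_measurable:
  assumes h: "h > 0"
  shows "first_row h \<in> mat_borel (2 * h) \<rightarrow>\<^sub>M (\<Pi>\<^sub>M i\<in>{..<h}. borel)"
  unfolding first_row_def
proof (rule measurable_restrict)
  fix i assume i: "i \<in> {..<h}"
  let ?I = "{..<2 * h} \<times> {..<2 * h}" and ?e = "\<lambda>X. \<lambda>p\<in>{..<2 * h} \<times> {..<2 * h}. X $$ p"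
  have "?e \<in> mat_borel (2 * h) \<rightarrow>\<^sub>M (\<Pi>\<^sub>M p\<in>?I. borel)"
    unfolding mat_borel_def by (rule measurable_vimage_algebra1) (auto simp: space_PiM)
  moreover have "(\<lambda>f. f (0, i)) \<in> (\<Pi>\<^sub>M p\<in>?I. borel) \<rightarrow>\<^sub>M borel"
    using i h by (intro measurable_component_singleton) auto
  ultimately have "(\<lambda>X. ?e X (0, i)) \<in> mat_borel (2 * h) \<rightarrow>\<^sub>M borel" by (rule measurable_compose)
  then show "(\<lambda>X. X $$ (0, i)) \<in> mat_borel (2 * h) \<rightarrow>\<^sub>M borel" using i h by simp
qed

lemma pte_random_matrix_first_row:
  assumes M: "prob_space M" and h: "h > 0" and A: "pte_random_matrix M D (2 * h) A"
    and D: "pte_law D"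
  shows "\<And>\<omega>. \<omega> \<in> space M \<Longrightarrow> A \<omega> = palindromic_toeplitz (2 * h) (first_row h (A \<omega>))"
    and "distr M (\<Pi>\<^sub>M i\<in>{..<h}. borel) (\<lambda>\<omega>. first_row h (A \<omega>)) = iid_law D h"
proof -
  interpret prob_space M by fact
  obtain b where b: "indep_vars (\<lambda>_. borel) b {..<h}" "\<And>i. i < h \<Longrightarrow> distr M borel (b i) = D"
      "\<And>\<omega>. \<omega> \<in> space M \<Longrightarrow> A \<omega> = palindromic_toeplitz (2 * h) (\<lambda>i. b i \<omega>)"
    using A by (auto simp: pte_random_matrix_def)
  have row: "first_row h (A \<omega>) = (\<lambda>i\<in>{..<h}. b i \<omega>)" if "\<omega> \<in> space M" for \<omega>
    unfolding b(3)[OF that] first_row_def palindromic_toeplitz_def using h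
    by (intro restrict_ext) (auto simp: Let_def)
  show "A \<omega> = palindromic_toeplitz (2 * h) (first_row h (A \<omega>))" if "\<omega> \<in> space M" for \<omega>
  proof -
    have "palindromic_toeplitz (2 * h) (\<lambda>i\<in>{..<h}. b i \<omega>) = palindromic_toeplitz (2 * h) (\<lambda>i. b i \<omega>)"
      by (rule palindromic_toeplitz_cong[OF h]) simp
    then show ?thesis unfolding row[OF that] using b(3)[OF that] by (rule trans[OF _ sym, rotated])
  qed
  have ne: "{..<h} \<noteq> {}" using h by auto
  have rv: "random_variable borel (b i)" if "i \<in> {..<h}" for i
    using b(1) that by (auto simp: indep_vars_def)
  have "distr M (\<Pi>\<^sub>M i\<in>{..<h}. borel) (\<lambda>\<omega>. first_row h (A \<omega>)) = distr M (\<Pi>\<^sub>M i\<in>{..<h}. borel) (\<lambda>\<omega>. \<lambda>i\<in>{..<h}. b i \<omega>)"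
    by (intro distr_cong refl) (simp add: row)
  also have "\<dots> = (\<Pi>\<^sub>M i\<in>{..<h}. distr M borel (b i))"
    using indep_vars_iff_distr_eq_PiM'[OF ne rv] b(1) by simp
  also have "\<dots> = iid_law D h"
    unfolding iid_law_def by (intro PiM_cong) (auto simp: b(2))
  finally show "distr M (\<Pi>\<^sub>M i\<in>{..<h}. borel) (\<lambda>\<omega>. first_row h (A \<omega>)) = iid_law D h" .
qed

lemma sets_iid_law: "pte_law D \<Longrightarrow> sets (iid_law D h) = sets (\<Pi>\<^sub>M i\<in>{..<h}. borel)"
  unfolding iid_law_def by (intro sets_PiM_cong) (auto simp: pte_law_sets)

lemma first_rows_joint_law:
  assumes M: "prob_space M" and D: "pte_law D" and E: "pte_law E" and h: "h > 0"
    and A: "pte_random_matrix M D (2 * h) A" and B: "pte_random_matrix M E (2 * h) B"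
    and indep: "prob_space.indep_var M (mat_borel (2 * h)) A (mat_borel (2 * h)) B"
  shows "(\<lambda>\<omega>. (first_row h (A \<omega>), first_row h (B \<omega>))) \<in> M \<rightarrow>\<^sub>M coeff_law D E h"
    and "distr M (coeff_law D E h) (\<lambda>\<omega>. (first_row h (A \<omega>), first_row h (B \<omega>))) = coeff_law D E h"
proof -
  interpret prob_space M by fact
  let ?P = "\<Pi>\<^sub>M i\<in>{..<h}. borel :: real measure"
  have "indep_var ?P (first_row h \<circ> A) ?P (first_row h \<circ> B)"
    by (rule indep_var_compose[OF indep first_row_measurable[OF h] first_row_measurable[OF h]])
  then have ind: "indep_var ?P (\<lambda>\<omega>. first_row h (A \<omega>)) ?P (\<lambda>\<omega>. first_row h (B \<omega>))"
    by (simp add: o_def)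
  have meas: "(\<lambda>\<omega>. first_row h (A \<omega>)) \<in> M \<rightarrow>\<^sub>M ?P" "(\<lambda>\<omega>. first_row h (B \<omega>)) \<in> M \<rightarrow>\<^sub>M ?P"
    using indep_var_rv1[OF ind] indep_var_rv2[OF ind] by auto
  have sets: "sets (?P \<Otimes>\<^sub>M ?P) = sets (coeff_law D E h)"
    unfolding coeff_law_def using sets_iid_law[OF D] sets_iid_law[OF E] by (intro sets_pair_measure_cong) auto
  have "(\<lambda>\<omega>. (first_row h (A \<omega>), first_row h (B \<omega>))) \<in> M \<rightarrow>\<^sub>M ?P \<Otimes>\<^sub>M ?P"
    using meas by (rule measurable_Pair)
  then show "(\<lambda>\<omega>. (first_row h (A \<omega>), first_row h (B \<omega>))) \<in> M \<rightarrow>\<^sub>M coeff_law D E h"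
    using measurable_cong_sets[OF refl sets] by blast
  have "distr M (coeff_law D E h) (\<lambda>\<omega>. (first_row h (A \<omega>), first_row h (B \<omega>)))
      = distr M (?P \<Otimes>\<^sub>M ?P) (\<lambda>\<omega>. (first_row h (A \<omega>), first_row h (B \<omega>)))"
    by (rule distr_cong[OF refl sets[symmetric] refl])
  also have "\<dots> = distr M ?P (\<lambda>\<omega>. first_row h (A \<omega>)) \<Otimes>\<^sub>M distr M ?P (\<lambda>\<omega>. first_row h (B \<omega>))"
    using ind by (simp add: indep_var_distribution_eq)
  also have "\<dots> = coeff_law D E h"
    unfolding coeff_law_def pte_random_matrix_first_row(2)[OF M h A D] pte_random_matrix_first_row(2)[OF M h B E] ..
  finally show "distr M (coeff_law D E h) (\<lambda>\<omega>. (first_row h (A \<omega>), first_row h (B \<omega>))) = coeff_law D E h" .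
qed

lemma scaled_esd_near_empirical:
  assumes h: "h > 0"
  shows "\<bar>scaled_esd (anticommutator (palindromic_toeplitz (2 * h) b) (palindromic_toeplitz (2 * h) c)) x
     - cdf (empirical (2 * h - 1) (circ_product h (b, c))) x\<bar> \<le> 3 / real (2 * h)"
proof -
  have m: "2 * h - 1 > 0" using h by simp
  have "circ_product h (b, c) k = 2 * circ_eigenvalue h k b * circ_eigenvalue h k c / real (2 * h)" for k
    by (simp add: circ_product_def scaled_eigenvalue_def)
  then show ?thesis
    using scaled_esd_anticommutator_palindromic_toeplitz[OF h, of b c x] by (simp only: cdf_empirical[OF m])
qed

theorem corollary1p12:
  fixes M :: "'w measure"
    and D E :: "real measure"
    and A B :: "nat \<Rightarrow> 'w \<Rightarrow> real mat"
  assumes "prob_space M"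
    and "pte_law D" and "pte_law E"
    and "\<And>N. even N \<Longrightarrow> N > 0 \<Longrightarrow> pte_random_matrix M D N (A N)"
    and "\<And>N. even N \<Longrightarrow> N > 0 \<Longrightarrow> pte_random_matrix M E N (B N)"
    and "\<And>N. even N \<Longrightarrow> N > 0 \<Longrightarrow>
           prob_space.indep_var M (mat_borel N) (A N) (mat_borel N) (B N)"
  shows "limiting_spectral_density M
           (\<lambda>n \<omega>. anticommutator (A (2 * n) \<omega>) (B (2 * n) \<omega>))
           (density_convolution (chi_squared_density 1) (neg_chi_squared_density 1))"
proof -
  let ?\<mu> = "density lborel chi_conv"
  let ?C = "\<lambda>n \<omega>. anticommutator (A (2 * n) \<omega>) (B (2 * n) \<omega>)"
  note D = assms(2) and E = assms(3)
  have "weak_conv_in_prob M (\<lambda>n \<omega>. scaled_esd (?C n \<omega>)) (cdf ?\<mu>)"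
    unfolding weak_conv_in_prob_def
  proof (intro allI impI)
    fix x \<epsilon> :: real assume x: "isCont (cdf ?\<mu>) x" and \<epsilon>: "\<epsilon> > 0"
    \<comment> \<open>The other half of \<open>\<epsilon>\<close> absorbs the deterministic error \<open>3 / N\<close>.\<close>
    define bad where "bad = (\<lambda>h. {p \<in> space (coeff_law D E h).
      \<epsilon> / 2 < \<bar>cdf (empirical (2 * h - 1) (circ_product h p)) x - cdf ?\<mu> x\<bar>})"
    have bad_sets: "bad h \<in> sets (coeff_law D E h)" if "h > 0" for h
      unfolding bad_def by (rule empirical_cdf_tendsto_in_prob(1)[OF D E x _ that]) (use \<epsilon> in simp)
    have bad_lim: "(\<lambda>h. measure (coeff_law D E h) (bad h)) \<longlonglongrightarrow> 0"
      unfolding bad_def by (rule empirical_cdf_tendsto_in_prob(2)[OF D E x]) (use \<epsilon> in simp)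
    define S where "S = (\<lambda>h. {\<omega> \<in> space M. \<epsilon> < \<bar>scaled_esd (?C h \<omega>) x - cdf ?\<mu> x\<bar>})"
    have le: "outer_measure_of M (S h) \<le> ennreal (measure (coeff_law D E h) (bad h))"
      if h: "h > 0" and small: "3 / real (2 * h) < \<epsilon> / 2" for h
    proof -
      interpret J: prob_space "coeff_law D E h" by (rule prob_space_coeff_law[OF D E])
      have A: "pte_random_matrix M D (2 * h) (A (2 * h))" and B: "pte_random_matrix M E (2 * h) (B (2 * h))"
        and ind: "prob_space.indep_var M (mat_borel (2 * h)) (A (2 * h)) (mat_borel (2 * h)) (B (2 * h))"
        using assms(4-6)[of "2 * h"] h by auto
      define T where "T = (\<lambda>\<omega>. (first_row h (A (2 * h) \<omega>), first_row h (B (2 * h) \<omega>)))"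
      have T: "T \<in> M \<rightarrow>\<^sub>M coeff_law D E h" and dT: "distr M (coeff_law D E h) T = coeff_law D E h"
        unfolding T_def by (rule first_rows_joint_law[OF assms(1) D E h A B ind])+
      have sub: "S h \<subseteq> T -` bad h \<inter> space M"
      proof
        fix \<omega> assume "\<omega> \<in> S h"
        then have \<omega>: "\<omega> \<in> space M" and big: "\<epsilon> < \<bar>scaled_esd (?C h \<omega>) x - cdf ?\<mu> x\<bar>"
          by (simp_all add: S_def)
        have "\<bar>scaled_esd (?C h \<omega>) x - cdf (empirical (2 * h - 1) (circ_product h (T \<omega>))) x\<bar> \<le> 3 / real (2 * h)"
          unfolding T_def
          using scaled_esd_near_empirical[OF h, of "first_row h (A (2 * h) \<omega>)" "first_row h (B (2 * h) \<omega>)" x]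
            pte_random_matrix_first_row(1)[OF assms(1) h A D \<omega>] pte_random_matrix_first_row(1)[OF assms(1) h B E \<omega>]
          by simp
        then have "\<epsilon> / 2 < \<bar>cdf (empirical (2 * h - 1) (circ_product h (T \<omega>))) x - cdf ?\<mu> x\<bar>"
          using big small by linarith
        moreover have "T \<omega> \<in> space (coeff_law D E h)" using measurable_space[OF T \<omega>] .
        ultimately show "\<omega> \<in> T -` bad h \<inter> space M" using \<omega> by (simp add: bad_def)
      qed
      have "outer_measure_of M (S h) \<le> emeasure M (T -` bad h \<inter> space M)"
        unfolding outer_measure_of_def
        by (rule INF_lower) (use sub measurable_sets[OF T bad_sets[OF h]] in auto)
      also have "\<dots> = emeasure (distr M (coeff_law D E h) T) (bad h)"
        by (rule emeasure_distr[OF T bad_sets[OF h], symmetric])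
      also have "\<dots> = ennreal (measure (coeff_law D E h) (bad h))"
        unfolding dT by (rule J.emeasure_eq_measure)
      finally show ?thesis .
    qed
    have "(\<lambda>h. 3 / real (2 * h)) \<longlonglongrightarrow> 0" by real_asymp
    then have "\<forall>\<^sub>F h in sequentially. 3 / real (2 * h) < \<epsilon> / 2"
      using \<epsilon> by (intro order_tendstoD(2)[where y = 0]) auto
    then have ev: "\<forall>\<^sub>F h in sequentially. outer_measure_of M (S h) \<le> ennreal (measure (coeff_law D E h) (bad h))"
      using eventually_gt_at_top[of 0] by eventually_elim (rule le)
    have "(\<lambda>h. ennreal (measure (coeff_law D E h) (bad h))) \<longlonglongrightarrow> 0"
      using tendsto_ennrealI[OF bad_lim] by simp
    then have "(\<lambda>h. outer_measure_of M (S h)) \<longlonglongrightarrow> 0"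
      by (rule tendsto_sandwich[OF _ ev tendsto_const, rotated]) simp
    then show "(\<lambda>n. outer_measure_of M {\<omega> \<in> space M. \<epsilon> < \<bar>scaled_esd (?C n \<omega>) x - cdf ?\<mu> x\<bar>}) \<longlonglongrightarrow> 0"
      by (simp add: S_def)
  qed
  then show ?thesis
    unfolding limiting_spectral_density_def limiting_spectral_distribution_def
    using chi_conv_measurable real_distribution_chi_conv by blast
qed

end
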